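(* If $u$ is an inner function, then $$\mathscr{R}(\mathcal{K}_u) = \mathcal{K}_{u} \cap \mathscr{R}(H^2) = \{f \in \mathcal{K}_u: \widehat{f}(n) = O(e^{-c_f \sqrt{n}}) \text{ as } n\to\infty \text{ for some constant } c_f>0\}.$$
   Context: $\mathbb{D}$ is the open unit disk, $\mathbb{T}$ the unit circle, $m$ normalized Lebesgue measure on $\mathbb{T}$, $H^2$ the Hardy space (viewed as a closed subspace of $L^2(\mathbb{T})$), $H^\infty$ the bounded analytic functions on $\mathbb{D}$, and $\widehat f(n)$ the $n$-th Taylor (Fourier) coefficient of $f$. An inner function is a $u\in H^\infty$ with unimodular radial boundary values almost everywhere on $\mathbb{T}$. $\mathcal{O}$ is the class of outer functions, i.e. functions of the form $\gamma\exp\big(\int_{\mathbb{T}} \frac{\xi + z}{\xi - z} W(\xi)\, dm(\xi)\big)$ with $|\gamma|=1$ and $W$ extended real-valued and integrable on $\mathbb{T}$. For $\phi\in H^\infty$, the co-analytic Toeplitz operator $T_{\overline\phi}:H^2\to H^2$ is $T_{\overline\phi}f=P_+(\overline\phi f)$, where $P_+$ is the orthogonal projection of $L^2(\mathbb{T})$ onto $H^2$. The model space is $\mathcal{K}_u=(uH^2)^\perp$ (orthogonal complement in $H^2$); it is invariant under every $T_{\overline\phi}$, $\phi\in H^\infty$. Define $$\mathscr{R}(H^2) = \bigcap \{T_{\overline{\phi}} H^2: \phi \in H^{\infty} \setminus \{0\}\},\qquad \mathscr{R}(\mathcal{K}_u) = \bigcap \{T_{\overline{\phi}} \mathcal{K}_u: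 \phi \in H^{\infty}\cap \mathcal{O}\}.$$ Known theorem of McCarthy (may be assumed): $\mathscr{R}(H^2) = \{f \in H^{\infty}: \widehat{f}(n) = O(e^{-c_f \sqrt{n}}) \text{ for some } c_f>0\}$. *)

theory Defs
  imports "HOL-Complex_Analysis.Complex_Analysis" "HOL-Probability.Probability"
    "HOL-Library.Landau_Symbols"
begin

text \<open>
  Elements of \<open>L\<^sup>2(\<bbbT>)\<close> are represented by functions \<open>complex \<Rightarrow> complex\<close> of which only the values
  on the unit circle matter, up to equality almost everywhere. Every set of such functions below is
  closed under almost everywhere equality of measurable functions, so that equality of two of these
  sets is equality of the corresponding sets of equivalence classes. Functions on the disk, by
  contrast, are represented by functions of which only the values on \<open>ball 0 1\<close> matter.
\<close>

definition circle_measure :: "complex measure" where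
  "circle_measure =
     distr (uniform_measure lborel {0..2 * pi}) (restrict_space borel (sphere 0 1)) cis"

definition L2 :: "(complex \<Rightarrow> complex) set" where
  "L2 = {f \<in> borel_measurable circle_measure.
           integrable circle_measure (\<lambda>\<zeta>. (norm (f \<zeta>))\<^sup>2)}"

definition l2_inner :: "(complex \<Rightarrow> complex) \<Rightarrow> (complex \<Rightarrow> complex) \<Rightarrow> complex" where
  "l2_inner f g = (\<integral>\<zeta>. f \<zeta> * cnj (g \<zeta>) \<partial>circle_measure)"

definition fourier_coeff :: "(complex \<Rightarrow> complex) \<Rightarrow> int \<Rightarrow> complex" where
  "fourier_coeff f k = l2_inner f (\<lambda>\<zeta>. \<zeta> powi k)"

definition H2 :: "(complex \<Rightarrow> complex) set" where
  "H2 = {f \<in> L2. \<forall>k<0. fourier_coeff f k = 0}"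

definition ae_closure :: "(complex \<Rightarrow> complex) set \<Rightarrow> (complex \<Rightarrow> complex) set" where
  "ae_closure A = {f \<in> borel_measurable circle_measure.
                     \<exists>g\<in>A. AE \<zeta> in circle_measure. f \<zeta> = g \<zeta>}"

definition Hinf :: "(complex \<Rightarrow> complex) set" where
  "Hinf = {\<phi>. \<phi> holomorphic_on ball 0 1 \<and> bounded (\<phi> ` ball 0 1)}"

text \<open>
  For bounded holomorphic \<open>\<phi>\<close> the radial limit exists almost everywhere (Fatou); where it does not,
  \<^const>\<open>Lim\<close> takes one fixed unspecified value, so the boundary function is still measurable.
\<close>

definition boundary :: "(complex \<Rightarrow> complex) \<Rightarrow> complex \<Rightarrow> complex" where
  "boundary \<phi> \<zeta> = Lim (at_left 1) (\<lambda>r. \<phi> (complex_of_real r * \<zeta>))"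

definition inner_function :: "(complex \<Rightarrow> complex) \<Rightarrow> bool" where
  "inner_function u \<longleftrightarrow> u \<in> Hinf \<and>
     (AE \<zeta> in circle_measure.
        \<exists>l. ((\<lambda>r. u (complex_of_real r * \<zeta>)) \<longlongrightarrow> l) (at_left 1) \<and> norm l = 1)"

text \<open>
  An integrable extended real-valued \<open>W\<close> is finite almost everywhere and enters only through
  integrals, so it is taken real-valued.
\<close>

definition outer_function :: "(complex \<Rightarrow> complex) \<Rightarrow> bool" where
  "outer_function \<phi> \<longleftrightarrow>
     (\<exists>\<gamma> (W :: complex \<Rightarrow> real). norm \<gamma> = 1 \<and> integrable circle_measure W \<and>
        (\<forall>z\<in>ball 0 1. \<phi> z =
           \<gamma> * exp (\<integral>\<xi>. (\<xi> + z) / (\<xi> - z) * complex_of_real (W \<xi>) \<partial>circle_measure)))"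

text \<open>A representative of the orthogonal projection; it is unique up to a null set.\<close>

definition P_plus :: "(complex \<Rightarrow> complex) \<Rightarrow> complex \<Rightarrow> complex" where
  "P_plus h = (SOME f. f \<in> H2 \<and> (\<forall>g\<in>H2. l2_inner (\<lambda>\<zeta>. h \<zeta> - f \<zeta>) g = 0))"

definition coanalytic_toeplitz ::
    "(complex \<Rightarrow> complex) \<Rightarrow> (complex \<Rightarrow> complex) \<Rightarrow> complex \<Rightarrow> complex" where
  "coanalytic_toeplitz \<phi> f = P_plus (\<lambda>\<zeta>. cnj (boundary \<phi> \<zeta>) * f \<zeta>)"

definition model_space :: "(complex \<Rightarrow> complex) \<Rightarrow> (complex \<Rightarrow> complex) set" where
  "model_space u = {f \<in> H2. \<forall>g\<in>H2. l2_inner f (\<lambda>\<zeta>. boundary u \<zeta> * g \<zeta>) = 0}"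

definition common_range_H2 :: "(complex \<Rightarrow> complex) set" where
  "common_range_H2 =
     (\<Inter>\<phi>\<in>{\<phi> \<in> Hinf. \<exists>z\<in>ball 0 1. \<phi> z \<noteq> 0}. ae_closure (coanalytic_toeplitz \<phi> ` H2))"

definition common_range_model :: "(complex \<Rightarrow> complex) \<Rightarrow> (complex \<Rightarrow> complex) set" where
  "common_range_model u =
     (\<Inter>\<phi>\<in>{\<phi> \<in> Hinf. outer_function \<phi>}. ae_closure (coanalytic_toeplitz \<phi> ` model_space u))"

definition root_exp_decay :: "(complex \<Rightarrow> complex) \<Rightarrow> bool" where
  "root_exp_decay f \<longleftrightarrow>
     (\<exists>c>0. (\<lambda>n::nat. norm (fourier_coeff f (int n))) \<in> O(\<lambda>n. exp (- c * sqrt (real n))))"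

end

theory Submission
  imports Defs "HOL-Real_Asymp.Real_Asymp"
begin

text \<open>
  Co-analytic Toeplitz operators with bounded symbols commute, and the one with an outer symbol
  \<open>\<phi>\<close> is injective, since \<open>\<phi> H\<^sup>2\<close> is dense. If \<open>f = T h\<close> lies in the model space, where \<open>T\<close> is
  such an operator, then \<open>T\<close> also annihilates the image of \<open>h\<close> under the operator with symbol
  \<open>cnj u\<close>; so that image vanishes and \<open>h\<close> lies in the model space. Conversely, every non-zero
  \<open>\<phi>\<close> in \<open>H\<^sup>\<infinity>\<close> dominates on the circle the modulus of a bounded outer function \<open>\<psi>\<close>, because
  \<open>ln \<bar>\<phi>\<bar>\<close> is integrable there, and then the range for \<open>\<psi>\<close> is contained in the range for \<open>\<phi>\<close>.

  The boundary values behind this come from Fatou's theorem: a bounded analytic function has a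
  primitive that is absolutely continuous on the circle, hence differentiable almost everywhere
  (by Henstock's lemma and Vitali's covering theorem), and Cauchy's formula turns a tangential
  derivative of the primitive into a radial limit.
\<close>

section \<open>Differentiation of indefinite integrals almost everywhere\<close>

text \<open>The definitions speak of radial limits, whereas orthogonality and projections speak of
  Fourier coefficients. One bridge joins them: the radial limit function of a bounded analytic
  function exists almost everywhere and has the Taylor coefficients as its Fourier coefficients.
  Beyond it, functions on the circle are identified by comparing coefficients or inner products. A
  second obstacle is the boundary modulus of an outer function whose \<open>W\<close> is unbounded.
  The modulus is computed for bounded \<open>W\<close> only; unbounded \<open>W\<close> are cut off
  from below, and monotonicity of the Poisson integral carries the estimates over. The same cut-off
  gives integrability of the logarithm: \<open>\<phi>\<close> divided by the outer functions of the
  truncated modulus stays bounded at one point, uniformly in the truncation. Finally, the known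
  description of the range in H^2 asks for boundary functions of bounded analytic functions, while
  the claim asks only for decay inside the model space. Decay of order
  \<open>exp (- c * sqrt n)\<close> makes the Fourier series absolutely convergent, which closes
  this gap.\<close>

lemma sum_content_bad_intervals:
  fixes f :: "real \<Rightarrow> 'b::euclidean_space"
  assumes gauge: "\<And>p. p tagged_partial_division_of cbox a b \<Longrightarrow> \<gamma> fine p \<Longrightarrow>
             (\<Sum>(x,K)\<in>p. norm (measure lborel K *\<^sub>R f x - integral K f)) < e * l"
    and l: "l > 0" and C: "finite C"
    and disj: "pairwise (\<lambda>i j. disjnt (cball ((fst i + snd i)/2) (\<bar>snd i - fst i\<bar>/2))
                 (cball ((fst j + snd j)/2) (\<bar>snd j - fst j\<bar>/2))) C"
    and sub: "\<And>x y. (x, y) \<in> C \<Longrightarrow> x \<in> {a..b} \<and> y \<in> {a..b} \<and> x \<noteq> y \<and> closed_segment x y \<subseteq> \<gamma> x \<and>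
       norm (\<bar>y - x\<bar> *\<^sub>R f x - integral (closed_segment x y) f) > l * \<bar>y - x\<bar>"
  shows "(\<Sum>(x,y)\<in>C. \<bar>y - x\<bar>) \<le> e"
proof -
  have cb: "cball ((x + y)/2) (\<bar>y - x\<bar>/2) = closed_segment x y" for x y :: real
    by (auto simp: closed_segment_eq_real_ivl cball_eq_atLeastAtMost abs_if field_simps)
  let ?g = "\<lambda>(x::real,y). (x, closed_segment x y)"
  let ?p = "?g ` C"
  have inj: "inj_on ?g C"
    by (rule inj_onI) (auto simp: doubleton_eq_iff closed_segment_eq)
  have "?p tagged_partial_division_of cbox a b"
    unfolding tagged_partial_division_of_def
  proof (intro conjI allI impI)
    show "finite ?p" using C by simp
  next
    fix x K assume "(x, K) \<in> ?p"
    then obtain y where y: "(x, y) \<in> C" "K = closed_segment x y" by auto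
    show "x \<in> K" "K \<subseteq> cbox a b" "\<exists>a b. K = cbox a b"
      using sub[OF y(1)] y(2) by (auto simp: closed_segment_eq_real_ivl)
  next
    fix x K x' K' assume *: "(x, K) \<in> ?p \<and> (x', K') \<in> ?p \<and> (x, K) \<noteq> (x', K')"
    then obtain y y' where y: "(x, y) \<in> C" "K = closed_segment x y"
      and y': "(x', y') \<in> C" "K' = closed_segment x' y'" using * by auto
    have "disjnt K K'"
      using pairwiseD[OF disj y(1) y'(1)] * y y' by (auto simp: cb)
    then show "interior K \<inter> interior K' = {}"
      using interior_subset by (auto simp: disjnt_def)
  qed
  moreover have "\<gamma> fine ?p" using sub by (auto simp: fine_def)
  ultimately have "(\<Sum>(x,K)\<in>?p. norm (measure lborel K *\<^sub>R f x - integral K f)) < e * l"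
    by (rule gauge)
  also have "(\<Sum>(x,K)\<in>?p. norm (measure lborel K *\<^sub>R f x - integral K f)) =
      (\<Sum>(x,y)\<in>C. norm (measure lborel (closed_segment x y) *\<^sub>R f x - integral (closed_segment x y) f))"
    by (subst sum.reindex[OF inj]) (auto simp: case_prod_unfold)
  also have "\<dots> = (\<Sum>(x,y)\<in>C. norm (\<bar>y - x\<bar> *\<^sub>R f x - integral (closed_segment x y) f))"
    by (intro sum.cong) (auto simp: closed_segment_eq_real_ivl abs_if)
  finally have *: "(\<Sum>(x,y)\<in>C. norm (\<bar>y - x\<bar> *\<^sub>R f x - integral (closed_segment x y) f)) < e * l" .
  \<comment> \<open>Each error exceeds \<open>l\<close> times the length of its segment, so
    Henstock's bound \<open>e * l\<close> on the total error bounds the total length by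
    \<open>e\<close>.\<close>
  have "(\<Sum>(x,y)\<in>C. l * \<bar>y - x\<bar>) \<le> (\<Sum>(x,y)\<in>C. norm (\<bar>y - x\<bar> *\<^sub>R f x - integral (closed_segment x y) f))"
    using sub by (intro sum_mono) (auto intro: less_imp_le)
  with * have "(\<Sum>(x,y)\<in>C. l * \<bar>y - x\<bar>) < e * l"
    by linarith
  then have "l * (\<Sum>(x,y)\<in>C. \<bar>y - x\<bar>) < e * l"
    by (simp add: sum_distrib_left case_prod_unfold)
  then show ?thesis using l by (simp add: mult.commute[of e])
qed

text \<open>The segments from a bad point to its witnesses form a Vitali cover of \<open>E\<close>.
  A disjoint subfamily covers almost all of \<open>E\<close>, and Henstock's lemma keeps its total
  length below any prescribed \<open>e\<close>. Segments are written as balls given by midpoint and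
  half-length to fit the form of Vitali's theorem.\<close>

lemma negligible_bad_points:
  fixes f :: "real \<Rightarrow> 'b::euclidean_space"
  assumes f: "f integrable_on {a..b}" and l: "l > 0"
  defines "E \<equiv> {x\<in>{a<..<b}. \<forall>d>0. \<exists>y\<in>{a<..<b}. y \<noteq> x \<and> \<bar>y - x\<bar> < d \<and>
      norm (\<bar>y - x\<bar> *\<^sub>R f x - integral (closed_segment x y) f) > l * \<bar>y - x\<bar>}"
  shows "negligible E"
  unfolding negligible_outer_le
proof (intro allI impI)
  fix e :: real assume "e > 0"
  then have el: "e * l > 0" using l by simp
  have fc: "f integrable_on cbox a b" using f by simp
  obtain \<gamma> where \<gamma>: "gauge \<gamma>" and
    H: "\<And>p. p tagged_partial_division_of cbox a b \<Longrightarrow> \<gamma> fine p \<Longrightarrow>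
             (\<Sum>(x,K)\<in>p. norm (measure lborel K *\<^sub>R f x - integral K f)) < e * l"
    by (rule Henstock_lemma[OF fc el]) blast
  let ?a = "\<lambda>i::real\<times>real. (fst i + snd i)/2" and ?r = "\<lambda>i::real\<times>real. \<bar>snd i - fst i\<bar>/2"
  have cb: "cball ((x + y)/2) (\<bar>y - x\<bar>/2) = closed_segment x y" for x y :: real
    by (auto simp: closed_segment_eq_real_ivl cball_eq_atLeastAtMost abs_if field_simps)
  define K where "K = {(x,y). x \<in> E \<and> y \<in> {a<..<b} \<and> y \<noteq> x \<and> closed_segment x y \<subseteq> \<gamma> x \<and>
      norm (\<bar>y - x\<bar> *\<^sub>R f x - integral (closed_segment x y) f) > l * \<bar>y - x\<bar>}"
  obtain C where C: "countable C" "C \<subseteq> K"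
     and disj: "pairwise (\<lambda>i j. disjnt (cball (?a i) (?r i)) (cball (?a j) (?r j))) C"
     and neg: "negligible (E - (\<Union>i \<in> C. cball (?a i) (?r i)))"
  proof (rule Vitali_covering_theorem_cballs[of K ?r E ?a])
    show "0 < ?r i" if "i \<in> K" for i using that by (auto simp: K_def)
    fix x d :: real assume x: "x \<in> E" "0 < d"
    obtain d' where d': "d' > 0" "ball x d' \<subseteq> \<gamma> x"
      using \<gamma> unfolding gauge_def by (meson openE)
    \<comment> \<open>One witness serves two purposes: closer than \<open>d\<close> makes the cover
      fine in Vitali's sense, closer than \<open>d'\<close> keeps the segment inside the gauge set
      of its tag \<open>x\<close>.\<close>
    obtain y where y: "y \<in> {a<..<b}" "y \<noteq> x" "\<bar>y - x\<bar> < min d d'"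
        "norm (\<bar>y - x\<bar> *\<^sub>R f x - integral (closed_segment x y) f) > l * \<bar>y - x\<bar>"
    proof -
      have "min d d' > 0" using x d' by simp
      then show ?thesis using x(1) that unfolding E_def by blast
    qed
    have "closed_segment x y \<subseteq> ball x d'"
      using y(3) by (auto simp: closed_segment_eq_real_ivl dist_real_def split: if_splits)
    then have "(x, y) \<in> K" using x y d' by (auto simp: K_def)
    moreover have "x \<in> cball (?a (x,y)) (?r (x,y))" by (simp add: cb)
    moreover have "?r (x,y) < d" using y(3) x(2) by simp
    ultimately show "\<exists>i. i \<in> K \<and> x \<in> cball (?a i) (?r i) \<and> ?r i < d" by blast
  qed
  define U where "U = (\<Union>i \<in> C. cball (?a i) (?r i))"
  \<comment> \<open>Henstock's lemma speaks of finite divisions, so the bound is proved for finite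
    subfamilies first and then passed to the countable union.\<close>
  have fin: "measure lebesgue (\<Union>i \<in> C'. cball (?a i) (?r i)) \<le> e" if "C' \<subseteq> C" "finite C'" for C'
  proof -
    have "measure lebesgue (\<Union>i \<in> C'. cball (?a i) (?r i)) \<le>
        (\<Sum>i\<in>C'. measure lebesgue (cball (?a i) (?r i)))"
      by (intro measure_UNION_le that) auto
    also have "\<dots> = (\<Sum>(x,y)\<in>C'. \<bar>y - x\<bar>)"
      by (intro sum.cong) (auto simp: cball_eq_atLeastAtMost abs_if)
    also have "\<dots> \<le> e"
    proof (rule sum_content_bad_intervals[OF H l])
      show "finite C'" by fact
      show "pairwise (\<lambda>i j. disjnt (cball (?a i) (?r i)) (cball (?a j) (?r j))) C'"
        using disj that by (auto intro: pairwise_subset)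
      fix x y assume "(x, y) \<in> C'"
      then have "(x, y) \<in> K" using that C by auto
      then show "x \<in> {a..b} \<and> y \<in> {a..b} \<and> x \<noteq> y \<and> closed_segment x y \<subseteq> \<gamma> x \<and>
       norm (\<bar>y - x\<bar> *\<^sub>R f x - integral (closed_segment x y) f) > l * \<bar>y - x\<bar>"
        by (auto simp: K_def E_def)
    qed
    finally show ?thesis .
  qed
  have U: "U \<in> lmeasurable" "measure lebesgue U \<le> e"
    unfolding U_def
    by (rule fmeasurable_UN_bound[OF C(1) _ fin] measure_UN_bound[OF C(1) _ fin]; simp)+
  have neg: "negligible (E - U)" using neg unfolding U_def .
  have "(E - U) \<union> U \<in> lmeasurable"
    by (intro fmeasurable.Un negligible_imp_measurable neg U(1))
  moreover have "measure lebesgue (U \<union> (E - U)) = measure lebesgue U"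
    using neg U(1) by (intro measure_Un_null_set) (simp_all only: fmeasurableD negligible_iff_null_sets)
  ultimately show "\<exists>T. E \<subseteq> T \<and> T \<in> lmeasurable \<and> measure lebesgue T \<le> e"
    using U(2) by (intro exI[of _ "(E - U) \<union> U"]) (simp add: Un_commute)
qed

text \<open>If the derivative at \<open>x\<close> fails to be \<open>f x\<close>, then
  \<open>x\<close> is bad for some threshold \<open>1 / (n + 1)\<close>; the exceptional set is thus
  inside a countable union of null sets.\<close>

theorem negligible_nondifferentiability_indefinite_integral:
  fixes f :: "real \<Rightarrow> 'b::euclidean_space"
  assumes f: "f integrable_on {a..b}"
  shows "negligible {x\<in>{a<..<b}. \<not> ((\<lambda>y. integral {a..y} f) has_vector_derivative f x) (at x)}"
proof -
  define E where "E l = {x\<in>{a<..<b}. \<forall>d>0. \<exists>y\<in>{a<..<b}. y \<noteq> x \<and> \<bar>y - x\<bar> < d \<and>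
      norm (\<bar>y - x\<bar> *\<^sub>R f x - integral (closed_segment x y) f) > l * \<bar>y - x\<bar>}" for l
  have "negligible (E l)" if "l > 0" for l
    unfolding E_def by (rule negligible_bad_points[OF f that])
  then have neg: "negligible (\<Union>n. E (inverse (real (Suc n))))"
    by (intro negligible_Union_nat) simp
  have in_E: "x \<in> (\<Union>n. E (inverse (real (Suc n))))"
    if x: "x \<in> {a<..<b}" and nd: "\<not> ((\<lambda>y. integral {a..y} f) has_vector_derivative f x) (at x)" for x
  proof (rule ccontr)
    assume notin: "x \<notin> (\<Union>n. E (inverse (real (Suc n))))"
    have "((\<lambda>y. integral {a..y} f) has_vector_derivative f x) (at x within {a<..<b})"
      unfolding has_vector_derivative_def has_derivative_within_alt
    proof (intro conjI allI impI bounded_linear_scaleR_left)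
      fix e :: real assume "e > 0"
      then obtain n where n: "inverse (real (Suc n)) < e" using reals_Archimedean by blast
      obtain d where d: "d > 0" and H: "\<And>y. y\<in>{a<..<b} \<Longrightarrow> y \<noteq> x \<Longrightarrow> \<bar>y - x\<bar> < d \<Longrightarrow>
          norm (\<bar>y - x\<bar> *\<^sub>R f x - integral (closed_segment x y) f) \<le> inverse (real (Suc n)) * \<bar>y - x\<bar>"
      proof -
        have "x \<notin> E (inverse (real (Suc n)))" using notin by blast
        then have "\<not> (\<forall>d>0. \<exists>y\<in>{a<..<b}. y \<noteq> x \<and> \<bar>y - x\<bar> < d \<and>
            norm (\<bar>y - x\<bar> *\<^sub>R f x - integral (closed_segment x y) f) > inverse (real (Suc n)) * \<bar>y - x\<bar>)"
          using x unfolding E_def mem_Collect_eq by iprover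
        then obtain d where d: "d > 0" "\<not> (\<exists>y\<in>{a<..<b}. y \<noteq> x \<and> \<bar>y - x\<bar> < d \<and>
            norm (\<bar>y - x\<bar> *\<^sub>R f x - integral (closed_segment x y) f) > inverse (real (Suc n)) * \<bar>y - x\<bar>)"
          unfolding not_all not_imp by iprover
        show ?thesis
        proof (rule that[OF d(1)])
          fix y assume y: "y \<in> {a<..<b}" "y \<noteq> x" "\<bar>y - x\<bar> < d"
          show "norm (\<bar>y - x\<bar> *\<^sub>R f x - integral (closed_segment x y) f) \<le> inverse (real (Suc n)) * \<bar>y - x\<bar>"
          proof (rule ccontr)
            assume "\<not> ?thesis"
            then have "norm (\<bar>y - x\<bar> *\<^sub>R f x - integral (closed_segment x y) f) > inverse (real (Suc n)) * \<bar>y - x\<bar>"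
              by (simp only: not_le)
            with y have "\<exists>y\<in>{a<..<b}. y \<noteq> x \<and> \<bar>y - x\<bar> < d \<and>
                norm (\<bar>y - x\<bar> *\<^sub>R f x - integral (closed_segment x y) f) > inverse (real (Suc n)) * \<bar>y - x\<bar>"
              by (intro bexI[of _ y] conjI)
            with d(2) show False by (rule notE)
          qed
        qed
      qed
      show "\<exists>d>0. \<forall>y\<in>{a<..<b}. norm (y - x) < d \<longrightarrow>
          norm (integral {a..y} f - integral {a..x} f - (y - x) *\<^sub>R f x) \<le> e * norm (y - x)"
      proof (intro exI[of _ d] conjI ballI impI d)
        fix y assume y: "y \<in> {a<..<b}" "norm (y - x) < d"
        have int: "f integrable_on {a..t}" if "t \<in> {a<..<b}" for t
          using that by (intro integrable_on_subinterval[OF f]) auto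
        have "norm (integral {a..y} f - integral {a..x} f - (y - x) *\<^sub>R f x) \<le> inverse (real (Suc n)) * \<bar>y - x\<bar>"
        proof (rule linorder_cases[of x y])
          assume less: "x < y"
          have eq: "integral {a..x} f + integral {x..y} f = integral {a..y} f"
            using less x y int by (intro Henstock_Kurzweil_Integration.integral_combine) auto
          have "norm ((y - x) *\<^sub>R f x - integral {x..y} f) \<le> inverse (real (Suc n)) * \<bar>y - x\<bar>"
            using H[OF y(1)] less y(2) unfolding closed_segment_eq_real_ivl by (simp del: of_nat_Suc)
          moreover have "norm (integral {a..y} f - integral {a..x} f - (y - x) *\<^sub>R f x)
              = norm ((y - x) *\<^sub>R f x - (integral {a..y} f - integral {a..x} f))"
            by (rule norm_minus_commute)
          ultimately show ?thesis by (simp only: add_diff_cancel_left' flip: eq)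
        next
          assume "x = y"
          then show ?thesis by (simp del: of_nat_Suc)
        next
          assume less: "y < x"
          have "integral {a..y} f + integral {y..x} f = integral {a..x} f"
            using less x y int by (intro Henstock_Kurzweil_Integration.integral_combine) auto
          then have "integral {a..y} f - integral {a..x} f - (y - x) *\<^sub>R f x
              = (x - y) *\<^sub>R f x - integral {y..x} f"
            by (simp add: algebra_simps)
          moreover have "norm ((x - y) *\<^sub>R f x - integral {y..x} f) \<le> inverse (real (Suc n)) * \<bar>y - x\<bar>"
            using H[OF y(1)] less y(2) unfolding closed_segment_eq_real_ivl by (simp del: of_nat_Suc)
          ultimately show ?thesis by (simp only:)
        qed
        also have "\<dots> \<le> e * norm (y - x)" using n by (simp add: mult_right_mono)
        finally show "norm (integral {a..y} f - integral {a..x} f - (y - x) *\<^sub>R f x) \<le> e * norm (y - x)" .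
      qed
    qed
    moreover have "at x within {a<..<b} = at x"
      using x by (intro at_within_open) auto
    ultimately show False using nd by simp
  qed
  have "{x\<in>{a<..<b}. \<not> ((\<lambda>y. integral {a..y} f) has_vector_derivative f x) (at x)}
      \<subseteq> (\<Union>n. E (inverse (real (Suc n))))"
    using in_E by blast
  with neg show ?thesis by (rule negligible_subset)
qed

corollary indefinite_integral_has_vector_derivative_AE:
  fixes f :: "real \<Rightarrow> 'b::euclidean_space"
  assumes f: "f integrable_on {a..b}"
  shows "AE t in lborel. t \<in> {a..b} \<longrightarrow> t \<in> {a<..<b} \<and>
    ((\<lambda>y. integral {a..y} f) has_vector_derivative f t) (at t)"
proof -
  let ?N = "{x\<in>{a<..<b}. \<not> ((\<lambda>y. integral {a..y} f) has_vector_derivative f x) (at x)}"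
  have "?N \<in> null_sets lebesgue"
    using negligible_nondifferentiability_indefinite_integral[OF f] by (simp only: negligible_iff_null_sets)
  then have "AE t in lebesgue. t \<notin> ?N" by (rule AE_not_in)
  then have "AE t in lborel. t \<notin> ?N" by (simp only: AE_completion_iff)
  moreover have "AE t in lborel. t \<noteq> a" "AE t in lborel. t \<noteq> b" by (rule AE_lborel_singleton)+
  ultimately show ?thesis
    by eventually_elim auto
qed

section \<open>Normalized Lebesgue measure on the circle\<close>

lemma space_circle [simp]: "space circle_measure = sphere 0 1"
  by (simp add: circle_measure_def space_restrict_space)

lemma sets_circle: "sets circle_measure = sets (restrict_space borel (sphere 0 1))"
  by (simp add: circle_measure_def)

lemma cis_measurable: "cis \<in> uniform_measure lborel A \<rightarrow>\<^sub>M restrict_space borel (sphere 0 1)"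
  unfolding measurable_cong_sets[OF sets_uniform_measure refl] measurable_cong_sets[OF sets_lborel refl]
  by (auto intro!: measurable_restrict_space2 borel_measurable_continuous_onI continuous_intros)

lemma cis_measurable_circle: "cis \<in> lborel \<rightarrow>\<^sub>M circle_measure"
  unfolding measurable_cong_sets[OF refl sets_circle]
  by (auto intro!: measurable_restrict_space2 borel_measurable_continuous_onI continuous_intros)

interpretation circle: prob_space circle_measure
  unfolding circle_measure_def
  by (intro prob_space.prob_space_distr prob_space_uniform_measure cis_measurable) auto

lemma measurable_circle_borel:
  "f \<in> borel_measurable borel \<Longrightarrow> f \<in> borel_measurable circle_measure"
  unfolding measurable_cong_sets[OF sets_circle refl] by (rule measurable_restrict_space1)

lemma measurable_circle_continuous:
  fixes f :: "complex \<Rightarrow> 'a::topological_space"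
  shows "continuous_on (sphere 0 1) f \<Longrightarrow> f \<in> borel_measurable circle_measure"
  unfolding measurable_cong_sets[OF sets_circle refl]
  by (rule borel_measurable_continuous_on_restrict)

lemma measurable_circle_ident [measurable]: "(\<lambda>\<zeta>. \<zeta>) \<in> borel_measurable circle_measure"
  by (intro measurable_circle_continuous continuous_intros)

lemma borel_measurable_cnj [measurable]:
  "f \<in> borel_measurable M \<Longrightarrow> (\<lambda>x. cnj (f x)) \<in> borel_measurable M"
  by (rule measurable_compose[OF _ borel_measurable_continuous_onI[OF continuous_on_cnj[OF continuous_on_id]]])

lemma integrable_circle_bounded:
  fixes f :: "complex \<Rightarrow> 'a::{banach, second_countable_topology}"
  assumes "f \<in> borel_measurable circle_measure" "AE \<zeta> in circle_measure. norm (f \<zeta>) \<le> C"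
  shows "integrable circle_measure f"
  using assms by (intro circle.integrable_const_bound)

lemma integrable_circle_continuous:
  fixes f :: "complex \<Rightarrow> 'a::{banach, second_countable_topology}"
  assumes "continuous_on (sphere 0 1) f"
  shows "integrable circle_measure f"
proof -
  have "compact (f ` sphere 0 1)" by (intro compact_continuous_image assms) auto
  then obtain C where "\<And>\<zeta>. \<zeta> \<in> sphere 0 1 \<Longrightarrow> norm (f \<zeta>) \<le> C"
    by (meson bounded_iff compact_imp_bounded imageI)
  then show ?thesis
    by (intro integrable_circle_bounded[of _ C] measurable_circle_continuous assms) auto
qed

lemma uniform_measure_interval_eq_density:
  "uniform_measure lborel {0..2*pi} =
     density lborel (\<lambda>t. ennreal (indicator {0..2*pi} t / (2*pi)))"
  unfolding uniform_measure_def
  by (intro density_cong) (auto simp: indicator_def divide_ennreal[symmetric] ennreal_1[symmetric] simp del: ennreal_1)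

lemma integral_circle:
  fixes f :: "complex \<Rightarrow> complex"
  assumes "f \<in> borel_measurable circle_measure"
  shows "(\<integral>\<zeta>. f \<zeta> \<partial>circle_measure) = (LINT t:{0..2*pi}|lborel. f (cis t)) / (2*pi)"
proof -
  have [measurable]: "(\<lambda>t. f (cis t)) \<in> borel_measurable lborel"
    using measurable_compose[OF cis_measurable_circle assms] .
  have "(\<integral>\<zeta>. f \<zeta> \<partial>circle_measure) = (\<integral>t. f (cis t) \<partial>uniform_measure lborel {0..2*pi})"
    using assms unfolding circle_measure_def
    by (intro integral_distr cis_measurable) (simp add: measurable_cong_sets[OF sets_circle refl] circle_measure_def)
  also have "\<dots> = (\<integral>t. (indicator {0..2*pi} t / (2*pi)) *\<^sub>R f (cis t) \<partial>lborel)"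
    unfolding uniform_measure_interval_eq_density by (intro integral_density) auto
  also have "\<dots> = (\<integral>t. (indicator {0..2*pi} t *\<^sub>R f (cis t)) / (2*pi) \<partial>lborel)"
    by (intro Bochner_Integration.integral_cong) (auto simp: scaleR_conv_of_real)
  finally show ?thesis by (simp add: set_lebesgue_integral_def)
qed

lemma integrable_circle_iff:
  fixes f :: "complex \<Rightarrow> complex"
  assumes "f \<in> borel_measurable circle_measure"
  shows "integrable circle_measure f \<longleftrightarrow> set_integrable lborel {0..2*pi} (\<lambda>t. f (cis t))"
proof -
  have [measurable]: "(\<lambda>t. f (cis t)) \<in> borel_measurable lborel"
    using measurable_compose[OF cis_measurable_circle assms] .
  have "integrable circle_measure f \<longleftrightarrow> integrable (uniform_measure lborel {0..2*pi}) (\<lambda>t. f (cis t))"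
    using assms unfolding circle_measure_def
    by (intro integrable_distr_eq cis_measurable) (simp add: measurable_cong_sets[OF sets_circle refl] circle_measure_def)
  also have "\<dots> \<longleftrightarrow> integrable lborel (\<lambda>t. (indicator {0..2*pi} t / (2*pi)) *\<^sub>R f (cis t))"
    unfolding uniform_measure_interval_eq_density by (intro integrable_density) auto
  also have "\<dots> \<longleftrightarrow> integrable lborel (\<lambda>t. (1/(2*pi)) *\<^sub>R (indicator {0..2*pi} t *\<^sub>R f (cis t)))"
    by (intro Bochner_Integration.integrable_cong) (auto)
  also have "\<dots> \<longleftrightarrow> set_integrable lborel {0..2*pi} (\<lambda>t. f (cis t))"
    unfolding set_integrable_def using integrable_scaleR_right[of "2*pi" lborel "\<lambda>t. (1/(2*pi)) *\<^sub>R (indicator {0..2*pi} t *\<^sub>R f (cis t))"]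
      integrable_scaleR_right[of "1/(2*pi)" lborel "\<lambda>t. indicator {0..2*pi} t *\<^sub>R f (cis t)"]
    by auto
  finally show ?thesis .
qed

text \<open>Pulling a null set back along \<open>cis\<close> goes through the image measure and asks
  for a measurable set. Hence the set of points with a radial limit has to be shown measurable
  before Fatou's theorem can be moved from the interval to the circle.\<close>

lemma AE_circle_iff:
  assumes "{\<zeta>\<in>sphere 0 1. P \<zeta>} \<in> sets circle_measure"
  shows "(AE \<zeta> in circle_measure. P \<zeta>) \<longleftrightarrow> (AE t in lborel. t \<in> {0..2*pi} \<longrightarrow> P (cis t))"
proof -
  have "(AE \<zeta> in circle_measure. P \<zeta>) \<longleftrightarrow> (AE t in uniform_measure lborel {0..2*pi}. P (cis t))"
    unfolding circle_measure_def
    using assms by (intro AE_distr_iff cis_measurable) (simp add: sets_circle space_restrict_space)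
  also have "\<dots> \<longleftrightarrow> (AE t in lborel. t \<in> {0..2*pi} \<longrightarrow> P (cis t))"
    by (intro AE_uniform_measure) auto
  finally show ?thesis .
qed

lemma integral_circle_power_pos:
  assumes "n > 0"
  shows "(\<integral>\<zeta>. \<zeta> ^ n \<partial>circle_measure) = 0"
proof -
  have "((\<lambda>t. cis (real n * t)) has_integral
      (cis (real n * (2*pi)) / (\<i> * n) - cis (real n * 0) / (\<i> * n))) {0..2*pi}"
  proof (rule fundamental_theorem_of_calculus)
    fix t :: real
    have "((\<lambda>z. exp (\<i> * (of_nat n * z)) / (\<i> * of_nat n)) has_field_derivative
        exp (\<i> * (of_nat n * complex_of_real t))) (at (complex_of_real t))"
      using assms by (auto intro!: derivative_eq_intros simp: field_simps)
    from has_vector_derivative_real_field[OF this]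
    show "((\<lambda>t. cis (real n * t) / (\<i> * n)) has_vector_derivative cis (real n * t)) (at t within {0..2*pi})"
      by (simp add: cis_conv_exp)
  qed auto
  moreover have "cis (real n * (2*pi)) = 1"
    by (metis cis_multiple_2pi Ints_of_nat mult.commute)
  moreover have "(\<lambda>t. cis (real n * t)) = (\<lambda>t. cis t ^ n)"
    by (simp add: Complex.DeMoivre)
  ultimately have "((\<lambda>t. cis t ^ n) has_integral 0) {0..2*pi}"
    by simp
  moreover have "set_integrable lborel {0..2*pi} (\<lambda>t. cis t ^ n)"
    unfolding set_integrable_def by (intro borel_integrable_compact continuous_intros) auto
  ultimately have "(LINT t:{0..2*pi}|lborel. cis t ^ n) = 0"
    by (simp add: set_borel_integral_eq_integral(2) integral_unique)
  then show ?thesis by (subst integral_circle) auto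
qed

lemma cnj_on_circle: "norm \<zeta> = 1 \<Longrightarrow> cnj \<zeta> = inverse \<zeta>" for \<zeta> :: complex
  by (metis divide_conv_cnj divide_inverse mult_1)

lemma sphere_powi_uminus: "norm \<zeta> = 1 \<Longrightarrow> cnj (\<zeta> powi k) = \<zeta> powi (- k)" for \<zeta> :: complex
  by (simp add: cnj_on_circle power_int_minus power_int_inverse)

section \<open>Fourier series and the space \<open>H\<^sup>2\<close>\<close>

definition l2_sq :: "(complex \<Rightarrow> complex) \<Rightarrow> real" where
  "l2_sq f = (\<integral>\<zeta>. (norm (f \<zeta>))\<^sup>2 \<partial>circle_measure)"

lemma l2_sq_nonneg [simp]: "l2_sq f \<ge> 0"
  unfolding l2_sq_def by simp

lemma L2_measurable: "f \<in> L2 \<Longrightarrow> f \<in> borel_measurable circle_measure"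
  by (simp add: L2_def)

lemma L2_integrable_sq: "f \<in> L2 \<Longrightarrow> integrable circle_measure (\<lambda>\<zeta>. (norm (f \<zeta>))\<^sup>2)"
  by (simp add: L2_def)

lemma L2_integrable:
  assumes "f \<in> L2" shows "integrable circle_measure f"
proof -
  note [measurable] = L2_measurable[OF assms]
  have "integrable circle_measure (\<lambda>\<zeta>. norm (f \<zeta>))"
    by (rule circle.square_integrable_imp_integrable[OF _ L2_integrable_sq[OF assms]]) measurable
  then show ?thesis by (rule integrable_norm_cancel) measurable
qed

lemma L2_bounded:
  assumes [measurable]: "f \<in> borel_measurable circle_measure"
    and "AE \<zeta> in circle_measure. norm (f \<zeta>) \<le> C"
  shows "f \<in> L2"
  unfolding L2_def using assms(2)
  by (auto intro!: integrable_circle_bounded[where C = "C\<^sup>2"] power_mono elim!: eventually_mono)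

lemma L2_continuous: "continuous_on (sphere 0 1) f \<Longrightarrow> f \<in> L2"
  unfolding L2_def
  by (auto intro!: integrable_circle_continuous measurable_circle_continuous continuous_intros)

lemma L2_mult_integrable:
  assumes f: "f \<in> L2" and g: "g \<in> L2"
  shows "integrable circle_measure (\<lambda>\<zeta>. f \<zeta> * g \<zeta>)"
proof (rule Bochner_Integration.integrable_bound)
  note [measurable] = L2_measurable[OF f] L2_measurable[OF g]
  show "integrable circle_measure (\<lambda>\<zeta>. (norm (f \<zeta>))\<^sup>2 + (norm (g \<zeta>))\<^sup>2)"
    using f g by (intro Bochner_Integration.integrable_add L2_integrable_sq)
  show "(\<lambda>\<zeta>. f \<zeta> * g \<zeta>) \<in> borel_measurable circle_measure" by measurable
  have "x * y \<le> x\<^sup>2 + y\<^sup>2" for x y :: real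
    using sum_squares_bound[of x y] zero_le_power2[of x] zero_le_power2[of y]
    by linarith
  then show "AE \<zeta> in circle_measure. norm (f \<zeta> * g \<zeta>) \<le> norm ((norm (f \<zeta>))\<^sup>2 + (norm (g \<zeta>))\<^sup>2)"
    by (auto simp: norm_mult)
qed

lemma L2_cnj: "f \<in> L2 \<Longrightarrow> (\<lambda>\<zeta>. cnj (f \<zeta>)) \<in> L2"
  unfolding L2_def by auto

lemma L2_add:
  assumes f: "f \<in> L2" and g: "g \<in> L2" shows "(\<lambda>\<zeta>. f \<zeta> + g \<zeta>) \<in> L2"
  unfolding L2_def mem_Collect_eq
proof
  note [measurable] = L2_measurable[OF f] L2_measurable[OF g]
  show "(\<lambda>\<zeta>. f \<zeta> + g \<zeta>) \<in> borel_measurable circle_measure" by measurable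
  show "integrable circle_measure (\<lambda>\<zeta>. (norm (f \<zeta> + g \<zeta>))\<^sup>2)"
  proof (rule Bochner_Integration.integrable_bound)
    show "integrable circle_measure (\<lambda>\<zeta>. 2 * (norm (f \<zeta>))\<^sup>2 + 2 * (norm (g \<zeta>))\<^sup>2)"
      using f g by (intro Bochner_Integration.integrable_add integrable_mult_right L2_integrable_sq)
    have "(norm (x + y))\<^sup>2 \<le> 2 * (norm x)\<^sup>2 + 2 * (norm y)\<^sup>2" for x y :: complex
    proof -
      have "(norm (x + y))\<^sup>2 \<le> (norm x + norm y)\<^sup>2" by (intro power_mono norm_triangle_ineq) auto
      also have "\<dots> \<le> 2 * (norm x)\<^sup>2 + 2 * (norm y)\<^sup>2"
        using sum_squares_bound[of "norm x" "norm y"] by (simp add: power2_sum)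
      finally show ?thesis .
    qed
    then show "AE \<zeta> in circle_measure. norm ((norm (f \<zeta> + g \<zeta>))\<^sup>2) \<le> norm (2 * (norm (f \<zeta>))\<^sup>2 + 2 * (norm (g \<zeta>))\<^sup>2)"
      by auto
  qed measurable
qed

lemma L2_bounded_mult:
  assumes f: "f \<in> L2" and b [measurable]: "b \<in> borel_measurable circle_measure"
    and C: "AE \<zeta> in circle_measure. norm (b \<zeta>) \<le> C"
  shows "(\<lambda>\<zeta>. b \<zeta> * f \<zeta>) \<in> L2"
  unfolding L2_def mem_Collect_eq
proof
  note [measurable] = L2_measurable[OF f]
  show "(\<lambda>\<zeta>. b \<zeta> * f \<zeta>) \<in> borel_measurable circle_measure" by measurable
  show "integrable circle_measure (\<lambda>\<zeta>. (norm (b \<zeta> * f \<zeta>))\<^sup>2)"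
  proof (rule Bochner_Integration.integrable_bound)
    show "integrable circle_measure (\<lambda>\<zeta>. C\<^sup>2 * (norm (f \<zeta>))\<^sup>2)"
      using f by (intro integrable_mult_right L2_integrable_sq)
    show "AE \<zeta> in circle_measure. norm ((norm (b \<zeta> * f \<zeta>))\<^sup>2) \<le> norm (C\<^sup>2 * (norm (f \<zeta>))\<^sup>2)"
      using C by eventually_elim (auto simp: norm_mult power_mult_distrib intro!: mult_right_mono power_mono)
  qed measurable
qed

lemma L2_cmult: "f \<in> L2 \<Longrightarrow> (\<lambda>\<zeta>. c * f \<zeta>) \<in> L2"
  by (rule L2_bounded_mult[of f "\<lambda>_. c" "norm c"]) auto

lemma L2_diff: "f \<in> L2 \<Longrightarrow> g \<in> L2 \<Longrightarrow> (\<lambda>\<zeta>. f \<zeta> - g \<zeta>) \<in> L2"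
  using L2_add[of f "\<lambda>\<zeta>. (-1) * g \<zeta>"] L2_cmult[of g "-1"] by simp

lemma l2_inner_integrable: "f \<in> L2 \<Longrightarrow> g \<in> L2 \<Longrightarrow> integrable circle_measure (\<lambda>\<zeta>. f \<zeta> * cnj (g \<zeta>))"
  by (intro L2_mult_integrable L2_cnj)

lemma l2_inner_diff_left:
  "f \<in> L2 \<Longrightarrow> g \<in> L2 \<Longrightarrow> h \<in> L2 \<Longrightarrow> l2_inner (\<lambda>\<zeta>. f \<zeta> - g \<zeta>) h = l2_inner f h - l2_inner g h"
  unfolding l2_inner_def left_diff_distrib by (intro Bochner_Integration.integral_diff l2_inner_integrable)

lemma l2_inner_cmult_left: "l2_inner (\<lambda>\<zeta>. c * f \<zeta>) h = c * l2_inner f h"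
  unfolding l2_inner_def by (simp add: mult.assoc)

lemma l2_inner_commute: "l2_inner g f = cnj (l2_inner f g)"
  unfolding l2_inner_def by (subst Bochner_Integration.integral_cnj[symmetric]) (simp add: mult.commute)

lemma l2_inner_diff_right:
  "f \<in> L2 \<Longrightarrow> g \<in> L2 \<Longrightarrow> h \<in> L2 \<Longrightarrow> l2_inner h (\<lambda>\<zeta>. f \<zeta> - g \<zeta>) = l2_inner h f - l2_inner h g"
  by (simp add: l2_inner_commute[of h] l2_inner_diff_left)

lemma l2_inner_self: "l2_inner f f = complex_of_real (l2_sq f)"
  unfolding l2_inner_def l2_sq_def
  by (subst integral_complex_of_real[symmetric]) (simp only: complex_norm_square)

lemma l2_inner_cong_AE:
  assumes [measurable]: "f \<in> borel_measurable circle_measure" "f' \<in> borel_measurable circle_measure"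
      "g \<in> borel_measurable circle_measure" "g' \<in> borel_measurable circle_measure"
    and "AE \<zeta> in circle_measure. f \<zeta> = f' \<zeta>" "AE \<zeta> in circle_measure. g \<zeta> = g' \<zeta>"
  shows "l2_inner f g = l2_inner f' g'"
  unfolding l2_inner_def
proof (rule integral_cong_AE)
  show "AE \<zeta> in circle_measure. f \<zeta> * cnj (g \<zeta>) = f' \<zeta> * cnj (g' \<zeta>)"
    using assms(5,6) by eventually_elim simp
qed measurable

lemma l2_sq_diff_commute: "l2_sq (\<lambda>\<zeta>. f \<zeta> - g \<zeta>) = l2_sq (\<lambda>\<zeta>. g \<zeta> - f \<zeta>)"
  unfolding l2_sq_def by (simp add: norm_minus_commute)

lemma l2_sq_diff:
  assumes f: "f \<in> L2" and g: "g \<in> L2"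
  shows "l2_sq (\<lambda>\<zeta>. f \<zeta> - g \<zeta>) = l2_sq f + l2_sq g - 2 * Re (l2_inner f g)"
proof -
  have "complex_of_real (l2_sq (\<lambda>\<zeta>. f \<zeta> - g \<zeta>)) =
      l2_inner f f - l2_inner f g - cnj (l2_inner f g) + l2_inner g g"
    using assms unfolding l2_inner_self[symmetric]
    by (simp add: l2_inner_diff_left l2_inner_diff_right L2_diff l2_inner_commute[of g f])
  then have "Re (complex_of_real (l2_sq (\<lambda>\<zeta>. f \<zeta> - g \<zeta>))) =
      Re (l2_inner f f - l2_inner f g - cnj (l2_inner f g) + l2_inner g g)" by simp
  then show ?thesis by (simp add: l2_inner_self)
qed

lemma l2_sq_eq_0:
  assumes "f \<in> L2" "l2_sq f = 0" shows "AE \<zeta> in circle_measure. f \<zeta> = 0"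
  using assms integral_nonneg_eq_0_iff_AE[OF L2_integrable_sq[OF assms(1)]]
  by (simp add: l2_sq_def)

text \<open>The free parameter \<open>t\<close> replaces the square roots of the Cauchy--Schwarz inequality.\<close>

lemma integral_norm_mult_bound:
  assumes f: "f \<in> L2" and g: "g \<in> L2" and t: "t > 0"
  shows "(\<integral>\<zeta>. norm (f \<zeta> * g \<zeta>) \<partial>circle_measure) \<le> (t * l2_sq f + l2_sq g / t) / 2"
proof -
  have "(\<integral>\<zeta>. norm (f \<zeta> * g \<zeta>) \<partial>circle_measure) \<le>
      (\<integral>\<zeta>. (t * (norm (f \<zeta>))\<^sup>2 + (norm (g \<zeta>))\<^sup>2 / t) / 2 \<partial>circle_measure)"
  proof (rule integral_mono)
    show "integrable circle_measure (\<lambda>\<zeta>. norm (f \<zeta> * g \<zeta>))"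
      using L2_mult_integrable[OF f g] by simp
    show "integrable circle_measure (\<lambda>\<zeta>. (t * (norm (f \<zeta>))\<^sup>2 + (norm (g \<zeta>))\<^sup>2 / t) / 2)"
      using f g by (intro integrable_divide Bochner_Integration.integrable_add integrable_mult_right L2_integrable_sq)
    fix \<zeta>
    have "2 * (t * norm (f \<zeta>)) * norm (g \<zeta>) \<le> (t * norm (f \<zeta>))\<^sup>2 + (norm (g \<zeta>))\<^sup>2"
      by (rule sum_squares_bound)
    then show "norm (f \<zeta> * g \<zeta>) \<le> (t * (norm (f \<zeta>))\<^sup>2 + (norm (g \<zeta>))\<^sup>2 / t) / 2"
      using t by (simp add: norm_mult field_simps power2_eq_square)
  qed
  also have "\<dots> = (t * l2_sq f + l2_sq g / t) / 2"
    unfolding l2_sq_def using f g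
    by (subst integral_divide_zero, subst Bochner_Integration.integral_add)
       (auto intro!: integrable_divide integrable_mult_right L2_integrable_sq)
  finally show ?thesis .
qed

lemma norm_l2_inner_bound:
  assumes f: "f \<in> L2" and g: "g \<in> L2" and t: "t > 0"
  shows "norm (l2_inner f g) \<le> (t * l2_sq f + l2_sq g / t) / 2"
proof -
  have "norm (l2_inner f g) \<le> (\<integral>\<zeta>. norm (f \<zeta> * cnj (g \<zeta>)) \<partial>circle_measure)"
    unfolding l2_inner_def by (rule integral_norm_bound)
  also have "\<dots> \<le> (t * l2_sq f + l2_sq g / t) / 2"
    using integral_norm_mult_bound[OF f L2_cnj[OF g] t] by (simp add: l2_sq_def)
  finally show ?thesis .
qed

text \<open>The best \<open>t\<close> would give the bound \<open>sqrt (a n * b)\<close>. Fixing a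
  large \<open>t\<close> first, to make \<open>b / t\<close> small, and taking \<open>n\<close>
  large afterwards gives the limit without roots.\<close>

lemma AM_GM_tendsto:
  assumes "\<And>n t. t > 0 \<Longrightarrow> 0 \<le> x n \<and> x n \<le> (t * a n + b / t) / 2" "a \<longlonglongrightarrow> (0::real)" "b \<ge> 0"
  shows "x \<longlonglongrightarrow> (0::real)"
proof (rule LIMSEQ_I)
  fix e :: real assume e: "e > 0"
  \<comment> \<open>This gives \<open>b / t \<le> e\<close>; adding 1 keeps \<open>t\<close>
    positive when \<open>b = 0\<close>.\<close>
  define t where "t = (b + 1) / e"
  have t: "t > 0" using e assms(3) by (simp add: t_def)
  then have "e / t > 0" using e by simp
  then obtain N where N: "\<And>n. n \<ge> N \<Longrightarrow> norm (a n - 0) < e / t"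
    using LIMSEQ_D[OF assms(2)] by blast
  have "norm (x n - 0) < e" if "n \<ge> N" for n
  proof -
    have "t * a n < e" using N[OF that] t by (simp add: pos_less_divide_eq mult.commute abs_less_iff)
    moreover have "b / t \<le> e" using e assms(3) by (simp add: t_def field_simps)
    ultimately show ?thesis using assms(1)[OF t, of n] by simp
  qed
  then show "\<exists>N. \<forall>n\<ge>N. norm (x n - 0) < e" by blast
qed

lemma l2_inner_tendsto:
  assumes f: "\<And>n. f n \<in> L2" "f' \<in> L2" and g: "g \<in> L2"
    and lim: "(\<lambda>n. l2_sq (\<lambda>\<zeta>. f n \<zeta> - f' \<zeta>)) \<longlonglongrightarrow> 0"
  shows "(\<lambda>n. l2_inner (f n) g) \<longlonglongrightarrow> l2_inner f' g"
proof -
  have "(\<lambda>n. norm (l2_inner (\<lambda>\<zeta>. f n \<zeta> - f' \<zeta>) g)) \<longlonglongrightarrow> 0"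
    by (rule AM_GM_tendsto[OF _ lim, of _ "l2_sq g"]) (intro conjI norm_ge_zero norm_l2_inner_bound L2_diff f g l2_sq_nonneg, simp_all)
  then have "(\<lambda>n. l2_inner (f n) g - l2_inner f' g) \<longlonglongrightarrow> 0"
    by (simp add: tendsto_norm_zero_iff l2_inner_diff_left f g)
  then show ?thesis by (rule LIM_zero_cancel)
qed


lemma L2_powi: "(\<lambda>\<zeta>. \<zeta> powi k) \<in> L2"
  by (intro L2_continuous continuous_intros) auto

lemma L2_power: "(\<lambda>\<zeta>. \<zeta> ^ n) \<in> L2"
  by (intro L2_continuous continuous_intros)

lemma l2_inner_sum_left:
  assumes "g \<in> L2" "\<And>i. i \<in> I \<Longrightarrow> f i \<in> L2"
  shows "l2_inner (\<lambda>\<zeta>. \<Sum>i\<in>I. f i \<zeta>) g = (\<Sum>i\<in>I. l2_inner (f i) g)"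
  unfolding l2_inner_def sum_distrib_right
  by (intro Bochner_Integration.integral_sum l2_inner_integrable assms)

lemma l2_inner_powi: "l2_inner (\<lambda>\<zeta>. \<zeta> powi j) (\<lambda>\<zeta>. \<zeta> powi k) = (if j = k then 1 else 0)"
proof -
  have "l2_inner (\<lambda>\<zeta>. \<zeta> powi j) (\<lambda>\<zeta>. \<zeta> powi k) = (\<integral>\<zeta>. \<zeta> powi (j - k) \<partial>circle_measure)"
    unfolding l2_inner_def
  proof (rule Bochner_Integration.integral_cong[OF refl])
    fix \<zeta> :: complex assume "\<zeta> \<in> space circle_measure"
    then have "norm \<zeta> = 1" "\<zeta> \<noteq> 0" by auto
    then show "\<zeta> powi j * cnj (\<zeta> powi k) = \<zeta> powi (j - k)"
      unfolding sphere_powi_uminus[OF \<open>norm \<zeta> = 1\<close>] by (simp add: power_int_add[symmetric])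
  qed
  also have "\<dots> = (if j = k then 1 else 0)"
  proof (rule linorder_cases[of j k])
    assume "j = k"
    then show ?thesis using circle.prob_space by simp
  next
    assume "k < j"
    then show ?thesis using integral_circle_power_pos[of "nat (j - k)"] by (simp add: power_int_def)
  next
    assume less: "j < k"
    have "(\<integral>\<zeta>. \<zeta> powi (j - k) \<partial>circle_measure) = (\<integral>\<zeta>. cnj (\<zeta> ^ nat (k - j)) \<partial>circle_measure)"
    proof (rule Bochner_Integration.integral_cong[OF refl])
      fix \<zeta> :: complex assume "\<zeta> \<in> space circle_measure"
      then have "norm \<zeta> = 1" by auto
      then show "\<zeta> powi (j - k) = cnj (\<zeta> ^ nat (k - j))"
        using sphere_powi_uminus[OF \<open>norm \<zeta> = 1\<close>, of "k - j"] less by (simp add: power_int_def)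
    qed
    also have "\<dots> = cnj (\<integral>\<zeta>. \<zeta> ^ nat (k - j) \<partial>circle_measure)"
      by (rule Bochner_Integration.integral_cnj)
    also have "\<dots> = 0" using less by (subst integral_circle_power_pos) auto
    finally show ?thesis using less by simp
  qed
  finally show ?thesis .
qed

lemma fourier_coeff_diff:
  "f \<in> L2 \<Longrightarrow> g \<in> L2 \<Longrightarrow> fourier_coeff (\<lambda>\<zeta>. f \<zeta> - g \<zeta>) k = fourier_coeff f k - fourier_coeff g k"
  unfolding fourier_coeff_def by (intro l2_inner_diff_left L2_powi)

lemma fourier_coeff_tendsto:
  assumes "\<And>n. f n \<in> L2" "f' \<in> L2" "(\<lambda>n. l2_sq (\<lambda>\<zeta>. f n \<zeta> - f' \<zeta>)) \<longlonglongrightarrow> 0"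
  shows "(\<lambda>n. fourier_coeff (f n) k) \<longlonglongrightarrow> fourier_coeff f' k"
  unfolding fourier_coeff_def by (intro l2_inner_tendsto assms L2_powi)

definition taylor_sum :: "(nat \<Rightarrow> complex) \<Rightarrow> nat \<Rightarrow> complex \<Rightarrow> complex" where
  "taylor_sum a N z = (\<Sum>n<N. a n * z ^ n)"

lemma L2_taylor_sum: "taylor_sum a N \<in> L2"
  unfolding taylor_sum_def by (intro L2_continuous continuous_intros)

lemma l2_inner_taylor_sum_left:
  assumes "g \<in> L2"
  shows "l2_inner (taylor_sum a N) g = (\<Sum>n<N. a n * l2_inner (\<lambda>\<zeta>. \<zeta> ^ n) g)"
  unfolding taylor_sum_def
  by (subst l2_inner_sum_left) (auto intro!: assms L2_cmult L2_power simp: l2_inner_cmult_left)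

lemma fourier_coeff_taylor_sum:
  "fourier_coeff (taylor_sum a N) k = (if 0 \<le> k \<and> nat k < N then a (nat k) else 0)"
proof -
  have "fourier_coeff (taylor_sum a N) k = (\<Sum>n<N. a n * (if int n = k then 1 else 0))"
    unfolding fourier_coeff_def l2_inner_taylor_sum_left[OF L2_powi] l2_inner_powi[symmetric] by simp
  also have "\<dots> = (\<Sum>n<N. if n = nat k then (if k \<ge> 0 then a n else 0) else 0)"
    by (intro sum.cong) auto
  finally show ?thesis by simp
qed

lemma l2_inner_taylor_sum_right:
  assumes "f \<in> L2"
  shows "l2_inner f (taylor_sum a N) = (\<Sum>n<N. cnj (a n) * fourier_coeff f (int n))"
  unfolding l2_inner_commute[of f "taylor_sum a N"] l2_inner_taylor_sum_left[OF assms] fourier_coeff_def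
  by (simp add: l2_inner_commute[of f])

lemma l2_sq_taylor_sum: "l2_sq (taylor_sum a N) = (\<Sum>n<N. (norm (a n))\<^sup>2)"
proof -
  have "complex_of_real (l2_sq (taylor_sum a N)) = (\<Sum>n<N. cnj (a n) * a n)"
    unfolding l2_inner_self[symmetric] l2_inner_taylor_sum_right[OF L2_taylor_sum] fourier_coeff_taylor_sum
    by (intro sum.cong) auto
  also have "\<dots> = complex_of_real (\<Sum>n<N. (norm (a n))\<^sup>2)"
    by (simp add: complex_norm_square mult.commute del: of_real_power)
  finally show ?thesis by (simp only: of_real_eq_iff)
qed

lemma taylor_sum_diff:
  assumes "N \<le> K"
  shows "taylor_sum a K z - taylor_sum a N z = taylor_sum (\<lambda>n. if N \<le> n then a n else 0) K z"
proof -
  have "taylor_sum a K z = (\<Sum>n\<in>{..<N}. a n * z ^ n) + (\<Sum>n\<in>{N..<K}. a n * z ^ n)"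
    unfolding taylor_sum_def using assms
    by (subst sum.union_disjoint[symmetric]) (auto simp: ivl_disj_un_one)
  moreover have "taylor_sum (\<lambda>n. if N \<le> n then a n else 0) K z = (\<Sum>n\<in>{N..<K}. a n * z ^ n)"
    unfolding taylor_sum_def by (rule sum.mono_neutral_cong_right) auto
  ultimately show ?thesis by (simp add: taylor_sum_def)
qed

lemma l2_sq_diff_taylor_sum:
  assumes f: "f \<in> L2" and a: "\<And>n. n < N \<Longrightarrow> a n = fourier_coeff f (int n)"
  shows "l2_sq (\<lambda>\<zeta>. f \<zeta> - taylor_sum a N \<zeta>) = l2_sq f - (\<Sum>n<N. (norm (a n))\<^sup>2)"
proof -
  have "l2_inner f (taylor_sum a N) = (\<Sum>n<N. cnj (a n) * a n)"
    unfolding l2_inner_taylor_sum_right[OF f] using a by simp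
  also have "\<dots> = complex_of_real (\<Sum>n<N. (norm (a n))\<^sup>2)"
    by (simp add: complex_norm_square mult.commute del: of_real_power)
  finally show ?thesis
    by (simp add: l2_sq_diff[OF f L2_taylor_sum] l2_sq_taylor_sum)
qed

lemma bessel:
  assumes f: "f \<in> L2"
  shows "(\<Sum>n<N. (norm (fourier_coeff f (int n)))\<^sup>2) \<le> l2_sq f"
  using l2_sq_nonneg[of "\<lambda>\<zeta>. f \<zeta> - taylor_sum (\<lambda>n. fourier_coeff f (int n)) N \<zeta>"]
  by (subst (asm) l2_sq_diff_taylor_sum[OF f]) auto

lemma summable_fourier_sq:
  assumes "f \<in> L2" shows "summable (\<lambda>n. (norm (fourier_coeff f (int n)))\<^sup>2)"
  by (rule summableI_nonneg_bounded[of _ "l2_sq f"]) (auto intro: bessel assms)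

text \<open>The partial sums are Cauchy in L^2, hence in L^1, so a subsequence converges almost
  everywhere. Fatou's lemma along this subsequence bounds the squared distance from the limit to the
  \<open>N\<close>-th partial sum by the tail \<open>T N\<close>.\<close>

theorem riesz_fischer:
  assumes a: "summable (\<lambda>n. (norm (a n))\<^sup>2)"
  obtains f where "f \<in> H2" "\<And>n. fourier_coeff f (int n) = a n"
    "(\<lambda>N. l2_sq (\<lambda>\<zeta>. taylor_sum a N \<zeta> - f \<zeta>)) \<longlonglongrightarrow> 0"
proof -
  let ?s = "taylor_sum a" and ?M = circle_measure
  define T where "T N = (\<Sum>n. (norm (a (n + N)))\<^sup>2)" for N
  have T0: "T \<longlonglongrightarrow> 0" unfolding T_def by (rule suminf_exist_split2[OF a])
  have [measurable]: "?s N \<in> borel_measurable ?M" for N by (rule L2_measurable[OF L2_taylor_sum])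
  have tail: "l2_sq (\<lambda>\<zeta>. ?s K \<zeta> - ?s N \<zeta>) \<le> T N" if "N \<le> K" for N K
  proof -
    have "l2_sq (\<lambda>\<zeta>. ?s K \<zeta> - ?s N \<zeta>) = (\<Sum>n<K. (norm (if N \<le> n then a n else 0))\<^sup>2)"
      using l2_sq_taylor_sum[of "\<lambda>n. if N \<le> n then a n else 0" K]
      unfolding taylor_sum_diff[OF that] .
    also have "\<dots> = (\<Sum>n\<in>{N..<K}. (norm (a n))\<^sup>2)"
      by (rule sum.mono_neutral_cong_right) auto
    also have "\<dots> = (\<Sum>n<K-N. (norm (a (n + N)))\<^sup>2)"
      using that sum.shift_bounds_nat_ivl[of "\<lambda>n. (norm (a n))\<^sup>2" 0 N "K - N"]
      by (simp add: atLeast0LessThan)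
    also have "\<dots> \<le> T N"
      unfolding T_def by (rule sum_le_suminf) (use summable_ignore_initial_segment[OF a] in auto)
    finally show ?thesis .
  qed
  obtain r where r: "strict_mono r" and ae: "AE \<zeta> in ?M. Cauchy (\<lambda>i. ?s (r i) \<zeta>)"
  proof (rule cauchy_L1_AE_cauchy_subseq)
    show "integrable ?M (?s n)" for n by (rule L2_integrable[OF L2_taylor_sum])
    fix e :: real assume e: "e > 0"
    have one: "(\<lambda>_. 1) \<in> L2" by (intro L2_continuous continuous_intros)
    have one_sq: "l2_sq (\<lambda>_. 1) = 1" unfolding l2_sq_def using circle.prob_space by simp
    \<comment> \<open>With parameter \<open>1 / e\<close> and second factor 1, the L^1 distance is
      at most \<open>(T j / e + e) / 2\<close>, which is below \<open>e\<close> once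
      \<open>T j < e * e\<close>.\<close>
    from LIMSEQ_D[OF T0, of "e * e"] e obtain N where N: "\<And>n. n \<ge> N \<Longrightarrow> T n < e * e"
      by (auto simp: abs_less_iff)
    have "(\<integral>\<zeta>. norm (?s i \<zeta> - ?s j \<zeta>) \<partial>?M) < e" if ij: "N \<le> j" "j \<le> i" for i j
    proof -
      have "(\<integral>\<zeta>. norm ((?s i \<zeta> - ?s j \<zeta>) * 1) \<partial>?M) \<le> ((1/e) * l2_sq (\<lambda>\<zeta>. ?s i \<zeta> - ?s j \<zeta>) + l2_sq (\<lambda>_. 1) / (1/e)) / 2"
        using e by (intro integral_norm_mult_bound L2_diff L2_taylor_sum one) auto
      also have "\<dots> \<le> ((1/e) * T j + e) / 2"
        using tail[OF ij(2)] e unfolding one_sq by (simp add: divide_right_mono)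
      also have "\<dots> < e" using N[OF ij(1)] e by (simp add: field_simps)
      finally show ?thesis by simp
    qed note * = this
    have "(\<integral>\<zeta>. norm (?s i \<zeta> - ?s j \<zeta>) \<partial>?M) < e" if "i \<ge> N" "j \<ge> N" for i j
      using *[of i j] *[of j i] that by (cases "j \<le> i") (auto simp: norm_minus_commute)
    then show "\<exists>N. \<forall>i\<ge>N. \<forall>j\<ge>N. (\<integral>\<zeta>. norm (?s i \<zeta> - ?s j \<zeta>) \<partial>?M) < e" by blast
  qed
  define f where "f \<zeta> = lim (\<lambda>i. ?s (r i) \<zeta>)" for \<zeta>
  have [measurable]: "f \<in> borel_measurable ?M" unfolding f_def by measurable
  have ae_lim: "AE \<zeta> in ?M. (\<lambda>i. ?s (r i) \<zeta>) \<longlonglongrightarrow> f \<zeta>"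
    using ae unfolding f_def by eventually_elim (simp add: Cauchy_convergent_iff convergent_LIMSEQ_iff)
  \<comment> \<open>Integrability of the limit is not known yet, so the estimate is made for the
    nonnegative extended integral; it then yields both membership in \<open>L2\<close> and
    convergence.\<close>
  have nn: "(\<integral>\<^sup>+\<zeta>. ennreal ((norm (f \<zeta> - ?s N \<zeta>))\<^sup>2) \<partial>?M) \<le> ennreal (T N)" for N
  proof -
    have "(\<integral>\<^sup>+\<zeta>. ennreal ((norm (f \<zeta> - ?s N \<zeta>))\<^sup>2) \<partial>?M) =
        (\<integral>\<^sup>+\<zeta>. liminf (\<lambda>i. ennreal ((norm (?s (r i) \<zeta> - ?s N \<zeta>))\<^sup>2)) \<partial>?M)"
    proof (rule nn_integral_cong_AE)
      show "AE \<zeta> in ?M. ennreal ((norm (f \<zeta> - ?s N \<zeta>))\<^sup>2) = liminf (\<lambda>i. ennreal ((norm (?s (r i) \<zeta> - ?s N \<zeta>))\<^sup>2))"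
        using ae_lim
      proof eventually_elim
        case (elim \<zeta>)
        have "(\<lambda>i. ennreal ((norm (?s (r i) \<zeta> - ?s N \<zeta>))\<^sup>2)) \<longlonglongrightarrow> ennreal ((norm (f \<zeta> - ?s N \<zeta>))\<^sup>2)"
          by (intro tendsto_intros elim)
        from lim_imp_Liminf[OF _ this] show ?case by simp
      qed
    qed
    also have "\<dots> \<le> liminf (\<lambda>i. \<integral>\<^sup>+\<zeta>. ennreal ((norm (?s (r i) \<zeta> - ?s N \<zeta>))\<^sup>2) \<partial>?M)"
      by (rule nn_integral_liminf) measurable
    also have "\<dots> \<le> ennreal (T N)"
    proof (rule Liminf_le)
      have "(\<integral>\<^sup>+\<zeta>. ennreal ((norm (?s (r i) \<zeta> - ?s N \<zeta>))\<^sup>2) \<partial>?M) \<le> ennreal (T N)" if "i \<ge> N" for i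
      proof -
        have "r i \<ge> N" using seq_suble[OF r, of i] that by simp
        then have "l2_sq (\<lambda>\<zeta>. ?s (r i) \<zeta> - ?s N \<zeta>) \<le> T N" by (rule tail)
        moreover have "(\<integral>\<^sup>+\<zeta>. ennreal ((norm (?s (r i) \<zeta> - ?s N \<zeta>))\<^sup>2) \<partial>?M) = ennreal (l2_sq (\<lambda>\<zeta>. ?s (r i) \<zeta> - ?s N \<zeta>))"
          unfolding l2_sq_def by (intro nn_integral_eq_integral L2_integrable_sq L2_diff L2_taylor_sum) auto
        ultimately show ?thesis by (simp add: ennreal_leI)
      qed
      then show "\<forall>\<^sub>F i in sequentially. (\<integral>\<^sup>+\<zeta>. ennreal ((norm (?s (r i) \<zeta> - ?s N \<zeta>))\<^sup>2) \<partial>?M) \<le> ennreal (T N)"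
        by (rule eventually_sequentiallyI)
    qed simp
    finally show ?thesis .
  qed
  have int: "integrable ?M (\<lambda>\<zeta>. (norm (f \<zeta> - ?s N \<zeta>))\<^sup>2)" for N
  proof (rule integrableI_bounded)
    show "(\<integral>\<^sup>+\<zeta>. ennreal (norm ((norm (f \<zeta> - ?s N \<zeta>))\<^sup>2)) \<partial>?M) < \<infinity>"
      using nn[of N] by (simp add: le_less_trans[OF _ ennreal_less_top])
  qed measurable
  have f: "f \<in> L2"
    using int[of 0] by (simp add: L2_def taylor_sum_def)
  have le: "l2_sq (\<lambda>\<zeta>. ?s N \<zeta> - f \<zeta>) \<le> T N" for N
  proof -
    have "ennreal (l2_sq (\<lambda>\<zeta>. f \<zeta> - ?s N \<zeta>)) \<le> ennreal (T N)"
      using nn[of N] unfolding l2_sq_def by (subst nn_integral_eq_integral[symmetric]) (auto intro: int)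
    moreover have "T N \<ge> 0" unfolding T_def by (intro suminf_nonneg summable_ignore_initial_segment a) auto
    ultimately show ?thesis by (simp add: l2_sq_diff_commute)
  qed
  have lim: "(\<lambda>N. l2_sq (\<lambda>\<zeta>. ?s N \<zeta> - f \<zeta>)) \<longlonglongrightarrow> 0"
    by (rule tendsto_sandwich[OF _ _ tendsto_const T0]) (auto intro!: always_eventually le)
  note coeff = fourier_coeff_tendsto[OF L2_taylor_sum f lim]
  have "fourier_coeff f (int n) = a n" for n
  proof -
    have "(\<lambda>N. fourier_coeff (?s N) (int n)) \<longlonglongrightarrow> a n"
      by (rule tendsto_eventually, rule eventually_sequentiallyI[of "Suc n"]) (simp add: fourier_coeff_taylor_sum)
    then show ?thesis using coeff LIMSEQ_unique by blast
  qed
  moreover have "fourier_coeff f k = 0" if "k < 0" for k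
  proof -
    have "(\<lambda>N. fourier_coeff (?s N) k) \<longlonglongrightarrow> 0"
      using that by (simp add: fourier_coeff_taylor_sum)
    then show ?thesis using coeff LIMSEQ_unique by blast
  qed
  ultimately show ?thesis using that[of f] f lim by (auto simp: H2_def)
qed


section \<open>Uniqueness of Fourier coefficients for integrable functions\<close>

inductive trig_poly :: "(complex \<Rightarrow> complex) \<Rightarrow> bool" where
  monom: "trig_poly (\<lambda>\<zeta>. c * \<zeta> powi k)"
| add: "trig_poly f \<Longrightarrow> trig_poly g \<Longrightarrow> trig_poly (\<lambda>\<zeta>. f \<zeta> + g \<zeta>)"

text \<open>The product is matched only on the circle, because exponents of \<open>powi\<close> add
  up only at nonzero points.\<close>

lemma trig_poly_mult_monom:
  assumes "trig_poly g"
  shows "\<exists>h. trig_poly h \<and> (\<forall>\<zeta>\<in>sphere 0 1. h \<zeta> = c * \<zeta> powi k * g \<zeta>)"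
  using assms
proof induction
  case (monom c' k')
  show ?case
  proof (intro exI conjI ballI)
    show "trig_poly (\<lambda>\<zeta>. (c * c') * \<zeta> powi (k + k'))" by (rule trig_poly.monom)
    fix \<zeta> :: complex assume "\<zeta> \<in> sphere 0 1"
    then have "\<zeta> \<noteq> 0" by auto
    then show "(c * c') * \<zeta> powi (k + k') = c * \<zeta> powi k * (c' * \<zeta> powi k')"
      by (simp add: power_int_add)
  qed
next
  case (add f g)
  then obtain h1 h2 where "trig_poly h1" "trig_poly h2"
     "\<forall>\<zeta>\<in>sphere 0 1. h1 \<zeta> = c * \<zeta> powi k * f \<zeta>" "\<forall>\<zeta>\<in>sphere 0 1. h2 \<zeta> = c * \<zeta> powi k * g \<zeta>" by blast
  then show ?case
    by (intro exI[of _ "\<lambda>\<zeta>. h1 \<zeta> + h2 \<zeta>"]) (auto intro: trig_poly.add simp: distrib_left)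
qed

lemma trig_poly_mult:
  assumes "trig_poly f" "trig_poly g"
  shows "\<exists>h. trig_poly h \<and> (\<forall>\<zeta>\<in>sphere 0 1. h \<zeta> = f \<zeta> * g \<zeta>)"
  using assms(1)
proof induction
  case (monom c k)
  show ?case by (rule trig_poly_mult_monom[OF assms(2)])
next
  case (add f1 f2)
  then obtain h1 h2 where "trig_poly h1" "trig_poly h2"
     "\<forall>\<zeta>\<in>sphere 0 1. h1 \<zeta> = f1 \<zeta> * g \<zeta>" "\<forall>\<zeta>\<in>sphere 0 1. h2 \<zeta> = f2 \<zeta> * g \<zeta>" by blast
  then show ?case
    by (intro exI[of _ "\<lambda>\<zeta>. h1 \<zeta> + h2 \<zeta>"]) (auto intro: trig_poly.add simp: distrib_right)
qed

lemma real_polynomial_function_trig_poly: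
  assumes "real_polynomial_function p"
  shows "\<exists>h. trig_poly h \<and> (\<forall>\<zeta>\<in>sphere 0 1. h \<zeta> = complex_of_real (p \<zeta>))"
  using assms
proof induction
  case (linear p)
  then interpret bounded_linear p .
  let ?a = "complex_of_real (p 1)" and ?b = "complex_of_real (p \<i>)"
  show ?case
  proof (intro exI conjI ballI)
    \<comment> \<open>These coefficients come from Re z = (z + cnj z) / 2 and Im z = (z - cnj z) /
      (2i), with cnj z equal to the inverse of z on the circle.\<close>
    show "trig_poly (\<lambda>\<zeta>. (?a / 2 + ?b / (2 * \<i>)) * \<zeta> powi 1 + (?a / 2 - ?b / (2 * \<i>)) * \<zeta> powi (-1))"
      by (intro trig_poly.intros)
    fix \<zeta> :: complex assume "\<zeta> \<in> sphere 0 1"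
    then have inv: "\<zeta> powi (-1) = cnj \<zeta>"
      by (simp add: cnj_on_circle power_int_minus)
    have "p \<zeta> = p (Re \<zeta> *\<^sub>R 1 + Im \<zeta> *\<^sub>R \<i>)"
      by (rule arg_cong[of _ _ p]) (simp add: complex_eq_iff)
    also have "\<dots> = Re \<zeta> * p 1 + Im \<zeta> * p \<i>"
      by (simp only: add scaleR real_scaleR_def)
    finally show "(?a / 2 + ?b / (2 * \<i>)) * \<zeta> powi 1 + (?a / 2 - ?b / (2 * \<i>)) * \<zeta> powi (-1) = complex_of_real (p \<zeta>)"
      unfolding inv by (simp add: complex_eq_iff Re_divide Im_divide field_simps)
  qed
next
  case (const c)
  show ?case using trig_poly.monom[of "complex_of_real c" 0] by force
next
  case (add p q)
  then obtain h1 h2 where "trig_poly h1" "trig_poly h2"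
     "\<forall>\<zeta>\<in>sphere 0 1. h1 \<zeta> = complex_of_real (p \<zeta>)" "\<forall>\<zeta>\<in>sphere 0 1. h2 \<zeta> = complex_of_real (q \<zeta>)" by blast
  then show ?case
    by (intro exI[of _ "\<lambda>\<zeta>. h1 \<zeta> + h2 \<zeta>"]) (auto intro: trig_poly.add)
next
  case (mult p q)
  then obtain h1 h2 where "trig_poly h1" "trig_poly h2" and
     h: "\<forall>\<zeta>\<in>sphere 0 1. h1 \<zeta> = complex_of_real (p \<zeta>)" "\<forall>\<zeta>\<in>sphere 0 1. h2 \<zeta> = complex_of_real (q \<zeta>)" by blast
  then obtain h3 where "trig_poly h3" "\<forall>\<zeta>\<in>sphere 0 1. h3 \<zeta> = h1 \<zeta> * h2 \<zeta>"
    using trig_poly_mult by blast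
  then show ?case using h by (intro exI[of _ h3]) auto
qed

lemma trig_poly_continuous: "trig_poly f \<Longrightarrow> continuous_on (sphere 0 1) f"
  by (induction rule: trig_poly.induct) (auto intro!: continuous_intros)

lemma integrable_mult_continuous:
  assumes f: "integrable circle_measure f" and g: "continuous_on (sphere 0 1) g"
  shows "integrable circle_measure (\<lambda>\<zeta>. f \<zeta> * g \<zeta> :: complex)"
proof -
  note [measurable] = borel_measurable_integrable[OF f] measurable_circle_continuous[OF g]
  have "compact (g ` sphere 0 1)" by (intro compact_continuous_image g) auto
  then obtain C where C: "\<And>\<zeta>. \<zeta> \<in> sphere 0 1 \<Longrightarrow> norm (g \<zeta>) \<le> C"
    by (meson bounded_iff compact_imp_bounded imageI)
  show ?thesis
  proof (rule Bochner_Integration.integrable_bound)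
    show "integrable circle_measure (\<lambda>\<zeta>. C * norm (f \<zeta>))" using f by simp
    show "AE \<zeta> in circle_measure. norm (f \<zeta> * g \<zeta>) \<le> norm (C * norm (f \<zeta>))"
    proof (rule AE_I2)
      fix \<zeta> assume "\<zeta> \<in> space circle_measure"
      then have "norm (g \<zeta>) \<le> C" using C by simp
      then have "norm (f \<zeta>) * norm (g \<zeta>) \<le> norm (f \<zeta>) * \<bar>C\<bar>" by (intro mult_left_mono) auto
      then show "norm (f \<zeta> * g \<zeta>) \<le> norm (C * norm (f \<zeta>))"
        by (simp add: norm_mult abs_mult mult.commute)
    qed
  qed measurable
qed

context
  fixes f :: "complex \<Rightarrow> complex"
  assumes f: "integrable circle_measure f"
    and coeff0: "\<And>k. (\<integral>\<zeta>. f \<zeta> * cnj (\<zeta> powi k) \<partial>circle_measure) = 0"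
begin

lemma integral_mult_trig_poly_0:
  assumes "trig_poly g" shows "(\<integral>\<zeta>. f \<zeta> * g \<zeta> \<partial>circle_measure) = 0"
  using assms
proof induction
  case (monom c k)
  have "(\<integral>\<zeta>. f \<zeta> * (c * \<zeta> powi k) \<partial>circle_measure) = (\<integral>\<zeta>. c * (f \<zeta> * cnj (\<zeta> powi (-k))) \<partial>circle_measure)"
  proof (rule Bochner_Integration.integral_cong[OF refl])
    fix \<zeta> assume "\<zeta> \<in> space circle_measure"
    then have "norm \<zeta> = 1" by simp
    then show "f \<zeta> * (c * \<zeta> powi k) = c * (f \<zeta> * cnj (\<zeta> powi (-k)))"
      unfolding sphere_powi_uminus[OF \<open>norm \<zeta> = 1\<close>] by simp
  qed
  then show ?case using coeff0 by simp
next
  case (add g h)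
  then show ?case
    by (simp add: distrib_left integrable_mult_continuous[OF f] trig_poly_continuous)
qed

text \<open>By Stone-Weierstrass \<open>g\<close> is uniformly close to a polynomial in the real
  coordinates, which is a trigonometric polynomial on the circle; the error is at most
  \<open>e\<close> times the L^1 norm of \<open>f\<close>.\<close>

lemma integral_mult_continuous_0:
  fixes g :: "complex \<Rightarrow> real"
  assumes g: "continuous_on (sphere 0 1) g"
  shows "(\<integral>\<zeta>. f \<zeta> * g \<zeta> \<partial>circle_measure) = 0"
proof -
  have le: "norm (\<integral>\<zeta>. f \<zeta> * g \<zeta> \<partial>circle_measure) \<le> e * (\<integral>\<zeta>. norm (f \<zeta>) \<partial>circle_measure)" if e: "e > 0" for e
  proof -
    obtain p where p: "real_polynomial_function p" "\<And>\<zeta>. \<zeta> \<in> sphere 0 1 \<Longrightarrow> \<bar>g \<zeta> - p \<zeta>\<bar> < e"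
      using Stone_Weierstrass_real_polynomial_function[OF compact_sphere g e] by blast
    obtain h where h: "trig_poly h" "\<forall>\<zeta>\<in>sphere 0 1. h \<zeta> = complex_of_real (p \<zeta>)"
      using real_polynomial_function_trig_poly[OF p(1)] by blast
    have gc: "continuous_on (sphere 0 1) (\<lambda>\<zeta>. complex_of_real (g \<zeta>))" by (intro continuous_intros g)
    note int = integrable_mult_continuous[OF f gc] integrable_mult_continuous[OF f trig_poly_continuous[OF h(1)]]
    have "(\<integral>\<zeta>. f \<zeta> * g \<zeta> \<partial>circle_measure) = (\<integral>\<zeta>. f \<zeta> * g \<zeta> - f \<zeta> * h \<zeta> \<partial>circle_measure)"
      using integral_mult_trig_poly_0[OF h(1)] int by simp
    also have "norm \<dots> \<le> (\<integral>\<zeta>. norm (f \<zeta> * g \<zeta> - f \<zeta> * h \<zeta>) \<partial>circle_measure)"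
      by (rule integral_norm_bound)
    also have "\<dots> \<le> (\<integral>\<zeta>. e * norm (f \<zeta>) \<partial>circle_measure)"
    proof (rule integral_mono)
      fix \<zeta> assume z: "\<zeta> \<in> space circle_measure"
      then have "norm (complex_of_real (g \<zeta>) - h \<zeta>) \<le> e"
        using h(2) p(2)[of \<zeta>] by (simp flip: of_real_diff)
      then have "norm (f \<zeta>) * norm (complex_of_real (g \<zeta>) - h \<zeta>) \<le> norm (f \<zeta>) * e"
        by (intro mult_left_mono) auto
      then show "norm (f \<zeta> * g \<zeta> - f \<zeta> * h \<zeta>) \<le> e * norm (f \<zeta>)"
        by (simp add: norm_mult mult.commute flip: right_diff_distrib)
    qed (use f int in auto)
    finally show ?thesis by simp
  qed
  show ?thesis
  proof (rule ccontr)
    let ?x = "norm (\<integral>\<zeta>. f \<zeta> * g \<zeta> \<partial>circle_measure)" and ?I = "(\<integral>\<zeta>. norm (f \<zeta>) \<partial>circle_measure)"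
    assume "(\<integral>\<zeta>. f \<zeta> * g \<zeta> \<partial>circle_measure) \<noteq> 0"
    then have pos: "?x > 0" by simp
    define I x where "I = (\<integral>\<zeta>. norm (f \<zeta>) \<partial>circle_measure)" and "x = norm (\<integral>\<zeta>. f \<zeta> * g \<zeta> \<partial>circle_measure)"
    have I: "I \<ge> 0" unfolding I_def by simp
    have x: "x > 0" unfolding x_def by (rule pos)
    \<comment> \<open>With this choice the upper bound is less than \<open>x\<close> itself; the
      summand 1 covers the case \<open>I = 0\<close>.\<close>
    have "x / (2 * (I + 1)) > 0" using x I by simp
    from le[OF this] have "x \<le> x / (2 * (I + 1)) * I" by (simp only: I_def x_def)
    also have "\<dots> = x * (I / (2 * (I + 1)))" by simp
    also have "\<dots> < x * 1"
    proof (intro mult_strict_left_mono x)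
      show "I / (2 * (I + 1)) < 1" using I by (subst pos_divide_less_eq) auto
    qed
    finally show False by simp
  qed
qed

lemma integral_indicator_closed_0:
  assumes A: "closed A" "A \<noteq> {}"
  shows "(\<integral>\<zeta>. f \<zeta> * indicator A \<zeta> \<partial>circle_measure) = 0"
proof -
  note [measurable] = borel_measurable_integrable[OF f]
  \<comment> \<open>Continuous cut-offs equal to 1 on \<open>A\<close> and vanishing at distance at
    least \<open>1 / n\<close> from \<open>A\<close>; closedness of \<open>A\<close> makes them
    converge to the indicator pointwise.\<close>
  define h where "h n \<zeta> = max 0 (1 - real n * infdist \<zeta> A)" for n \<zeta>
  have hc: "continuous_on (sphere 0 1) (h n)" for n
    unfolding h_def by (intro continuous_intros)
  have [measurable]: "h n \<in> borel_measurable circle_measure" for n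
    by (rule measurable_circle_continuous[OF hc])
  have [measurable]: "(indicator A :: complex \<Rightarrow> complex) \<in> borel_measurable circle_measure"
    using A by (intro measurable_circle_borel) auto
  have "(\<lambda>n. \<integral>\<zeta>. f \<zeta> * h n \<zeta> \<partial>circle_measure) \<longlonglongrightarrow> (\<integral>\<zeta>. f \<zeta> * indicator A \<zeta> \<partial>circle_measure)"
  proof (rule integral_dominated_convergence[where w = "\<lambda>\<zeta>. norm (f \<zeta>)"])
    show "AE \<zeta> in circle_measure. (\<lambda>n. f \<zeta> * complex_of_real (h n \<zeta>)) \<longlonglongrightarrow> f \<zeta> * indicator A \<zeta>"
    proof (rule AE_I2)
      fix \<zeta>
      have "(\<lambda>n. h n \<zeta>) \<longlonglongrightarrow> indicator A \<zeta>"
      proof (cases "\<zeta> \<in> A")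
        case True
        then show ?thesis by (simp add: h_def)
      next
        case False
        then have pos: "infdist \<zeta> A > 0"
          using A by (metis in_closed_iff_infdist_zero infdist_nonneg order_le_less)
        obtain N where N: "real N * infdist \<zeta> A > 1" using reals_Archimedean3[OF pos] by blast
        have "h n \<zeta> = 0" if "n \<ge> N" for n
        proof -
          have "real N * infdist \<zeta> A \<le> real n * infdist \<zeta> A"
            using that pos by (intro mult_right_mono) auto
          then show ?thesis using N by (simp add: h_def)
        qed
        then have "(\<lambda>n. h n \<zeta>) \<longlonglongrightarrow> 0"
          by (intro tendsto_eventually eventually_sequentiallyI)
        then show ?thesis using False by simp
      qed
      then have "(\<lambda>n. f \<zeta> * complex_of_real (h n \<zeta>)) \<longlonglongrightarrow> f \<zeta> * complex_of_real (indicator A \<zeta>)"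
        by (intro tendsto_intros)
      then show "(\<lambda>n. f \<zeta> * complex_of_real (h n \<zeta>)) \<longlonglongrightarrow> f \<zeta> * indicator A \<zeta>"
        by (cases "\<zeta> \<in> A") simp_all
    qed
    fix n
    have "\<bar>h n \<zeta>\<bar> \<le> 1" for \<zeta>
      unfolding h_def by (auto simp: infdist_nonneg)
    then show "AE \<zeta> in circle_measure. norm (f \<zeta> * complex_of_real (h n \<zeta>)) \<le> norm (f \<zeta>)"
      by (auto simp: norm_mult mult_left_le)
  qed (use f in auto)
  then have "(\<lambda>n::nat. 0) \<longlonglongrightarrow> (\<integral>\<zeta>. f \<zeta> * indicator A \<zeta> \<partial>circle_measure)"
    unfolding integral_mult_continuous_0[OF hc] .
  from LIMSEQ_unique[OF this tendsto_const] show ?thesis .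
qed

text \<open>Taking closed arcs as sets, the indefinite integral of \<open>f (cis t)\<close> vanishes
  identically. Its derivative is the integrand almost everywhere, so the integrand vanishes
  there.\<close>

lemma AE_eq_0_if_fourier_coeff_0: "AE \<zeta> in circle_measure. f \<zeta> = 0"
proof -
  note [measurable] = borel_measurable_integrable[OF f]
  let ?g = "\<lambda>t. f (cis t)"
  have g: "set_integrable lborel {0..2*pi} ?g"
    using f by (subst integrable_circle_iff[symmetric]) auto
  have gHK: "?g integrable_on {0..2*pi}"
    by (rule set_borel_integral_eq_integral(1)[OF g])
  have zero: "integral {0..x} ?g = 0" if x: "x \<in> {0<..<2*pi}" for x
  proof -
    let ?A = "cis ` {0..x}"
    have "compact ?A" by (intro compact_continuous_image continuous_intros) auto
    then have A: "closed ?A" "?A \<noteq> {}" using x by (auto simp: compact_imp_closed)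
    have [measurable]: "(\<lambda>\<zeta>. f \<zeta> * indicator ?A \<zeta>) \<in> borel_measurable circle_measure"
    proof -
      have [measurable]: "(indicator ?A :: complex \<Rightarrow> complex) \<in> borel_measurable circle_measure"
        using A by (intro measurable_circle_borel) auto
      show ?thesis by measurable
    qed
    have sub: "set_integrable lborel {0..x} ?g"
      by (rule set_integrable_subset[OF g]) (use x in auto)
    have "0 = (LINT t:{0..2*pi}|lborel. ?g t * indicator ?A (cis t))"
      using integral_indicator_closed_0[OF A] by (subst (asm) integral_circle) auto
    also have "\<dots> = (LINT t:{0..x}|lborel. ?g t)"
      unfolding set_lebesgue_integral_def
    proof (rule integral_cong_AE)
      \<comment> \<open>At \<open>2 * pi\<close> the point \<open>cis t\<close> returns to 1, which
        lies in the arc although \<open>t\<close> exceeds \<open>x\<close>; this single parameter is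
        discarded.\<close>
      have "AE t in lborel. t \<noteq> 2*pi" by (rule AE_lborel_singleton)
      then show "AE t in lborel. indicat_real {0..2*pi} t *\<^sub>R (?g t * indicator ?A (cis t)) = indicat_real {0..x} t *\<^sub>R ?g t"
      proof eventually_elim
        case (elim t)
        have "cis t \<in> ?A \<longleftrightarrow> t \<le> x" if "0 \<le> t" "t < 2*pi"
        proof
          assume "cis t \<in> ?A"
          then obtain s where s: "0 \<le> s" "s \<le> x" "cis t = cis s" by auto
          then have "sin t = sin s \<and> cos t = cos s" by (simp add: complex_eq_iff)
          then obtain n :: int where n: "t = s + 2 * pi * n" unfolding sin_cos_eq_iff by blast
          have "2 * pi * \<bar>real_of_int n\<bar> < 2 * pi * 1"
          proof -
            have "\<bar>2 * pi * real_of_int n\<bar> < 2 * pi" using n that s(1,2) x by auto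
            then show ?thesis by (simp add: abs_mult)
          qed
          then have "n = 0" by simp
          then have "t = s" using n by simp
          then show "t \<le> x" using s by simp
        qed (use that in auto)
        then show ?case using elim x by (auto simp: indicator_def)
      qed
      show "(\<lambda>t. indicat_real {0..2*pi} t *\<^sub>R (?g t * indicator ?A (cis t))) \<in> borel_measurable lborel"
        using measurable_compose[OF cis_measurable_circle \<open>(\<lambda>\<zeta>. f \<zeta> * indicator ?A \<zeta>) \<in> borel_measurable circle_measure\<close>]
        by (intro borel_measurable_scaleR) auto
      show "(\<lambda>t. indicat_real {0..x} t *\<^sub>R ?g t) \<in> borel_measurable lborel"
        using sub by (simp add: set_integrable_def)
    qed
    also have "\<dots> = integral {0..x} ?g" by (rule set_borel_integral_eq_integral(2)[OF sub])
    finally show ?thesis by simp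
  qed
  have deriv: "AE t in lborel. t \<in> {0..2*pi} \<longrightarrow> t \<in> {0<..<2*pi} \<and>
      ((\<lambda>y. integral {0..y} ?g) has_vector_derivative ?g t) (at t)"
    by (rule indefinite_integral_has_vector_derivative_AE[OF gHK])
  from deriv have "AE t in lborel. t \<in> {0..2*pi} \<longrightarrow> ?g t = 0"
  proof eventually_elim
    case (elim t)
    show ?case
    proof
      assume "t \<in> {0..2*pi}"
      with elim have t: "t \<in> {0<..<2*pi}"
        and dg: "((\<lambda>y. integral {0..y} ?g) has_vector_derivative ?g t) (at t)" by blast+
      from dg have "((\<lambda>y. 0) has_vector_derivative ?g t) (at t)"
        by (rule has_vector_derivative_transform_within_open[of _ _ _ "{0<..<2*pi}"]) (use t zero in auto)
      moreover have "((\<lambda>y. 0) has_vector_derivative 0) (at t)" by simp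
      ultimately show "?g t = 0" by (rule vector_derivative_unique_at)
    qed
  qed
  moreover have "{\<zeta>\<in>sphere 0 1. f \<zeta> = 0} \<in> sets circle_measure"
    using measurable_sets[of f circle_measure borel "{0}"] by (simp add: vimage_def Int_def conj_commute)
  ultimately show ?thesis by (subst AE_circle_iff) auto
qed

end


section \<open>Density of polynomials in H^2 and the orthogonal projection\<close>

lemma H2_L2: "f \<in> H2 \<Longrightarrow> f \<in> L2"
  by (simp add: H2_def)

lemma H2_diff: "f \<in> H2 \<Longrightarrow> g \<in> H2 \<Longrightarrow> (\<lambda>\<zeta>. f \<zeta> - g \<zeta>) \<in> H2"
  unfolding H2_def by (auto simp: L2_diff fourier_coeff_diff)

lemma H2_AE_eqI:
  assumes f: "f \<in> H2" and g: "g \<in> H2"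
    and eq: "\<And>n. fourier_coeff f (int n) = fourier_coeff g (int n)"
  shows "AE \<zeta> in circle_measure. f \<zeta> = g \<zeta>"
proof -
  have "fourier_coeff (\<lambda>\<zeta>. f \<zeta> - g \<zeta>) k = 0" for k
  proof (cases "k < 0")
    case True
    then show ?thesis using H2_diff[OF f g] by (simp add: H2_def)
  next
    case False
    then show ?thesis using eq[of "nat k"] by (simp add: fourier_coeff_diff H2_L2 f g)
  qed
  then have "AE \<zeta> in circle_measure. f \<zeta> - g \<zeta> = 0"
    by (intro AE_eq_0_if_fourier_coeff_0 L2_integrable L2_diff H2_L2 f g)
       (simp add: fourier_coeff_def l2_inner_def)
  then show ?thesis by simp
qed

lemma l2_sq_cong_AE:
  assumes "f \<in> borel_measurable circle_measure" "g \<in> borel_measurable circle_measure"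
    and "AE \<zeta> in circle_measure. f \<zeta> = g \<zeta>"
  shows "l2_sq f = l2_sq g"
  unfolding l2_sq_def using assms(1,2)
  by (intro integral_cong_AE eventually_mono[OF assms(3)]) auto

lemma L2_cong_AE:
  assumes f: "f \<in> L2" and g [measurable]: "g \<in> borel_measurable circle_measure"
    and ae: "AE \<zeta> in circle_measure. g \<zeta> = f \<zeta>"
  shows "g \<in> L2"
proof -
  note [measurable] = L2_measurable[OF f]
  have "integrable circle_measure (\<lambda>\<zeta>. (norm (g \<zeta>))\<^sup>2)"
    by (subst integrable_cong_AE[where g = "\<lambda>\<zeta>. (norm (f \<zeta>))\<^sup>2"])
       (auto intro: L2_integrable_sq f eventually_mono[OF ae])
  then show ?thesis by (simp add: L2_def)
qed

lemma H2_cong_AE: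
  assumes f: "f \<in> H2" and g: "g \<in> borel_measurable circle_measure"
    and ae: "AE \<zeta> in circle_measure. g \<zeta> = f \<zeta>"
  shows "g \<in> H2"
proof -
  have "fourier_coeff g k = fourier_coeff f k" for k
    unfolding fourier_coeff_def
    by (rule l2_inner_cong_AE) (use ae in \<open>auto intro: g L2_measurable H2_L2 f L2_powi\<close>)
  then show ?thesis using f L2_cong_AE[OF H2_L2[OF f] g ae] by (simp add: H2_def)
qed

text \<open>Riesz-Fischer applied to the coefficients of \<open>f\<close> produces some limit of
  these sums; uniqueness of coefficients identifies that limit with \<open>f\<close>.\<close>

lemma H2_taylor_tendsto:
  assumes f: "f \<in> H2"
  shows "(\<lambda>N. l2_sq (\<lambda>\<zeta>. taylor_sum (\<lambda>n. fourier_coeff f (int n)) N \<zeta> - f \<zeta>)) \<longlonglongrightarrow> 0"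
proof -
  let ?a = "\<lambda>n. fourier_coeff f (int n)"
  obtain g where g: "g \<in> H2" "\<And>n. fourier_coeff g (int n) = ?a n"
    and lim: "(\<lambda>N. l2_sq (\<lambda>\<zeta>. taylor_sum ?a N \<zeta> - g \<zeta>)) \<longlonglongrightarrow> 0"
    using riesz_fischer[OF summable_fourier_sq[OF H2_L2[OF f]]] by blast
  have "AE \<zeta> in circle_measure. f \<zeta> = g \<zeta>" using g by (intro H2_AE_eqI f) auto
  then have "l2_sq (\<lambda>\<zeta>. taylor_sum ?a N \<zeta> - f \<zeta>) = l2_sq (\<lambda>\<zeta>. taylor_sum ?a N \<zeta> - g \<zeta>)" for N
    by (intro l2_sq_cong_AE L2_measurable L2_diff L2_taylor_sum H2_L2 f g) (auto elim: eventually_mono)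
  then show ?thesis using lim by simp
qed

lemma l2_inner_H2_eq_0:
  assumes k: "k \<in> L2" "\<And>n. fourier_coeff k (int n) = 0" and g: "g \<in> H2"
  shows "l2_inner k g = 0"
proof -
  let ?s = "taylor_sum (\<lambda>n. fourier_coeff g (int n))"
  have "l2_inner (?s N) k = 0" for N
    using l2_inner_taylor_sum_right[OF k(1)] k(2) by (simp add: l2_inner_commute[of "?s N" k])
  moreover have "(\<lambda>N. l2_inner (?s N) k) \<longlonglongrightarrow> l2_inner g k"
    by (intro l2_inner_tendsto L2_taylor_sum H2_L2 g k H2_taylor_tendsto)
  ultimately have "l2_inner g k = 0" using LIMSEQ_unique[OF _ tendsto_const] by simp
  then show ?thesis by (simp add: l2_inner_commute[of k g])
qed

text \<open>The projection keeps the coefficients with nonnegative index. The remainder is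
  orthogonal to all polynomials, hence to all of \<open>H2\<close> by density. This also shows that
  the choice in \<open>P_plus\<close> is made from a nonempty set.\<close>

lemma H2_projection_exists:
  assumes h: "h \<in> L2"
  shows "\<exists>f. f \<in> H2 \<and> (\<forall>g\<in>H2. l2_inner (\<lambda>\<zeta>. h \<zeta> - f \<zeta>) g = 0)"
proof -
  obtain f where f: "f \<in> H2" "\<And>n. fourier_coeff f (int n) = fourier_coeff h (int n)"
    using riesz_fischer[OF summable_fourier_sq[OF h]] by blast
  then have "\<forall>g\<in>H2. l2_inner (\<lambda>\<zeta>. h \<zeta> - f \<zeta>) g = 0"
    by (intro ballI l2_inner_H2_eq_0 L2_diff h) (simp_all add: fourier_coeff_diff H2_L2 h)
  then show ?thesis using f by blast
qed

lemma
  assumes h: "h \<in> L2"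
  shows P_plus_H2: "P_plus h \<in> H2"
    and l2_inner_P_plus: "g \<in> H2 \<Longrightarrow> l2_inner (P_plus h) g = l2_inner h g"
proof -
  have *: "P_plus h \<in> H2 \<and> (\<forall>g\<in>H2. l2_inner (\<lambda>\<zeta>. h \<zeta> - P_plus h \<zeta>) g = 0)"
    unfolding P_plus_def by (rule someI_ex[OF H2_projection_exists[OF h]])
  then show "P_plus h \<in> H2" by blast
  then show "l2_inner (P_plus h) g = l2_inner h g" if "g \<in> H2"
  proof -
    have "l2_inner (\<lambda>\<zeta>. h \<zeta> - P_plus h \<zeta>) g = l2_inner h g - l2_inner (P_plus h) g"
      using * that by (intro l2_inner_diff_left h) (auto simp: H2_L2)
    then show ?thesis using * that by auto
  qed
qed

lemma H2_AE_eq_if_l2_inner_eq: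
  assumes f: "f \<in> H2" and g: "g \<in> H2" and eq: "\<And>h. h \<in> H2 \<Longrightarrow> l2_inner f h = l2_inner g h"
  shows "AE \<zeta> in circle_measure. f \<zeta> = g \<zeta>"
proof -
  let ?d = "\<lambda>\<zeta>. f \<zeta> - g \<zeta>"
  have "complex_of_real (l2_sq ?d) = l2_inner f ?d - l2_inner g ?d"
    by (simp add: l2_inner_diff_left L2_diff H2_L2 f g flip: l2_inner_self)
  also have "\<dots> = 0" using eq[OF H2_diff[OF f g]] by simp
  finally have "AE \<zeta> in circle_measure. ?d \<zeta> = 0"
    by (intro l2_sq_eq_0 L2_diff H2_L2 f g) simp
  then show ?thesis by simp
qed

lemma AE_eq_P_plusI:
  assumes "h \<in> L2" "f \<in> H2" "\<And>g. g \<in> H2 \<Longrightarrow> l2_inner f g = l2_inner h g"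
  shows "AE \<zeta> in circle_measure. f \<zeta> = P_plus h \<zeta>"
  by (rule H2_AE_eq_if_l2_inner_eq) (simp_all add: assms P_plus_H2 l2_inner_P_plus)

section \<open>Radial limits of bounded analytic functions\<close>

lemma contour_integral_unit_circle:
  assumes k: "continuous_on (sphere 0 1) k"
  shows "contour_integral (circlepath 0 1) k = 2 * pi * \<i> * (\<integral>\<xi>. k \<xi> * \<xi> \<partial>circle_measure)"
proof -
  have c: "continuous_on (sphere 0 1) (\<lambda>\<xi>. k \<xi> * \<xi>)" by (intro continuous_intros k)
  have int: "set_integrable lborel {0..2*pi} (\<lambda>t. k (cis t) * cis t)"
    using integrable_circle_continuous[OF c]
    by (subst (asm) integrable_circle_iff) (auto intro: measurable_circle_continuous c)
  have "contour_integral (circlepath 0 1) k = integral {0..2*pi} (\<lambda>t. \<i> * (k (cis t) * cis t))"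
    unfolding circlepath_def by (subst contour_integral_part_circlepath_eq) (auto simp: algebra_simps)
  also have "\<dots> = \<i> * integral {0..2*pi} (\<lambda>t. k (cis t) * cis t)"
    by (rule integral_mult_right)
  also have "\<dots> = \<i> * (LINT t:{0..2*pi}|lborel. k (cis t) * cis t)"
    by (simp add: set_borel_integral_eq_integral(2)[OF int])
  also have "\<dots> = 2 * pi * \<i> * (\<integral>\<xi>. k \<xi> * \<xi> \<partial>circle_measure)"
    by (subst integral_circle) (auto intro: measurable_circle_continuous c)
  finally show ?thesis .
qed

lemma
  assumes h: "continuous_on (cball 0 1) h" "h holomorphic_on ball 0 1" and z: "norm z < 1"
  shows Cauchy_formula_circle: "h z = (\<integral>\<xi>. h \<xi> / (\<xi> - z) * \<xi> \<partial>circle_measure)"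
    and Cauchy_derivative_circle:
      "(h has_field_derivative (\<integral>\<xi>. h \<xi> / (\<xi> - z)\<^sup>2 * \<xi> \<partial>circle_measure)) (at z)"
proof -
  have hs: "continuous_on (sphere 0 1) h" by (rule continuous_on_subset[OF h(1)]) auto
  have ne: "\<xi> - z \<noteq> 0" if "\<xi> \<in> sphere 0 1" for \<xi> using that z by auto
  have "contour_integral (circlepath 0 1) (\<lambda>u. h u / (u - z)) = 2 * pi * \<i> * h z"
    using Cauchy_integral_circlepath[OF h] z by (intro contour_integral_unique) simp
  moreover have "contour_integral (circlepath 0 1) (\<lambda>u. h u / (u - z)) =
      2 * pi * \<i> * (\<integral>\<xi>. h \<xi> / (\<xi> - z) * \<xi> \<partial>circle_measure)"
    by (intro contour_integral_unit_circle continuous_intros hs) (use ne in auto)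
  ultimately show "h z = (\<integral>\<xi>. h \<xi> / (\<xi> - z) * \<xi> \<partial>circle_measure)" by simp
  have "contour_integral (circlepath 0 1) (\<lambda>u. h u / (u - z)\<^sup>2) =
      2 * pi * \<i> * (\<integral>\<xi>. h \<xi> / (\<xi> - z)\<^sup>2 * \<xi> \<partial>circle_measure)"
    by (intro contour_integral_unit_circle continuous_intros hs) (use ne in auto)
  then show "(h has_field_derivative (\<integral>\<xi>. h \<xi> / (\<xi> - z)\<^sup>2 * \<xi> \<partial>circle_measure)) (at z)"
    using Cauchy_derivative_integral_circlepath(2)[OF h, of z] z by simp
qed

lemma norm_one_minus_cnj_mult: "norm \<xi> = 1 \<Longrightarrow> norm (1 - cnj z * \<xi>) = norm (\<xi> - z)"
proof -
  assume "norm \<xi> = 1"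
  then have "1 - cnj z * \<xi> = \<xi> * cnj (\<xi> - z)"
    using complex_norm_square[of \<xi>] by (simp add: algebra_simps)
  then have "norm (1 - cnj z * \<xi>) = norm \<xi> * norm (cnj (\<xi> - z))" by (simp only: norm_mult)
  then show ?thesis by (simp only: complex_mod_cnj \<open>norm \<xi> = 1\<close> mult_1)
qed

lemma one_minus_cnj_mult_nonzero:
  assumes "norm z < 1" "norm u \<le> 1" shows "1 - cnj z * u \<noteq> 0"
proof -
  have "norm (cnj z * u) \<le> norm z * 1"
    using assms unfolding norm_mult complex_mod_cnj by (intro mult_left_mono) auto
  then show ?thesis using assms by auto
qed

lemma integral_poisson_kernel:
  assumes z: "norm z < 1"
  shows "(\<integral>\<xi>. (1 - (norm z)\<^sup>2) / (norm (\<xi> - z))\<^sup>2 \<partial>circle_measure) = 1"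
proof -
  \<comment> \<open>On the circle \<open>1 - cnj z * \<xi>\<close> is
    \<open>\<xi> * cnj (\<xi> - z)\<close>, so this factor turns the Cauchy kernel into
    \<open>1 / (norm (\<xi> - z))\<^sup>2\<close>, while its value at \<open>z\<close> is the
    reciprocal of the numerator of the Poisson kernel.\<close>
  let ?q = "\<lambda>u. 1 / (1 - cnj z * u)"
  have nz: "1 - cnj z * u \<noteq> 0" if "norm u \<le> 1" for u
    by (rule one_minus_cnj_mult_nonzero[OF z that])
  have q: "continuous_on (cball 0 1) ?q" "?q holomorphic_on ball 0 1"
    using nz by (auto intro!: continuous_intros holomorphic_intros)
  have "?q z = (\<integral>\<xi>. ?q \<xi> / (\<xi> - z) * \<xi> \<partial>circle_measure)"
    by (rule Cauchy_formula_circle[OF q z])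
  also have "\<dots> = (\<integral>\<xi>. complex_of_real (1 / (norm (\<xi> - z))\<^sup>2) \<partial>circle_measure)"
  proof (rule Bochner_Integration.integral_cong[OF refl])
    fix \<xi> assume "\<xi> \<in> space circle_measure"
    then have xi: "norm \<xi> = 1" by simp
    have eq: "1 - cnj z * \<xi> = \<xi> * cnj (\<xi> - z)"
      using complex_norm_square[of \<xi>] xi by (simp add: algebra_simps)
    have nz: "\<xi> \<noteq> 0" "\<xi> - z \<noteq> 0" "cnj (\<xi> - z) \<noteq> 0" using xi z by auto
    have "?q \<xi> / (\<xi> - z) * \<xi> = 1 / ((\<xi> - z) * cnj (\<xi> - z))"
      unfolding eq using nz by (simp add: divide_simps)
    also have "\<dots> = complex_of_real (1 / (norm (\<xi> - z))\<^sup>2)"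
      by (simp only: complex_norm_square[symmetric] of_real_divide of_real_1)
    finally show "?q \<xi> / (\<xi> - z) * \<xi> = complex_of_real (1 / (norm (\<xi> - z))\<^sup>2)" .
  qed
  also have "\<dots> = complex_of_real (\<integral>\<xi>. 1 / (norm (\<xi> - z))\<^sup>2 \<partial>circle_measure)"
    by (rule integral_complex_of_real)
  finally have "complex_of_real (\<integral>\<xi>. 1 / (norm (\<xi> - z))\<^sup>2 \<partial>circle_measure) = 1 / (1 - cnj z * z)" by simp
  also have "\<dots> = complex_of_real (1 / (1 - (norm z)\<^sup>2))"
    using complex_norm_square[of z] by (simp add: mult.commute)
  finally have "(\<integral>\<xi>. 1 / (norm (\<xi> - z))\<^sup>2 \<partial>circle_measure) = 1 / (1 - (norm z)\<^sup>2)"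
    by (simp only: of_real_eq_iff)
  moreover have "(norm z)\<^sup>2 < 1" using z by (simp add: abs_square_less_1)
  then have "1 - (norm z)\<^sup>2 \<noteq> 0" by simp
  moreover have "(\<integral>\<xi>. (1 - (norm z)\<^sup>2) * (1 / (norm (\<xi> - z))\<^sup>2) \<partial>circle_measure) =
      (1 - (norm z)\<^sup>2) * (\<integral>\<xi>. 1 / (norm (\<xi> - z))\<^sup>2 \<partial>circle_measure)"
    by (rule integral_mult_right_zero)
  ultimately show ?thesis by simp
qed

lemma integrable_poisson_kernel:
  assumes z: "norm z < 1"
  shows "integrable circle_measure (\<lambda>\<xi>. (1 - (norm z)\<^sup>2) / (norm (\<xi> - z))\<^sup>2)"
  by (intro integrable_circle_continuous continuous_intros) (use z in auto)

text \<open>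
  The weight \<open>w\<close> equals \<open>1\<close> at \<open>z\<close> and is small away from the boundary point near \<open>z\<close>. Cauchy's
  formulas for \<open>g * w\<^sup>2\<close> and its derivative thus represent \<open>g'\<close> at \<open>z\<close> with a kernel that decays like
  the cube of the distance, so that a first-order estimate of \<open>g\<close> still beats it.
\<close>

lemma weighted_Cauchy_estimate:
  fixes g g' :: "complex \<Rightarrow> complex"
  assumes gc: "continuous_on (cball 0 1) g"
    and gd: "\<And>z. z \<in> ball 0 1 \<Longrightarrow> (g has_field_derivative g' z) (at z)"
    and \<zeta>: "norm \<zeta> = 1" and r: "0 \<le> r" "r < 1" and d: "d > 0" and e: "e \<ge> 0"
    and B: "\<And>\<xi>. norm \<xi> = 1 \<Longrightarrow> norm (g \<xi>) \<le> B"
    and osc: "\<And>\<xi>. norm \<xi> = 1 \<Longrightarrow> norm (\<xi> - \<zeta>) < d \<Longrightarrow> norm (g \<xi>) \<le> e * norm (\<xi> - \<zeta>)"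
  shows "norm (g' (of_real r * \<zeta>)) \<le> 8 * e + 32 * B * (1 - r\<^sup>2) / d ^ 3"
proof -
  define z where "z = of_real r * \<zeta>"
  define s where "s = 1 - r\<^sup>2"
  have nz: "norm z = r" unfolding z_def using \<zeta> r by (simp add: norm_mult)
  then have z1: "norm z < 1" using r by simp
  have s: "s > 0" unfolding s_def using r by (simp add: power_less_one_iff abs_square_less_1)
  have B0: "B \<ge> 0" using B[OF \<zeta>] norm_ge_zero[of "g \<zeta>"] by linarith
  define w where "w u = of_real s / (1 - cnj z * u)" for u
  define h where "h u = g u * (w u)\<^sup>2" for u
  have ne: "1 - cnj z * u \<noteq> 0" if "norm u \<le> 1" for u
    by (rule one_minus_cnj_mult_nonzero[OF z1 that])
  have wc: "continuous_on (cball 0 1) w"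
    unfolding w_def by (intro continuous_intros) (use ne in auto)
  have wh: "w holomorphic_on ball 0 1"
    unfolding w_def by (intro holomorphic_intros) (use ne in auto)
  have gh: "g holomorphic_on ball 0 1"
    by (rule holomorphic_onI) (metis gd field_differentiable_def field_differentiable_at_within)
  have hc: "continuous_on (cball 0 1) h" and hh: "h holomorphic_on ball 0 1"
    unfolding h_def by (intro continuous_intros holomorphic_intros gc wc gh wh)+
  have zz: "1 - cnj z * z = of_real s"
    using complex_norm_square[of z] by (simp add: nz s_def mult.commute)
  have w1: "w z = 1" unfolding w_def zz using s by simp
  have dw: "(w has_field_derivative cnj z / s) (at z)"
    unfolding w_def using s
    by (auto intro!: derivative_eq_intros simp: zz ne z1 less_imp_le power2_eq_square)
  have "(h has_field_derivative g' z * (w z)\<^sup>2 + 2 * w z * (cnj z / s) * g z) (at z)"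
    unfolding h_def using z1
    by (auto intro!: derivative_eq_intros gd dw)
  then have dh: "(h has_field_derivative g' z + 2 * (cnj z / s) * g z) (at z)"
    by (simp add: w1)
  have "g' z + 2 * (cnj z / s) * g z = (\<integral>\<xi>. h \<xi> / (\<xi> - z)\<^sup>2 * \<xi> \<partial>circle_measure)"
    by (rule DERIV_unique[OF dh Cauchy_derivative_circle[OF hc hh z1]])
  moreover have "g z = (\<integral>\<xi>. h \<xi> / (\<xi> - z) * \<xi> \<partial>circle_measure)"
    using Cauchy_formula_circle[OF hc hh z1] by (simp add: h_def w1)
  \<comment> \<open>The derivative of the squared weight contributes a multiple of
    \<open>g z\<close>; it is removed by writing \<open>g z\<close> as a Cauchy integral of
    \<open>h\<close> too, so that both terms carry the weight.\<close>
  ultimately have "g' z = (\<integral>\<xi>. h \<xi> / (\<xi> - z)\<^sup>2 * \<xi> \<partial>circle_measure)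
       - 2 * (cnj z / s) * (\<integral>\<xi>. h \<xi> / (\<xi> - z) * \<xi> \<partial>circle_measure)"
    by (simp add: algebra_simps)
  also have "\<dots> = (\<integral>\<xi>. h \<xi> / (\<xi> - z)\<^sup>2 * \<xi> - 2 * (cnj z / s) * (h \<xi> / (\<xi> - z) * \<xi>) \<partial>circle_measure)"
  proof -
    have hs: "continuous_on (sphere 0 1) h" by (rule continuous_on_subset[OF hc]) auto
    have "integrable circle_measure (\<lambda>\<xi>. h \<xi> / (\<xi> - z)\<^sup>2 * \<xi>)"
      "integrable circle_measure (\<lambda>\<xi>. 2 * (cnj z / s) * (h \<xi> / (\<xi> - z) * \<xi>))"
      by (intro integrable_circle_continuous continuous_intros hs; use z1 s in auto)+
    then show ?thesis
      unfolding integral_mult_right_zero[symmetric] by (rule Bochner_Integration.integral_diff[symmetric])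
  qed
  finally have eq: "g' z = (\<integral>\<xi>. h \<xi> / (\<xi> - z)\<^sup>2 * \<xi> - 2 * (cnj z / s) * (h \<xi> / (\<xi> - z) * \<xi>) \<partial>circle_measure)" .
  have pt: "norm (h \<xi> / (\<xi> - z)\<^sup>2 * \<xi> - 2 * (cnj z / s) * (h \<xi> / (\<xi> - z) * \<xi>))
      \<le> 8 * e * ((1 - (norm z)\<^sup>2) / (norm (\<xi> - z))\<^sup>2) + 32 * B * s / d ^ 3" if xi: "norm \<xi> = 1" for \<xi>
  proof -
    define D where "D = norm (\<xi> - z)"
    \<comment> \<open>From this bound both \<open>s\<close> and
      \<open>norm (\<xi> - \<zeta>)\<close> are at most \<open>2 * D\<close>, so the kernel and the
      oscillation can be measured in powers of \<open>D\<close> alone.\<close>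
    have D1: "D \<ge> 1 - r" unfolding D_def using norm_triangle_ineq2[of \<xi> z] xi nz by simp
    then have D: "D > 0" using r by simp
    have "s = (1 - r) * (1 + r)" by (simp add: s_def power2_eq_square algebra_simps)
    also have "\<dots> \<le> (1 - r) * 2" using r by (intro mult_left_mono) auto
    finally have sD: "s \<le> 2 * D" using D1 by simp
    have dist: "norm (\<xi> - \<zeta>) \<le> 2 * D"
    proof -
      have "norm (\<xi> - \<zeta>) \<le> norm (\<xi> - z) + norm (z - \<zeta>)" using norm_triangle_ineq[of "\<xi> - z" "z - \<zeta>"] by simp
      also have "z - \<zeta> = of_real (r - 1) * \<zeta>" by (simp add: z_def algebra_simps)
      also have "norm (of_real (r - 1) * \<zeta>) = 1 - r" using \<zeta> r by (simp add: norm_mult del: of_real_diff)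
      finally show ?thesis using D1 by (simp add: D_def)
    qed
    have hn: "norm (h \<xi>) = norm (g \<xi>) * (s / D)\<^sup>2"
      unfolding h_def w_def using s
      by (simp add: norm_mult norm_power norm_divide norm_one_minus_cnj_mult[OF xi] D_def)
    have "norm (h \<xi> / (\<xi> - z)\<^sup>2 * \<xi> - 2 * (cnj z / s) * (h \<xi> / (\<xi> - z) * \<xi>))
        \<le> norm (h \<xi> / (\<xi> - z)\<^sup>2 * \<xi>) + norm (2 * (cnj z / s) * (h \<xi> / (\<xi> - z) * \<xi>))"
      by (rule norm_triangle_ineq4)
    also have "\<dots> = norm (h \<xi>) / D\<^sup>2 + 2 * (r / s) * (norm (h \<xi>) / D)"
      using xi s by (simp add: norm_mult norm_divide norm_power nz D_def)
    also have "\<dots> \<le> norm (h \<xi>) / D\<^sup>2 + 2 * (1 / s) * (norm (h \<xi>) / D)"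
      using r s D by (intro add_mono mult_right_mono mult_left_mono divide_right_mono order_refl) auto
    also have "\<dots> = norm (g \<xi>) * (s * s / D ^ 4 + 2 * s / D ^ 3)"
      unfolding hn using D s by (simp add: field_simps power2_eq_square power3_eq_cube power4_eq_xxxx)
    also have "\<dots> \<le> norm (g \<xi>) * (2 * D * s / D ^ 4 + 2 * s / D ^ 3)"
      using sD D s by (intro mult_left_mono add_mono divide_right_mono mult_right_mono order_refl) auto
    also have "\<dots> = norm (g \<xi>) * (4 * s / D ^ 3)"
      using D by (simp add: field_simps power3_eq_cube power4_eq_xxxx)
    also have "\<dots> \<le> 8 * e * (s / D\<^sup>2) + 32 * B * s / d ^ 3"
    \<comment> \<open>Near \<open>\<zeta>\<close> the oscillation bound supplies a factor
      \<open>2 * D\<close>, which lowers the cubic decay to a Poisson kernel of total mass 1. Far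
      from \<open>\<zeta>\<close> one has \<open>D \<ge> d / 2\<close>, and \<open>4 * 2 ^ 3\<close>
      is the constant 32.\<close>
    proof (cases "norm (\<xi> - \<zeta>) < d")
      case True
      have "norm (g \<xi>) \<le> e * (2 * D)"
        using osc[OF xi True] dist e by (meson mult_left_mono order_trans)
      then have "norm (g \<xi>) * (4 * s / D ^ 3) \<le> e * (2 * D) * (4 * s / D ^ 3)"
        using s D by (intro mult_right_mono) auto
      also have "\<dots> = 8 * e * (s / D\<^sup>2)" using D by (simp add: field_simps power2_eq_square power3_eq_cube)
      finally show ?thesis using B0 s d by (auto intro!: add_increasing2)
    next
      case False
      then have "d / 2 \<le> D" using dist by simp
      then have "(d / 2) ^ 3 \<le> D ^ 3" using d by (intro power_mono) auto
      then have "4 * s / D ^ 3 \<le> 4 * s / (d / 2) ^ 3" using d s D by (intro divide_left_mono) auto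
      also have "\<dots> = 32 * s / d ^ 3" by (simp add: power_divide)
      finally have "norm (g \<xi>) * (4 * s / D ^ 3) \<le> B * (32 * s / d ^ 3)"
        using B[OF xi] B0 s D by (intro mult_mono) auto
      also have "\<dots> = 32 * B * s / d ^ 3" by simp
      finally show ?thesis using e s by (auto intro!: add_increasing)
    qed
    finally show ?thesis by (simp add: D_def nz s_def)
  qed
  have "norm (g' z) \<le> (\<integral>\<xi>. norm (h \<xi> / (\<xi> - z)\<^sup>2 * \<xi> - 2 * (cnj z / s) * (h \<xi> / (\<xi> - z) * \<xi>)) \<partial>circle_measure)"
    unfolding eq by (rule integral_norm_bound)
  also have "\<dots> \<le> (\<integral>\<xi>. 8 * e * ((1 - (norm z)\<^sup>2) / (norm (\<xi> - z))\<^sup>2) + 32 * B * s / d ^ 3 \<partial>circle_measure)"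
  proof (rule integral_mono)
    have hs: "continuous_on (sphere 0 1) h" by (rule continuous_on_subset[OF hc]) auto
    show "integrable circle_measure (\<lambda>\<xi>. norm (h \<xi> / (\<xi> - z)\<^sup>2 * \<xi> - 2 * (cnj z / s) * (h \<xi> / (\<xi> - z) * \<xi>)))"
      by (intro integrable_circle_continuous continuous_intros hs; use z1 s in auto)
    show "integrable circle_measure (\<lambda>\<xi>. 8 * e * ((1 - (norm z)\<^sup>2) / (norm (\<xi> - z))\<^sup>2) + 32 * B * s / d ^ 3)"
      by (intro Bochner_Integration.integrable_add integrable_mult_right integrable_poisson_kernel z1) auto
    fix \<xi> assume "\<xi> \<in> space circle_measure"
    then show "norm (h \<xi> / (\<xi> - z)\<^sup>2 * \<xi> - 2 * (cnj z / s) * (h \<xi> / (\<xi> - z) * \<xi>))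
      \<le> 8 * e * ((1 - (norm z)\<^sup>2) / (norm (\<xi> - z))\<^sup>2) + 32 * B * s / d ^ 3"
      by (intro pt) simp
  qed
  also have "\<dots> = 8 * e * 1 + 32 * B * s / d ^ 3"
    by (subst Bochner_Integration.integral_add)
       (auto intro!: integrable_mult_right integrable_poisson_kernel z1 simp: integral_poisson_kernel[OF z1] circle.prob_space[simplified]
         simp del: times_divide_eq_right)
  finally show ?thesis by (simp add: z_def s_def)
qed

text \<open>Subtracting the affine tangent \<open>F \<zeta> + c * (u - \<zeta>)\<close> leaves a
  function with derivative \<open>\<phi> - c\<close> that is of smaller than first order on the
  circle near \<open>\<zeta>\<close>, which is what the weighted estimate consumes.\<close>

lemma radial_limit_of_derivative:
  fixes F \<phi> :: "complex \<Rightarrow> complex"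
  assumes Fc: "continuous_on (cball 0 1) F"
    and Fd: "\<And>z. z \<in> ball 0 1 \<Longrightarrow> (F has_field_derivative \<phi> z) (at z)"
    and \<zeta>: "norm \<zeta> = 1"
    and osc: "\<And>e. e > 0 \<Longrightarrow> \<exists>d>0. \<forall>\<xi>\<in>sphere 0 1. norm (\<xi> - \<zeta>) < d \<longrightarrow>
                norm (F \<xi> - F \<zeta> - c * (\<xi> - \<zeta>)) \<le> e * norm (\<xi> - \<zeta>)"
  shows "((\<lambda>r. \<phi> (complex_of_real r * \<zeta>)) \<longlongrightarrow> c) (at_left 1)"
proof (rule tendstoI)
  fix \<epsilon> :: real assume \<epsilon>: "\<epsilon> > 0"
  define g where "g u = F u - F \<zeta> - c * (u - \<zeta>)" for u
  have gc: "continuous_on (cball 0 1) g" unfolding g_def by (intro continuous_intros Fc)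
  have gd: "(g has_field_derivative \<phi> z - c) (at z)" if "z \<in> ball 0 1" for z
    unfolding g_def by (auto intro!: derivative_eq_intros Fd that)
  have "compact (g ` cball 0 1)" by (intro compact_continuous_image gc) auto
  then obtain B where B: "\<And>\<xi>. \<xi> \<in> cball 0 1 \<Longrightarrow> norm (g \<xi>) \<le> B"
    by (meson bounded_iff compact_imp_bounded imageI)
  \<comment> \<open>The term \<open>8 * e\<close> of the estimate becomes half of
    \<open>\<epsilon>\<close>; with \<open>d\<close> now fixed, the other term vanishes as
    \<open>r\<close> tends to 1.\<close>
  obtain d where d: "d > 0" and dosc: "\<And>\<xi>. norm \<xi> = 1 \<Longrightarrow> norm (\<xi> - \<zeta>) < d \<Longrightarrow> norm (g \<xi>) \<le> \<epsilon> / 16 * norm (\<xi> - \<zeta>)"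
    using osc[of "\<epsilon> / 16"] \<epsilon> by (auto simp: g_def)
  have "((\<lambda>r::real. 32 * B * (1 - r\<^sup>2) / d ^ 3) \<longlongrightarrow> 32 * B * (1 - 1\<^sup>2) / d ^ 3) (at_left 1)"
    using d by (intro tendsto_intros) auto
  then have "((\<lambda>r::real. 32 * B * (1 - r\<^sup>2) / d ^ 3) \<longlongrightarrow> 0) (at_left 1)" by simp
  then have "\<forall>\<^sub>F r in at_left 1. 32 * B * (1 - r\<^sup>2) / d ^ 3 < \<epsilon> / 2"
    using \<epsilon> by (intro order_tendstoD) auto
  moreover have "\<forall>\<^sub>F r in at_left 1. r \<in> {0<..<1::real}"
    by (rule eventually_at_left_real) auto
  ultimately show "\<forall>\<^sub>F r in at_left 1. dist (\<phi> (complex_of_real r * \<zeta>)) c < \<epsilon>"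
  proof eventually_elim
    case (elim r)
    have "norm (\<phi> (of_real r * \<zeta>) - c) \<le> 8 * (\<epsilon> / 16) + 32 * B * (1 - r\<^sup>2) / d ^ 3"
      by (rule weighted_Cauchy_estimate[OF gc gd \<zeta>]) (use elim d dosc B \<epsilon> in auto)
    then show ?case using elim by (simp add: dist_norm)
  qed
qed

text \<open>A point of the circle near \<open>cis t\<close> is \<open>cis s\<close> with
  \<open>s - t\<close> the imaginary part of a logarithm, hence \<open>\<bar>s - t\<bar>\<close> is
  at most twice the chord. A derivative in the angle thus becomes a first-order estimate in the
  chord.\<close>

lemma tangential_derivative_oscillation:
  fixes F :: "complex \<Rightarrow> complex"
  assumes der: "((\<lambda>t. F (cis t)) has_vector_derivative c * (\<i> * cis t)) (at t)" and e: "e > 0"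
  shows "\<exists>d>0. \<forall>\<xi>\<in>sphere 0 1. norm (\<xi> - cis t) < d \<longrightarrow>
           norm (F \<xi> - F (cis t) - c * (\<xi> - cis t)) \<le> e * norm (\<xi> - cis t)"
proof -
  define k where "k s = F (cis s) - F (cis t) - c * (cis s - cis t)" for s
  have dcis: "(cis has_vector_derivative \<i> * cis t) (at t)"
    using has_derivative_cis[of "\<lambda>x. x" "\<lambda>x. x" t UNIV]
    by (simp add: has_vector_derivative_def has_derivative_ident)
  have "(k has_vector_derivative c * (\<i> * cis t) - 0 - c * (\<i> * cis t - 0)) (at t)"
    unfolding k_def
    by (intro has_vector_derivative_diff der has_vector_derivative_const has_vector_derivative_mult_right dcis)
  then have "(k has_vector_derivative 0) (at t)" by simp
  then have "(k has_derivative (\<lambda>h. 0)) (at t)" by (simp add: has_vector_derivative_def)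
  then obtain d where d: "d > 0" "\<And>s. norm (s - t) < d \<Longrightarrow> norm (k s - k t - 0) \<le> e / 2 * norm (s - t)"
    using e unfolding has_derivative_at_alt by (metis half_gt_zero)
  show ?thesis
  \<comment> \<open>The bound \<open>1/2\<close> is the range in which \<open>Ln\<close> is at most
    twice its distance from 1; \<open>d/2\<close> absorbs that factor 2 so that
    \<open>\<bar>s - t\<bar> < d\<close>. The same factor explains \<open>e / 2\<close>
    above.\<close>
  proof (intro exI[of _ "min (1/2) (d/2)"] conjI ballI impI)
    show "0 < min (1/2) (d/2)" using d by simp
    fix \<xi> assume xi: "\<xi> \<in> sphere 0 1" and less: "norm (\<xi> - cis t) < min (1/2) (d/2)"
    define w where "w = \<xi> / cis t"
    have "w - 1 = (\<xi> - cis t) / cis t" by (simp add: w_def diff_divide_distrib)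
    then have nw: "norm (w - 1) = norm (\<xi> - cis t)" by (simp add: norm_divide)
    have "norm w = 1" using xi by (simp add: w_def norm_divide)
    then have "w \<noteq> 0" by auto
    have "norm (Ln (1 + (w - 1))) \<le> 2 * norm (w - 1)"
      using less nw by (intro norm_Ln_le) auto
    then have Ln: "norm (Ln w) \<le> 2 * norm (\<xi> - cis t)" by (simp add: nw)
    define s where "s = t + Im (Ln w)"
    have "Re (Ln w) = 0" using \<open>norm w = 1\<close> \<open>w \<noteq> 0\<close> by simp
    then have "Ln w = \<i> * complex_of_real (Im (Ln w))" by (simp add: complex_eq_iff)
    then have "w = cis (Im (Ln w))"
      using exp_Ln[OF \<open>w \<noteq> 0\<close>] by (simp add: cis_conv_exp)
    then have "\<xi> = cis s"
      unfolding s_def cis_mult[symmetric] by (simp add: w_def mult.commute field_simps)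
    have st: "norm (s - t) \<le> 2 * norm (\<xi> - cis t)"
      using Ln abs_Im_le_cmod[of "Ln w"] by (simp add: s_def)
    then have "norm (k s - k t - 0) \<le> e / 2 * norm (s - t)" using less by (intro d) auto
    also have "\<dots> \<le> e / 2 * (2 * norm (\<xi> - cis t))" using st e by (intro mult_left_mono) auto
    finally show "norm (F \<xi> - F (cis t) - c * (\<xi> - cis t)) \<le> e * norm (\<xi> - cis t)"
      by (simp add: k_def \<open>\<xi> = cis s\<close>)
  qed
qed


section \<open>Measurability of radial limits\<close>

definition has_radial_limit :: "(complex \<Rightarrow> complex) \<Rightarrow> complex \<Rightarrow> complex \<Rightarrow> bool" where
  "has_radial_limit \<phi> \<zeta> l \<longleftrightarrow> ((\<lambda>r. \<phi> (complex_of_real r * \<zeta>)) \<longlongrightarrow> l) (at_left 1)"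

lemma boundary_eqI: "has_radial_limit \<phi> \<zeta> l \<Longrightarrow> boundary \<phi> \<zeta> = l"
  unfolding has_radial_limit_def boundary_def by (rule tendsto_Lim) auto

lemma closed_in_sets_circle: "closed K \<Longrightarrow> K \<subseteq> sphere 0 1 \<Longrightarrow> K \<in> sets circle_measure"
  unfolding sets_circle sets_restrict_space by (auto intro!: image_eqI[of _ _ K])

lemma continuous_on_dilation:
  assumes \<phi>: "continuous_on (ball 0 1) \<phi>" and p: "\<bar>p\<bar> < 1"
  shows "continuous_on (sphere 0 1) (\<lambda>\<zeta>. \<phi> (complex_of_real p * \<zeta>))"
  by (rule continuous_on_compose2[OF \<phi>]) (use p in \<open>auto intro!: continuous_intros simp: norm_mult\<close>)

text \<open>A fixed sequence of radii makes radial limits accessible to sequential limit theorems.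
  The shift by 2 keeps every radius strictly between 0 and 1, including the one for
  \<open>n = 0\<close>.\<close>

lemma radial_sequence:
  shows "1 - 1 / (real n + 2) \<in> {0<..<1}"
    and "has_radial_limit \<phi> \<zeta> l \<Longrightarrow> (\<lambda>n. \<phi> (complex_of_real (1 - 1 / (real n + 2)) * \<zeta>)) \<longlonglongrightarrow> l"
proof -
  show in01: "1 - 1 / (real n + 2) \<in> {0<..<1}" for n by (simp add: field_simps)
  assume lim: "has_radial_limit \<phi> \<zeta> l"
  have "(\<lambda>n. 1 - 1 / (real n + 2)) \<longlonglongrightarrow> 1" by real_asymp
  then have "filterlim (\<lambda>n. 1 - 1 / (real n + 2)) (at_left 1) sequentially"
    unfolding filterlim_at using in01 by (auto intro!: always_eventually)
  then show "(\<lambda>n. \<phi> (complex_of_real (1 - 1 / (real n + 2)) * \<zeta>)) \<longlonglongrightarrow> l"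
    using lim unfolding has_radial_limit_def by (rule filterlim_compose[rotated])
qed

text \<open>In this form of Cauchy's criterion the outer quantifiers run over natural numbers and
  the innermost inequality is not strict, so that each condition defines a closed set.\<close>

lemma radial_limit_iff_Cauchy:
  "(\<exists>l. has_radial_limit \<phi> \<zeta> l) \<longleftrightarrow>
   (\<forall>j::nat. \<exists>N::nat. \<forall>p\<in>{1 - 1 / real (Suc N)<..<1}. \<forall>q\<in>{1 - 1 / real (Suc N)<..<1}.
      norm (\<phi> (complex_of_real p * \<zeta>) - \<phi> (complex_of_real q * \<zeta>)) \<le> 1 / real (Suc j))"
  (is "?L \<longleftrightarrow> ?R")
proof
  assume ?L
  then obtain l where l: "has_radial_limit \<phi> \<zeta> l" by blast
  show ?R
  proof
    fix j :: nat
    have "\<forall>\<^sub>F r in at_left 1. dist (\<phi> (complex_of_real r * \<zeta>)) l < 1 / real (Suc j) / 2"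
      using l unfolding has_radial_limit_def by (rule tendstoD) simp
    then obtain b where b: "b < 1" "\<And>r. b < r \<Longrightarrow> r < 1 \<Longrightarrow> dist (\<phi> (complex_of_real r * \<zeta>)) l < 1 / real (Suc j) / 2"
      unfolding eventually_at_left_field by blast
    obtain N where N: "inverse (real (Suc N)) < 1 - b" using reals_Archimedean[of "1 - b"] b(1) by auto
    show "\<exists>N::nat. \<forall>p\<in>{1 - 1 / real (Suc N)<..<1}. \<forall>q\<in>{1 - 1 / real (Suc N)<..<1}.
      norm (\<phi> (complex_of_real p * \<zeta>) - \<phi> (complex_of_real q * \<zeta>)) \<le> 1 / real (Suc j)"
    proof (intro exI[of _ N] ballI)
      fix p q assume pq: "p \<in> {1 - 1 / real (Suc N)<..<1}" "q \<in> {1 - 1 / real (Suc N)<..<1}"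
      have "dist (\<phi> (complex_of_real p * \<zeta>)) l < 1 / real (Suc j) / 2" "dist (\<phi> (complex_of_real q * \<zeta>)) l < 1 / real (Suc j) / 2"
      proof -
        have "b < p" "p < 1" "b < q" "q < 1" using pq N by (auto simp: inverse_eq_divide simp del: of_nat_Suc)
        then show "dist (\<phi> (complex_of_real p * \<zeta>)) l < 1 / real (Suc j) / 2"
          "dist (\<phi> (complex_of_real q * \<zeta>)) l < 1 / real (Suc j) / 2" using b(2) by blast+
      qed
      then have "dist (\<phi> (complex_of_real p * \<zeta>)) (\<phi> (complex_of_real q * \<zeta>)) < 1 / real (Suc j)"
        by (rule dist_triangle_half_l)
      then show "norm (\<phi> (complex_of_real p * \<zeta>) - \<phi> (complex_of_real q * \<zeta>)) \<le> 1 / real (Suc j)"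
        by (simp add: dist_norm)
    qed
  qed
next
  assume R: ?R
  define X where "X n = \<phi> (complex_of_real (1 - 1 / (real n + 2)) * \<zeta>)" for n
  have X_in: "1 - 1 / (real n + 2) \<in> {1 - 1 / real (Suc N)<..<1}" if "n \<ge> N" for n N
    using that by (auto simp: field_simps)
  have "Cauchy X"
  proof (rule metric_CauchyI)
    fix e :: real assume "e > 0"
    then obtain j where j: "inverse (real (Suc j)) < e" using reals_Archimedean by blast
    obtain N where N: "\<forall>p\<in>{1 - 1 / real (Suc N)<..<1}. \<forall>q\<in>{1 - 1 / real (Suc N)<..<1}.
      norm (\<phi> (complex_of_real p * \<zeta>) - \<phi> (complex_of_real q * \<zeta>)) \<le> 1 / real (Suc j)" using R by blast
    have "dist (X m) (X n) < e" if "m \<ge> N" "n \<ge> N" for m n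
      using bspec[OF bspec[OF N X_in[OF that(1)]] X_in[OF that(2)]] j
      by (simp add: X_def dist_norm inverse_eq_divide)
    then show "\<exists>M. \<forall>m\<ge>M. \<forall>n\<ge>M. dist (X m) (X n) < e" by blast
  qed
  then obtain l where l: "X \<longlonglongrightarrow> l" using Cauchy_convergent_iff convergent_def by blast
  have "has_radial_limit \<phi> \<zeta> l"
    unfolding has_radial_limit_def
  proof (rule tendstoI)
    fix e :: real assume "e > 0"
    then obtain j where j: "inverse (real (Suc j)) < e" using reals_Archimedean by blast
    obtain N where N: "\<forall>p\<in>{1 - 1 / real (Suc N)<..<1}. \<forall>q\<in>{1 - 1 / real (Suc N)<..<1}.
      norm (\<phi> (complex_of_real p * \<zeta>) - \<phi> (complex_of_real q * \<zeta>)) \<le> 1 / real (Suc j)" using R by blast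
    have "dist (\<phi> (complex_of_real p * \<zeta>)) l < e" if p: "p \<in> {1 - 1 / real (Suc N)<..<1}" for p
    proof -
      have "norm (\<phi> (complex_of_real p * \<zeta>) - l) \<le> 1 / real (Suc j)"
      proof (rule LIMSEQ_le_const2)
        show "(\<lambda>n. norm (\<phi> (complex_of_real p * \<zeta>) - X n)) \<longlonglongrightarrow> norm (\<phi> (complex_of_real p * \<zeta>) - l)"
          by (intro tendsto_intros l)
        show "\<exists>M. \<forall>n\<ge>M. norm (\<phi> (complex_of_real p * \<zeta>) - X n) \<le> 1 / real (Suc j)"
          using bspec[OF N p] X_in unfolding X_def by blast
      qed
      then show ?thesis using j by (simp add: dist_norm inverse_eq_divide)
    qed
    moreover have "\<forall>\<^sub>F r in at_left 1. r \<in> {1 - 1 / real (Suc N)<..<1}"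
      by (rule eventually_at_left_real) simp
    ultimately show "\<forall>\<^sub>F r in at_left 1. dist (\<phi> (complex_of_real r * \<zeta>)) l < e"
      by (rule eventually_mono[rotated])
  qed
  then show ?L by blast
qed

text \<open>The uncountable intersection over the radii \<open>p\<close> and \<open>q\<close> is
  harmless because it consists of closed sets; only the countable operations over \<open>N\<close>
  and \<open>j\<close> remain.\<close>

lemma sets_radial_limit:
  assumes \<phi>: "continuous_on (ball 0 1) \<phi>"
  shows "{\<zeta>\<in>sphere 0 1. \<exists>l. has_radial_limit \<phi> \<zeta> l} \<in> sets circle_measure"
proof -
  define K where "K j N = (\<Inter>p\<in>{1 - 1 / real (Suc N)<..<1}. \<Inter>q\<in>{1 - 1 / real (Suc N)<..<1}.
      sphere 0 1 \<inter> (\<lambda>\<zeta>. norm (\<phi> (complex_of_real p * \<zeta>) - \<phi> (complex_of_real q * \<zeta>))) -` {.. 1 / real (Suc j)})"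
    for j N :: nat
  have sub: "{1 - 1 / real (Suc N)<..<1} \<subseteq> {0<..<1}" for N
  proof -
    have *: "1 / real (Suc N) \<le> 1" by simp
    show ?thesis by (intro subsetI, unfold greaterThanLessThan_iff) (use * in linarith)
  qed
  have "closed (K j N)" for j N
    unfolding K_def
  proof (intro closed_INT ballI continuous_closed_preimage)
    fix p q assume "p \<in> {1 - 1 / real (Suc N)<..<1}" "q \<in> {1 - 1 / real (Suc N)<..<1}"
    then have "\<bar>p\<bar> < 1" "\<bar>q\<bar> < 1" using sub[of N] by auto
    then show "continuous_on (sphere 0 1) (\<lambda>\<zeta>. norm (\<phi> (complex_of_real p * \<zeta>) - \<phi> (complex_of_real q * \<zeta>)))"
      by (intro continuous_intros continuous_on_dilation \<phi>)
  qed auto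
  moreover have Ks: "K j N \<subseteq> sphere 0 1" for j N
  proof -
    \<comment> \<open>An intersection over an empty index set would be the whole plane, so the
      inclusion in the circle depends on this.\<close>
    have "{1 - 1 / real (Suc N)<..<1} \<noteq> {}" by simp
    then show ?thesis unfolding K_def by blast
  qed
  ultimately have "K j N \<in> sets circle_measure" for j N by (intro closed_in_sets_circle)
  then have "(\<Union>N. K j N) \<in> sets circle_measure" for j by (intro sets.countable_UN) auto
  then have "(\<Inter>j. \<Union>N. K j N) \<in> sets circle_measure" by (intro sets.countable_INT) auto
  also have "(\<Inter>j. \<Union>N. K j N) = {\<zeta>\<in>sphere 0 1. \<exists>l. has_radial_limit \<phi> \<zeta> l}"
    using Ks unfolding radial_limit_iff_Cauchy
    by (auto simp: K_def simp del: mem_sphere of_nat_Suc greaterThanLessThan_iff)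
  finally show ?thesis .
qed

lemma measurable_boundary:
  assumes \<phi>: "continuous_on (ball 0 1) \<phi>"
  shows "boundary \<phi> \<in> borel_measurable circle_measure"
proof -
  let ?L = "{\<zeta>\<in>sphere 0 1. \<exists>l. has_radial_limit \<phi> \<zeta> l}"
  let ?X = "\<lambda>n \<zeta>. \<phi> (complex_of_real (1 - 1 / (real n + 2)) * \<zeta>)"
  have [measurable]: "?X n \<in> borel_measurable circle_measure" for n
    using radial_sequence(1)[of n] by (intro measurable_circle_continuous continuous_on_dilation \<phi>) auto
  have lim: "(\<lambda>\<zeta>. lim (\<lambda>n. ?X n \<zeta>)) \<in> borel_measurable circle_measure"
    by (rule borel_measurable_lim_metric) fact
  \<comment> \<open>Where no radial limit exists, \<open>Lim\<close> unfolds to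
    \<open>THE l. False\<close>, the same value at all such points; elsewhere it is the limit along
    the fixed radii.\<close>
  have "(\<lambda>\<zeta>. if \<zeta> \<in> ?L then lim (\<lambda>n. ?X n \<zeta>) else (THE l. False)) \<in> borel_measurable circle_measure"
  proof (rule measurable_If_set[OF lim])
    have "?L \<inter> space circle_measure = ?L" by auto
    then show "?L \<inter> space circle_measure \<in> sets circle_measure"
      using sets_radial_limit[OF \<phi>] by (simp only:)
  qed simp
  also have "?this \<longleftrightarrow> ?thesis"
  proof (rule measurable_cong)
    fix \<zeta> assume "\<zeta> \<in> space circle_measure"
    then have z: "\<zeta> \<in> sphere 0 1" by simp
    show "(if \<zeta> \<in> ?L then lim (\<lambda>n. ?X n \<zeta>) else (THE l. False)) = boundary \<phi> \<zeta>"
    proof (cases "\<exists>l. has_radial_limit \<phi> \<zeta> l")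
      case True
      then obtain l where l: "has_radial_limit \<phi> \<zeta> l" by blast
      then show ?thesis using z limI[OF radial_sequence(2)[OF l]] boundary_eqI[OF l] by auto
    next
      case False
      then have "boundary \<phi> \<zeta> = (THE l. False)"
        unfolding boundary_def t2_space_class.Lim_def has_radial_limit_def by (simp only: simp_thms not_ex)
      moreover have "\<zeta> \<notin> ?L" using False by blast
      ultimately show ?thesis by (simp only: if_False)
    qed
  qed
  finally show ?thesis .
qed


section \<open>Power series, Taylor coefficients and Fatou's theorem\<close>

lemma
  assumes b: "summable (\<lambda>n. norm (b n))"
    and g: "\<And>\<zeta>. norm \<zeta> = 1 \<Longrightarrow> (\<lambda>n. b n * \<zeta> ^ n) sums g \<zeta>"
  shows L2_power_series: "g \<in> L2"
    and fourier_coeff_power_series: "fourier_coeff g k = (if 0 \<le> k then b (nat k) else 0)"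
proof -
  let ?B = "\<Sum>n. norm (b n)"
  have lim: "(\<lambda>N. taylor_sum b N \<zeta>) \<longlonglongrightarrow> g \<zeta>" if "norm \<zeta> = 1" for \<zeta>
    using g[OF that] by (simp add: sums_def taylor_sum_def)
  have bound: "norm (taylor_sum b N \<zeta>) \<le> ?B" if "norm \<zeta> = 1" for N \<zeta>
  proof -
    have "norm (taylor_sum b N \<zeta>) \<le> (\<Sum>n<N. norm (b n))"
      unfolding taylor_sum_def by (rule sum_norm_le) (simp add: norm_mult norm_power that)
    also have "\<dots> \<le> ?B" by (rule sum_le_suminf[OF b]) auto
    finally show ?thesis .
  qed
  have [measurable]: "taylor_sum b N \<in> borel_measurable circle_measure" for N
    by (rule L2_measurable[OF L2_taylor_sum])
  have [measurable]: "g \<in> borel_measurable circle_measure"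
    by (rule borel_measurable_LIMSEQ_metric[of "taylor_sum b"]) (auto intro: lim)
  have "norm (g \<zeta>) \<le> ?B" if "norm \<zeta> = 1" for \<zeta>
    by (rule LIMSEQ_le_const2[OF tendsto_norm[OF lim[OF that]]]) (auto intro: bound that)
  then show g2: "g \<in> L2" by (intro L2_bounded[of _ ?B]) auto
  have [measurable]: "(\<lambda>\<zeta>. \<zeta> powi k) \<in> borel_measurable circle_measure"
    by (rule L2_measurable[OF L2_powi])
  have "(\<lambda>N. fourier_coeff (taylor_sum b N) k) \<longlonglongrightarrow> fourier_coeff g k"
    unfolding fourier_coeff_def l2_inner_def
  proof (rule integral_dominated_convergence[where w = "\<lambda>_. ?B"])
    show "AE \<zeta> in circle_measure. (\<lambda>N. taylor_sum b N \<zeta> * cnj (\<zeta> powi k)) \<longlonglongrightarrow> g \<zeta> * cnj (\<zeta> powi k)"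
      by (intro AE_I2 tendsto_intros lim) simp
    show "AE \<zeta> in circle_measure. norm (taylor_sum b N \<zeta> * cnj (\<zeta> powi k)) \<le> ?B" for N
      by (intro AE_I2) (simp add: norm_mult norm_power_int bound)
    show "(\<lambda>\<zeta>. g \<zeta> * cnj (\<zeta> powi k)) \<in> borel_measurable circle_measure" by measurable
    show "(\<lambda>\<zeta>. taylor_sum b N \<zeta> * cnj (\<zeta> powi k)) \<in> borel_measurable circle_measure" for N by measurable
  qed simp
  moreover have "(\<lambda>N. fourier_coeff (taylor_sum b N) k) \<longlonglongrightarrow> (if 0 \<le> k then b (nat k) else 0)"
    by (rule tendsto_eventually, rule eventually_sequentiallyI[of "Suc (nat k)"])
       (simp add: fourier_coeff_taylor_sum)
  ultimately show "fourier_coeff g k = (if 0 \<le> k then b (nat k) else 0)"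
    by (rule LIMSEQ_unique)
qed

definition taylor_coeff :: "(complex \<Rightarrow> complex) \<Rightarrow> nat \<Rightarrow> complex" where
  "taylor_coeff \<phi> n = (deriv ^^ n) \<phi> 0 / fact n"

lemma taylor_sums:
  assumes "\<phi> holomorphic_on ball 0 1" "norm z < 1"
  shows "(\<lambda>n. taylor_coeff \<phi> n * z ^ n) sums \<phi> z"
  using holomorphic_power_series[OF assms(1), of z] assms(2) by (simp add: taylor_coeff_def)

lemma summable_norm_taylor:
  assumes \<phi>: "\<phi> holomorphic_on ball 0 1" and z: "norm z < 1"
  shows "summable (\<lambda>n. norm (taylor_coeff \<phi> n * z ^ n))"
proof -
  define x where "x = complex_of_real ((1 + norm z) / 2)"
  have nx: "norm x = (1 + norm z) / 2" unfolding x_def norm_of_real by simp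
  show ?thesis
  proof (rule powser_insidea)
    show "summable (\<lambda>n. taylor_coeff \<phi> n * x ^ n)"
      using taylor_sums[OF \<phi>, of x] z nx by (simp add: sums_iff)
    show "norm z < norm x" using z nx by simp
  qed
qed

lemma
  assumes \<phi>: "\<phi> holomorphic_on ball 0 1" and r: "\<bar>r\<bar> < 1"
  shows L2_dilation: "(\<lambda>\<zeta>. \<phi> (complex_of_real r * \<zeta>)) \<in> L2"
    and fourier_coeff_dilation: "fourier_coeff (\<lambda>\<zeta>. \<phi> (complex_of_real r * \<zeta>)) k =
      (if 0 \<le> k then taylor_coeff \<phi> (nat k) * of_real r ^ nat k else 0)"
proof -
  have sm: "summable (\<lambda>n. norm (taylor_coeff \<phi> n * of_real r ^ n))"
    using r by (intro summable_norm_taylor \<phi>) simp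
  have "(\<lambda>n. taylor_coeff \<phi> n * of_real r ^ n * \<zeta> ^ n) sums \<phi> (complex_of_real r * \<zeta>)" if "norm \<zeta> = 1" for \<zeta>
    using taylor_sums[OF \<phi>, of "of_real r * \<zeta>"] r that by (simp add: norm_mult power_mult_distrib mult.assoc)
  from L2_power_series[OF sm this] fourier_coeff_power_series[OF sm this, of k]
  show "(\<lambda>\<zeta>. \<phi> (complex_of_real r * \<zeta>)) \<in> L2"
    "fourier_coeff (\<lambda>\<zeta>. \<phi> (complex_of_real r * \<zeta>)) k =
      (if 0 \<le> k then taylor_coeff \<phi> (nat k) * of_real r ^ nat k else 0)" by auto
qed

lemma Hinf_holomorphic: "\<phi> \<in> Hinf \<Longrightarrow> \<phi> holomorphic_on ball 0 1"
  by (simp add: Hinf_def)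

lemma HinfI: "\<phi> holomorphic_on ball 0 1 \<Longrightarrow> (\<And>z. norm z < 1 \<Longrightarrow> norm (\<phi> z) \<le> C) \<Longrightarrow> \<phi> \<in> Hinf"
  unfolding Hinf_def bounded_iff by (auto intro!: exI[of _ C])

lemma Hinf_bound:
  assumes "\<phi> \<in> Hinf"
  obtains C where "C > 0" "\<And>z. norm z < 1 \<Longrightarrow> norm (\<phi> z) \<le> C"
  using assms unfolding Hinf_def bounded_pos by auto

lemma Hinf_continuous: "\<phi> \<in> Hinf \<Longrightarrow> continuous_on (ball 0 1) \<phi>"
  by (simp add: Hinf_def holomorphic_on_imp_continuous_on)

text \<open>Bessel's inequality on the circle of radius \<open>r\<close> bounds the sum with weights
  \<open>r ^ (2 * n)\<close> by \<open>C\<^sup>2\<close>; for a fixed number of terms the radius may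
  tend to 1.\<close>

lemma taylor_sum_sq_bound:
  assumes \<phi>: "\<phi> holomorphic_on ball 0 1" and C: "\<And>z. norm z < 1 \<Longrightarrow> norm (\<phi> z) \<le> C"
  shows "(\<Sum>n<N. (norm (taylor_coeff \<phi> n))\<^sup>2) \<le> C\<^sup>2"
proof (rule LIMSEQ_le_const2)
  let ?r = "\<lambda>k. 1 - 1 / (real k + 2)"
  have r: "?r k \<in> {0<..<1}" for k by (rule radial_sequence(1))
  have lim: "?r \<longlonglongrightarrow> 1" by real_asymp
  have "(\<lambda>k. \<Sum>n<N. (norm (taylor_coeff \<phi> n))\<^sup>2 * (?r k ^ n)\<^sup>2) \<longlonglongrightarrow>
      (\<Sum>n<N. (norm (taylor_coeff \<phi> n))\<^sup>2 * (1 ^ n)\<^sup>2)"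
    by (intro tendsto_intros lim)
  then show "(\<lambda>k. \<Sum>n<N. (norm (taylor_coeff \<phi> n))\<^sup>2 * (?r k ^ n)\<^sup>2) \<longlonglongrightarrow> (\<Sum>n<N. (norm (taylor_coeff \<phi> n))\<^sup>2)"
    by simp
  have "(\<Sum>n<N. (norm (taylor_coeff \<phi> n))\<^sup>2 * (?r k ^ n)\<^sup>2) \<le> C\<^sup>2" for k
  proof -
    let ?g = "\<lambda>\<zeta>. \<phi> (complex_of_real (?r k) * \<zeta>)"
    have rk: "\<bar>?r k\<bar> < 1" using r[of k] by auto
    have "(\<Sum>n<N. (norm (taylor_coeff \<phi> n))\<^sup>2 * (?r k ^ n)\<^sup>2) = (\<Sum>n<N. (norm (fourier_coeff ?g (int n)))\<^sup>2)"
    proof (rule sum.cong[OF refl])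
      fix n
      have "norm (fourier_coeff ?g (int n)) = norm (taylor_coeff \<phi> n) * \<bar>?r k\<bar> ^ n"
        unfolding fourier_coeff_dilation[OF \<phi> rk] by (simp only: of_nat_0_le_iff if_True nat_int norm_mult norm_power norm_of_real)
      then show "(norm (taylor_coeff \<phi> n))\<^sup>2 * (?r k ^ n)\<^sup>2 = (norm (fourier_coeff ?g (int n)))\<^sup>2"
        using r[of k] by (simp only: power_mult_distrib abs_of_pos greaterThanLessThan_iff)
    qed
    also have "\<dots> \<le> l2_sq ?g" by (rule bessel[OF L2_dilation[OF \<phi> rk]])
    also have "\<dots> \<le> (\<integral>\<zeta>. C\<^sup>2 \<partial>circle_measure)"
      unfolding l2_sq_def
    proof (rule integral_mono)
      fix \<zeta> assume "\<zeta> \<in> space circle_measure"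
      then show "(norm (?g \<zeta>))\<^sup>2 \<le> C\<^sup>2" using rk by (intro power_mono C) (auto simp: norm_mult simp del: of_real_diff)
    qed (use L2_integrable_sq[OF L2_dilation[OF \<phi> rk]] in auto)
    also have "\<dots> = C\<^sup>2" using circle.prob_space by simp
    finally show ?thesis .
  qed
  then show "\<exists>K. \<forall>k\<ge>K. (\<Sum>n<N. (norm (taylor_coeff \<phi> n))\<^sup>2 * (?r k ^ n)\<^sup>2) \<le> C\<^sup>2" by blast
qed

lemma summable_taylor_sq:
  assumes "\<phi> \<in> Hinf" shows "summable (\<lambda>n. (norm (taylor_coeff \<phi> n))\<^sup>2)"
proof -
  obtain C where "\<And>z. norm z < 1 \<Longrightarrow> norm (\<phi> z) \<le> C" using Hinf_bound[OF assms] by blast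
  then show ?thesis
    by (intro summableI_nonneg_bounded[of _ "C\<^sup>2"] taylor_sum_sq_bound Hinf_holomorphic assms) auto
qed

lemma power_series_sums_cball:
  fixes c :: "nat \<Rightarrow> complex"
  assumes c: "summable (\<lambda>n. norm (c n))" and z: "norm z \<le> 1"
  shows "(\<lambda>n. c n * z ^ n) sums (\<Sum>n. c n * z ^ n)"
proof (rule summable_sums, rule summable_comparison_test'[OF c])
  show "norm (c n * z ^ n) \<le> norm (c n)" for n
    using z by (simp add: norm_mult norm_power mult_left_le power_le_one)
qed

lemma power_series_continuous_cball:
  fixes c :: "nat \<Rightarrow> complex"
  assumes c: "summable (\<lambda>n. norm (c n))"
  shows "continuous_on (cball 0 1) (\<lambda>z. \<Sum>n. c n * z ^ n)"
proof (rule uniform_limit_theorem)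
  show "uniform_limit (cball 0 1) (\<lambda>N z. \<Sum>n<N. c n * z ^ n) (\<lambda>z. \<Sum>n. c n * z ^ n) sequentially"
    by (rule Weierstrass_m_test[OF _ c]) (auto simp: norm_mult norm_power mult_left_le power_le_one)
  show "\<forall>\<^sub>F N in sequentially. continuous_on (cball 0 1) (\<lambda>z. \<Sum>n<N. c n * z ^ n)"
    by (intro always_eventually allI continuous_intros)
qed simp

text \<open>
  Fatou's theorem. The primitive \<open>F\<close> of \<open>\<phi>\<close> extends continuously to the closed disk, and along the
  circle it is the indefinite integral of the \<open>H\<^sup>2\<close> function \<open>f\<close> with the Taylor coefficients of \<open>\<phi>\<close>.
\<close>

theorem fatou_radial_limits:
  assumes \<phi>: "\<phi> \<in> Hinf"
  obtains f where "f \<in> H2" "\<And>n. fourier_coeff f (int n) = taylor_coeff \<phi> n"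
    "AE \<zeta> in circle_measure. has_radial_limit \<phi> \<zeta> (f \<zeta>)"
proof -
  note hol = Hinf_holomorphic[OF \<phi>]
  let ?a = "taylor_coeff \<phi>"
  obtain f where f: "f \<in> H2" "\<And>n. fourier_coeff f (int n) = ?a n"
    and flim: "(\<lambda>N. l2_sq (\<lambda>\<zeta>. taylor_sum ?a N \<zeta> - f \<zeta>)) \<longlonglongrightarrow> 0"
    using riesz_fischer[OF summable_taylor_sq[OF \<phi>]] by blast
  note fL2 = H2_L2[OF f(1)]
  note [measurable] = L2_measurable[OF fL2]
  \<comment> \<open>Coefficients of the primitive of \<open>\<phi>\<close> that vanishes at
    0.\<close>
  define c where "c n = (if n = 0 then 0 else ?a (n - 1) / of_nat n)" for n
  have c_Suc: "c (Suc n) = ?a n / of_nat (Suc n)" for n by (simp add: c_def)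
  \<comment> \<open>Square summability of the Taylor coefficients and of \<open>1 / (n + 1)\<close>
    gives absolute summability of their products. This is what extends the primitive continuously to
    the closed disk.\<close>
  have sq: "summable (\<lambda>n. (norm (?a n))\<^sup>2 + (1 / real (Suc n))\<^sup>2)"
  proof (intro summable_add summable_taylor_sq \<phi>)
    show "summable (\<lambda>n. (1 / real (Suc n))\<^sup>2)"
      using inverse_squares_sums by (simp add: sums_iff power_divide add.commute)
  qed
  have sc: "summable (\<lambda>n. norm (c n))"
  proof (subst summable_Suc_iff[symmetric], rule summable_comparison_test'[OF sq])
    fix n :: nat
    have "2 * (norm (?a n)) * (1 / real (Suc n)) \<le> (norm (?a n))\<^sup>2 + (1 / real (Suc n))\<^sup>2"
      by (rule sum_squares_bound)
    moreover have "0 \<le> norm (?a n) * (1 / real (Suc n))" by simp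
    moreover have "norm (norm (c (Suc n))) = norm (?a n) * (1 / real (Suc n))"
      unfolding c_Suc by (simp only: norm_divide norm_of_nat real_norm_def abs_norm_cancel) simp
    ultimately show "norm (norm (c (Suc n))) \<le> (norm (?a n))\<^sup>2 + (1 / real (Suc n))\<^sup>2" by linarith
  qed
  define F where "F z = (\<Sum>n. c n * z ^ n)" for z
  note Fsums = power_series_sums_cball[OF sc, folded F_def]
  note Fc = power_series_continuous_cball[OF sc, folded F_def]
  have Fd: "(F has_field_derivative \<phi> z) (at z)" if "z \<in> ball 0 1" for z
  proof -
    have "DERIV (\<lambda>z. \<Sum>n. c n * z ^ n) z :> (\<Sum>n. diffs c n * z ^ n)"
      by (rule termdiffs_strong[where K = 1]) (use that sc summable_norm_cancel in auto)
    moreover have "diffs c n = ?a n" for n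
      unfolding diffs_def c_Suc by (simp del: of_nat_Suc)
    ultimately show ?thesis
      using taylor_sums[OF hol, of z] that by (simp add: F_def[abs_def] sums_iff)
  qed
  \<comment> \<open>The chain rule's guess for the derivative of \<open>F (cis t)\<close>, with
    \<open>f\<close> in the place of the boundary values of \<open>\<phi>\<close> that are still to
    be found.\<close>
  let ?g = "\<lambda>t. f (cis t) * (\<i> * cis t)"
  have fz: "integrable circle_measure (\<lambda>\<zeta>. f \<zeta> * (\<i> * \<zeta>))"
    by (intro integrable_mult_continuous L2_integrable fL2 continuous_intros)
  then have gi: "set_integrable lborel {0..2*pi} ?g"
    by (subst (asm) integrable_circle_iff) auto
  have gHK: "?g integrable_on {0..2*pi}" by (rule set_borel_integral_eq_integral(1)[OF gi])
  have Fint: "F (cis t) - F 1 = integral {0..t} ?g" if t: "t \<in> {0..2*pi}" for t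
  proof -
    define p where "p N z = taylor_sum ?a N z" for N z
    define q where "q N t = p N (cis t) * (\<i> * cis t)" for N t
    have pc: "continuous_on UNIV (p N)" for N
      unfolding p_def taylor_sum_def by (intro continuous_intros)
    \<comment> \<open>Differentiation lowers the degree, so \<open>N\<close> terms of
      \<open>\<phi>\<close> correspond to \<open>Suc N\<close> terms of the primitive.\<close>
    have Nint: "integral {0..t} (q N) = (\<Sum>n<Suc N. c n * cis t ^ n) - (\<Sum>n<Suc N. c n * 1 ^ n)" for N
    proof -
      have "(q N has_integral (\<Sum>n<Suc N. c n * cis t ^ n) - (\<Sum>n<Suc N. c n * cis 0 ^ n)) {0..t}"
      proof (rule fundamental_theorem_of_calculus)
        fix x assume "x \<in> {0..t}"
        have d: "((\<lambda>z. \<Sum>n<Suc N. c n * z ^ n) has_field_derivative p N z) (at z)" for z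
        proof -
          have "((\<lambda>z. \<Sum>n<Suc N. c n * z ^ n) has_field_derivative (\<Sum>n<Suc N. c n * (of_nat n * z ^ (n - 1)))) (at z)"
            by (auto intro!: derivative_eq_intros simp: mult_ac)
          also have "(\<Sum>n<Suc N. c n * (of_nat n * z ^ (n - 1))) = (\<Sum>n<N. c (Suc n) * (of_nat (Suc n) * z ^ n))"
            by (subst sum.lessThan_Suc_shift) simp
          also have "\<dots> = p N z"
            unfolding p_def taylor_sum_def c_Suc by (intro sum.cong refl) (simp del: of_nat_Suc)
          finally show ?thesis .
        qed
        have dcis: "(cis has_vector_derivative \<i> * cis x) (at x within {0..t})"
          using has_derivative_cis[of "\<lambda>x. x" "\<lambda>x. x" x "{0..t}"]
          by (simp add: has_vector_derivative_def)
        show "((\<lambda>t. \<Sum>n<Suc N. c n * cis t ^ n) has_vector_derivative q N x) (at x within {0..t})"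
          using field_vector_diff_chain_within[OF dcis has_field_derivative_at_within[OF d]]
          by (simp only: o_def q_def mult.commute)
      qed (use t in auto)
      then show ?thesis by (simp add: integral_unique)
    qed
    have "(\<lambda>N. integral {0..t} (q N)) \<longlonglongrightarrow> F (cis t) - F 1"
    proof -
      have lim: "(\<lambda>N. \<Sum>n<Suc N. c n * z ^ n) \<longlonglongrightarrow> F z" if "norm z \<le> 1" for z
        using Fsums[OF that] unfolding sums_def by (rule LIMSEQ_Suc)
      have "norm (cis t) \<le> 1" "norm (1::complex) \<le> 1" by auto
      then show ?thesis unfolding Nint by (intro tendsto_diff lim)
    qed
    moreover have "(\<lambda>N. integral {0..t} (q N)) \<longlonglongrightarrow> integral {0..t} ?g"
    proof -
      \<comment> \<open>The L^1 distance of the Taylor sums to \<open>f\<close>, dominated by the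
        L^2 distance; \<open>2 * pi\<close> below undoes the normalization of the measure. Mean
        convergence suffices since only integrals over \<open>{0..t}\<close> are compared.\<close>
      define E where "E N = (\<integral>\<zeta>. norm ((p N \<zeta> - f \<zeta>) * 1) \<partial>circle_measure)" for N
      have one: "(\<lambda>_. 1) \<in> L2" by (intro L2_continuous continuous_intros)
      have E0: "E \<longlonglongrightarrow> 0"
        unfolding E_def p_def
        by (rule AM_GM_tendsto[OF _ flim, of _ "l2_sq (\<lambda>_. 1)"])
           (intro conjI integral_norm_mult_bound L2_diff L2_taylor_sum fL2 one Bochner_Integration.integral_nonneg norm_ge_zero l2_sq_nonneg, simp_all)
      have le: "norm (integral {0..t} (q N) - integral {0..t} ?g) \<le> 2 * pi * E N" for N
      proof -
        have m [measurable]: "p N \<in> borel_measurable circle_measure"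
          unfolding p_def by (rule L2_measurable[OF L2_taylor_sum])
        have dint: "integrable circle_measure (\<lambda>\<zeta>. complex_of_real (norm (p N \<zeta> - f \<zeta>)))"
          unfolding p_def by (intro integrable_of_real integrable_norm L2_integrable L2_diff L2_taylor_sum fL2)
        then have nint: "set_integrable lborel {0..2*pi} (\<lambda>s. complex_of_real (norm (p N (cis s) - f (cis s))))"
          by (subst (asm) integrable_circle_iff) auto
        then have nr: "set_integrable lborel {0..2*pi} (\<lambda>s. norm (p N (cis s) - f (cis s)))"
          unfolding set_integrable_def using integrable_Re by (force simp: scaleR_conv_of_real)
        have nHK: "(\<lambda>s. norm (p N (cis s) - f (cis s))) integrable_on {0..2*pi}"
          by (rule set_borel_integral_eq_integral(1)[OF nr])
        have qHK: "q N integrable_on {0..t}"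
          unfolding q_def
          by (intro integrable_continuous_interval continuous_intros continuous_on_compose2[OF pc]) auto
        have gHKt: "?g integrable_on {0..t}" by (rule integrable_on_subinterval[OF gHK]) (use t in auto)
        have nHKt: "(\<lambda>s. norm (p N (cis s) - f (cis s))) integrable_on {0..t}"
          by (rule integrable_on_subinterval[OF nHK]) (use t in auto)
        have "integral {0..t} (q N) - integral {0..t} ?g = integral {0..t} (\<lambda>s. q N s - ?g s)"
          by (rule Henstock_Kurzweil_Integration.integral_diff[OF qHK gHKt, symmetric])
        also have "norm \<dots> \<le> integral {0..t} (\<lambda>s. norm (p N (cis s) - f (cis s)))"
        proof (rule integral_norm_bound_integral)
          show "(\<lambda>s. q N s - ?g s) integrable_on {0..t}" by (rule integrable_diff[OF qHK gHKt])
          fix s assume "s \<in> {0..t}"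
          have "q N s - ?g s = (p N (cis s) - f (cis s)) * (\<i> * cis s)" by (simp add: q_def algebra_simps)
          then show "norm (q N s - ?g s) \<le> norm (p N (cis s) - f (cis s))" by (simp add: norm_mult)
        qed (rule nHKt)
        also have "\<dots> \<le> integral {0..2*pi} (\<lambda>s. norm (p N (cis s) - f (cis s)))"
          by (rule integral_subset_le[OF _ nHKt nHK]) (use t in auto)
        also have "\<dots> = (LINT s:{0..2*pi}|lborel. norm (p N (cis s) - f (cis s)))"
          by (simp add: set_borel_integral_eq_integral(2)[OF nr])
        also have "\<dots> = 2 * pi * E N"
        proof -
          have "complex_of_real (E N) = (\<integral>\<zeta>. complex_of_real (norm (p N \<zeta> - f \<zeta>)) \<partial>circle_measure)"
            unfolding E_def by (simp only: mult_1_right integral_complex_of_real)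
          also have "\<dots> = (LINT s:{0..2*pi}|lborel. complex_of_real (norm (p N (cis s) - f (cis s)))) / (2*pi)"
            by (rule integral_circle) measurable
          also have "(LINT s:{0..2*pi}|lborel. complex_of_real (norm (p N (cis s) - f (cis s)))) =
              complex_of_real (LINT s:{0..2*pi}|lborel. norm (p N (cis s) - f (cis s)))"
            by (rule set_integral_complex_of_real)
          finally have "complex_of_real (E N) = complex_of_real ((LINT s:{0..2*pi}|lborel. norm (p N (cis s) - f (cis s))) / (2*pi))"
            by simp
          then have "E N = (LINT s:{0..2*pi}|lborel. norm (p N (cis s) - f (cis s))) / (2*pi)"
            by (simp only: of_real_eq_iff)
          then show ?thesis by simp
        qed
        finally show ?thesis .
      qed
      have "(\<lambda>N. 2 * pi * E N) \<longlonglongrightarrow> 2 * pi * 0" by (intro tendsto_intros E0)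
      then have "(\<lambda>N. 2 * pi * E N) \<longlonglongrightarrow> 0" by simp
      then have "(\<lambda>N. integral {0..t} (q N) - integral {0..t} ?g) \<longlonglongrightarrow> 0"
        by (rule Lim_null_comparison[OF always_eventually, rotated]) (use le in blast)
      then show ?thesis by (rule LIM_zero_cancel)
    qed
    ultimately show ?thesis by (rule LIMSEQ_unique)
  qed
  have deriv: "AE t in lborel. t \<in> {0..2*pi} \<longrightarrow> t \<in> {0<..<2*pi} \<and>
      ((\<lambda>y. integral {0..y} ?g) has_vector_derivative ?g t) (at t)"
    by (rule indefinite_integral_has_vector_derivative_AE[OF gHK])
  from deriv have ae: "AE t in lborel. t \<in> {0..2*pi} \<longrightarrow> has_radial_limit \<phi> (cis t) (f (cis t))"
  proof eventually_elim
    case (elim t)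
    show ?case
    proof
      assume "t \<in> {0..2*pi}"
      with elim have t: "t \<in> {0<..<2*pi}"
        and dg: "((\<lambda>y. integral {0..y} ?g) has_vector_derivative ?g t) (at t)" by blast+
      from dg have "((\<lambda>y. F 1 + integral {0..y} ?g) has_vector_derivative 0 + ?g t) (at t)"
        by (intro has_vector_derivative_add has_vector_derivative_const)
      then have "((\<lambda>y. F (cis y)) has_vector_derivative 0 + ?g t) (at t)"
      proof (rule has_vector_derivative_transform_within_open[of _ _ _ "{0<..<2*pi}"])
        fix y assume "y \<in> {0<..<2*pi}"
        then have "F (cis y) - F 1 = integral {0..y} ?g" by (intro Fint) auto
        then show "F 1 + integral {0..y} ?g = F (cis y)" by (simp add: algebra_simps)
      qed (use t in auto)
      then have der: "((\<lambda>y. F (cis y)) has_vector_derivative f (cis t) * (\<i> * cis t)) (at t)" by simp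
      show "has_radial_limit \<phi> (cis t) (f (cis t))"
        unfolding has_radial_limit_def
        by (rule radial_limit_of_derivative[OF Fc Fd]) (use tangential_derivative_oscillation[OF der] in auto)
    qed
  qed
  have bm: "boundary \<phi> \<in> borel_measurable circle_measure"
    by (rule measurable_boundary[OF Hinf_continuous[OF \<phi>]])
  \<comment> \<open>Having the limit \<open>f \<zeta>\<close> is split into having some limit and
    agreement of \<open>boundary \<phi>\<close> with \<open>f\<close>; both conditions are
    measurable.\<close>
  have set_eq: "{\<zeta>\<in>sphere 0 1. has_radial_limit \<phi> \<zeta> (f \<zeta>)} =
      {\<zeta>\<in>sphere 0 1. \<exists>l. has_radial_limit \<phi> \<zeta> l} \<inter> {\<zeta>\<in>space circle_measure. boundary \<phi> \<zeta> = f \<zeta>}"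
    using boundary_eqI[of \<phi>] by fastforce
  have "{\<zeta>\<in>space circle_measure. boundary \<phi> \<zeta> = f \<zeta>} \<in> sets circle_measure"
    using bm by measurable
  then have "{\<zeta>\<in>sphere 0 1. has_radial_limit \<phi> \<zeta> (f \<zeta>)} \<in> sets circle_measure"
    unfolding set_eq using sets_radial_limit[OF Hinf_continuous[OF \<phi>]] by (intro sets.Int)
  then have "AE \<zeta> in circle_measure. has_radial_limit \<phi> \<zeta> (f \<zeta>)"
    using ae by (subst AE_circle_iff)
  then show ?thesis using that f by blast
qed

section \<open>Boundary functions and outer functions\<close>

lemma
  assumes \<phi>: "\<phi> \<in> Hinf"
  shows boundary_radial_limit: "AE \<zeta> in circle_measure. has_radial_limit \<phi> \<zeta> (boundary \<phi> \<zeta>)"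
    and boundary_H2: "boundary \<phi> \<in> H2"
    and fourier_coeff_boundary: "fourier_coeff (boundary \<phi>) (int n) = taylor_coeff \<phi> n"
proof -
  obtain f where f: "f \<in> H2" "\<And>n. fourier_coeff f (int n) = taylor_coeff \<phi> n"
    "AE \<zeta> in circle_measure. has_radial_limit \<phi> \<zeta> (f \<zeta>)"
    using fatou_radial_limits[OF \<phi>] by blast
  have bm: "boundary \<phi> \<in> borel_measurable circle_measure"
    by (rule measurable_boundary[OF Hinf_continuous[OF \<phi>]])
  show "AE \<zeta> in circle_measure. has_radial_limit \<phi> \<zeta> (boundary \<phi> \<zeta>)"
    using f(3) by eventually_elim (simp add: boundary_eqI)
  have ae: "AE \<zeta> in circle_measure. boundary \<phi> \<zeta> = f \<zeta>"
    using f(3) by eventually_elim (rule boundary_eqI)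
  show "boundary \<phi> \<in> H2" by (rule H2_cong_AE[OF f(1) bm ae])
  show "fourier_coeff (boundary \<phi>) (int n) = taylor_coeff \<phi> n"
    unfolding f(2)[symmetric] fourier_coeff_def
    by (rule l2_inner_cong_AE) (use ae in \<open>auto intro: bm L2_measurable H2_L2 f L2_powi\<close>)
qed

lemma measurable_boundary_Hinf [measurable (raw)]:
  "\<phi> \<in> Hinf \<Longrightarrow> boundary \<phi> \<in> borel_measurable circle_measure"
  by (intro measurable_boundary Hinf_continuous)

lemma AE_norm_boundary_le:
  assumes \<phi>: "\<phi> \<in> Hinf" and C: "\<And>z. norm z < 1 \<Longrightarrow> norm (\<phi> z) \<le> C"
  shows "AE \<zeta> in circle_measure. norm (boundary \<phi> \<zeta>) \<le> C"
proof -
  have "AE \<zeta> in circle_measure. norm \<zeta> = 1" by (rule AE_I2) simp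
  with boundary_radial_limit[OF \<phi>] show ?thesis
  proof eventually_elim
    case (elim \<zeta>)
    show ?case
    proof (rule LIMSEQ_le_const2[OF tendsto_norm[OF radial_sequence(2)[OF elim(1)]]])
      have "norm (\<phi> (complex_of_real (1 - 1 / (real n + 2)) * \<zeta>)) \<le> C" for n
        using radial_sequence(1)[of n] elim(2) by (intro C) (auto simp: norm_mult simp del: of_real_diff)
      then show "\<exists>N. \<forall>n\<ge>N. norm (\<phi> (complex_of_real (1 - 1 / (real n + 2)) * \<zeta>)) \<le> C" by blast
    qed
  qed
qed

lemma AE_boundary_bounded:
  assumes "\<phi> \<in> Hinf"
  obtains C where "AE \<zeta> in circle_measure. norm (boundary \<phi> \<zeta>) \<le> C"
proof -
  obtain C where "\<And>z. norm z < 1 \<Longrightarrow> norm (\<phi> z) \<le> C" using Hinf_bound[OF assms] by blast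
  from AE_norm_boundary_le[OF assms this] that show ?thesis by blast
qed

lemma Hinf_mult:
  assumes \<phi>: "\<phi> \<in> Hinf" and \<psi>: "\<psi> \<in> Hinf" shows "(\<lambda>z. \<phi> z * \<psi> z) \<in> Hinf"
proof -
  obtain C D where C: "C > 0" "\<And>z. norm z < 1 \<Longrightarrow> norm (\<phi> z) \<le> C"
    and D: "\<And>z. norm z < 1 \<Longrightarrow> norm (\<psi> z) \<le> D"
    using Hinf_bound[OF \<phi>] Hinf_bound[OF \<psi>] by metis
  show ?thesis
  proof (rule HinfI)
    show "(\<lambda>z. \<phi> z * \<psi> z) holomorphic_on ball 0 1"
      by (intro holomorphic_intros Hinf_holomorphic \<phi> \<psi>)
    show "norm (\<phi> z * \<psi> z) \<le> C * D" if "norm z < 1" for z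
      unfolding norm_mult using C D that by (intro mult_mono) (auto intro: less_imp_le)
  qed
qed

lemma AE_boundary_mult:
  assumes \<phi>: "\<phi> \<in> Hinf" and \<psi>: "\<psi> \<in> Hinf"
  shows "AE \<zeta> in circle_measure. boundary (\<lambda>z. \<phi> z * \<psi> z) \<zeta> = boundary \<phi> \<zeta> * boundary \<psi> \<zeta>"
  using boundary_radial_limit[OF \<phi>] boundary_radial_limit[OF \<psi>]
proof eventually_elim
  case (elim \<zeta>)
  then show ?case
    by (intro boundary_eqI) (auto simp: has_radial_limit_def intro: tendsto_mult)
qed

lemma boundary_mult_L2:
  assumes "\<phi> \<in> Hinf" "g \<in> L2" shows "(\<lambda>\<zeta>. boundary \<phi> \<zeta> * g \<zeta>) \<in> L2"
proof -
  obtain C where "AE \<zeta> in circle_measure. norm (boundary \<phi> \<zeta>) \<le> C"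
    using AE_boundary_bounded[OF assms(1)] by blast
  then show ?thesis using assms by (intro L2_bounded_mult measurable_boundary_Hinf)
qed

lemma cnj_boundary_mult_L2:
  assumes "\<phi> \<in> Hinf" "g \<in> L2" shows "(\<lambda>\<zeta>. cnj (boundary \<phi> \<zeta>) * g \<zeta>) \<in> L2"
  using L2_cnj[OF boundary_mult_L2[OF assms(1) L2_cnj[OF assms(2)]]] by simp

lemma l2_inner_cnj_mult: "l2_inner (\<lambda>\<zeta>. cnj (b \<zeta>) * f \<zeta>) g = l2_inner f (\<lambda>\<zeta>. b \<zeta> * g \<zeta>)"
  unfolding l2_inner_def by (simp add: mult_ac)

text \<open>For \<open>g\<close> a power of the variable the coefficient of negative index
  \<open>k\<close> is one of \<open>boundary \<phi>\<close> with the still smaller index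
  \<open>k - n\<close>; polynomials are dense.\<close>

lemma boundary_mult_H2:
  assumes \<phi>: "\<phi> \<in> Hinf" and g: "g \<in> H2"
  shows "(\<lambda>\<zeta>. boundary \<phi> \<zeta> * g \<zeta>) \<in> H2"
proof -
  let ?b = "boundary \<phi>" and ?s = "taylor_sum (\<lambda>n. fourier_coeff g (int n))"
  have L2: "(\<lambda>\<zeta>. ?b \<zeta> * g \<zeta>) \<in> L2" by (rule boundary_mult_L2[OF \<phi> H2_L2[OF g]])
  have "fourier_coeff (\<lambda>\<zeta>. ?b \<zeta> * g \<zeta>) k = 0" if k: "k < 0" for k
  proof -
    \<comment> \<open>Moving the boundary function to the second argument leaves \<open>g\<close>
      alone in the first, so its Taylor sums can be passed to the limit against a fixed
      function.\<close>
    let ?K = "\<lambda>\<zeta>. cnj (?b \<zeta>) * \<zeta> powi k"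
    have K: "?K \<in> L2" by (rule cnj_boundary_mult_L2[OF \<phi> L2_powi])
    have "l2_inner (\<lambda>\<zeta>. \<zeta> ^ n) ?K = 0" for n
    proof -
      have "l2_inner (\<lambda>\<zeta>. \<zeta> ^ n) ?K = fourier_coeff ?b (k - int n)"
        unfolding fourier_coeff_def l2_inner_def
      proof (rule Bochner_Integration.integral_cong[OF refl])
        fix \<zeta> :: complex assume "\<zeta> \<in> space circle_measure"
        then have n1: "norm \<zeta> = 1" and nz: "\<zeta> \<noteq> 0" by auto
        have "\<zeta> ^ n * \<zeta> powi (- k) = \<zeta> powi (- (k - int n))"
          using nz by (simp add: power_int_add[symmetric] flip: power_int_of_nat)
        then show "\<zeta> ^ n * cnj (cnj (?b \<zeta>) * \<zeta> powi k) = ?b \<zeta> * cnj (\<zeta> powi (k - int n))"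
          by (simp only: complex_cnj_mult complex_cnj_cnj sphere_powi_uminus[OF n1] mult.left_commute)
      qed
      also have "\<dots> = 0" using boundary_H2[OF \<phi>] k by (simp add: H2_def)
      finally show ?thesis .
    qed
    then have "l2_inner (?s N) ?K = 0" for N unfolding l2_inner_taylor_sum_left[OF K] by simp
    moreover have "(\<lambda>N. l2_inner (?s N) ?K) \<longlonglongrightarrow> l2_inner g ?K"
      by (intro l2_inner_tendsto L2_taylor_sum H2_L2 g K H2_taylor_tendsto)
    ultimately have "l2_inner g ?K = 0" using LIMSEQ_unique[OF _ tendsto_const] by simp
    moreover have "fourier_coeff (\<lambda>\<zeta>. ?b \<zeta> * g \<zeta>) k = l2_inner g ?K"
      unfolding fourier_coeff_def l2_inner_def by (simp add: mult_ac)
    ultimately show ?thesis by simp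
  qed
  then show ?thesis using L2 by (simp add: H2_def)
qed

text \<open>
  A weak form of the maximum principle on the boundary, which suffices below because the bound does
  not depend on \<open>q\<close>.
\<close>

lemma Hinf_norm_le:
  assumes q: "q \<in> Hinf" and b: "AE \<zeta> in circle_measure. norm (boundary q \<zeta>) \<le> 1" and z: "norm z < 1"
  shows "norm (q z) \<le> 1 / (1 - norm z)"
proof -
  \<comment> \<open>Taylor coefficients are Fourier coefficients of a function of modulus at most 1,
    so the power series is dominated by a geometric series.\<close>
  have coeff: "norm (taylor_coeff q n) \<le> 1" for n
  proof -
    have "norm (taylor_coeff q n) \<le> (\<integral>\<zeta>. norm (boundary q \<zeta> * cnj (\<zeta> powi int n)) \<partial>circle_measure)"
      unfolding fourier_coeff_boundary[OF q, symmetric] fourier_coeff_def l2_inner_def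
      by (rule integral_norm_bound)
    also have "\<dots> \<le> (\<integral>\<zeta>. 1 \<partial>circle_measure)"
    proof (rule integral_mono_AE)
      show "integrable circle_measure (\<lambda>\<zeta>. norm (boundary q \<zeta> * cnj (\<zeta> powi int n)))"
        by (intro integrable_norm l2_inner_integrable L2_powi H2_L2 boundary_H2 q)
      have "AE \<zeta> in circle_measure. norm \<zeta> = 1" by (rule AE_I2) simp
      with b show "AE \<zeta> in circle_measure. norm (boundary q \<zeta> * cnj (\<zeta> powi int n)) \<le> 1"
        by eventually_elim (simp add: norm_mult norm_power)
    qed simp
    also have "\<dots> = 1" using circle.prob_space by simp
    finally show ?thesis .
  qed
  have sm: "summable (\<lambda>n. norm (taylor_coeff q n * z ^ n))"
    by (rule summable_norm_taylor[OF Hinf_holomorphic[OF q] z])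
  have "norm (q z) \<le> (\<Sum>n. norm (taylor_coeff q n * z ^ n))"
    using summable_norm[OF sm] taylor_sums[OF Hinf_holomorphic[OF q] z] by (simp add: sums_iff)
  also have "\<dots> \<le> (\<Sum>n. norm z ^ n)"
  proof (rule suminf_le[OF _ sm])
    show "norm (taylor_coeff q n * z ^ n) \<le> norm z ^ n" for n
      using mult_right_mono[OF coeff[of n], of "norm z ^ n"] by (simp add: norm_mult norm_power)
    show "summable (\<lambda>n. norm z ^ n)" using z by (intro summable_geometric) simp
  qed
  also have "\<dots> = 1 / (1 - norm z)" using z by (intro suminf_geometric) simp
  finally show ?thesis .
qed

lemma Hinf_eq_integral_boundary:
  assumes "q \<in> Hinf" shows "q 0 = (\<integral>\<zeta>. boundary q \<zeta> \<partial>circle_measure)"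
  using fourier_coeff_boundary[OF assms, of 0] taylor_sums[OF Hinf_holomorphic[OF assms], of 0]
  by (simp add: fourier_coeff_def l2_inner_def taylor_coeff_def)

section \<open>Herglotz integrals and their real parts\<close>

text \<open>This is the exponent in \<open>outer_function\<close>. Its real part is the Poisson
  integral of \<open>W\<close>, whose kernel is positive with mass 1; all bounds on outer functions
  come from that.\<close>

definition herglotz :: "(complex \<Rightarrow> real) \<Rightarrow> complex \<Rightarrow> complex" where
  "herglotz W z = (\<integral>\<xi>. (\<xi> + z) / (\<xi> - z) * complex_of_real (W \<xi>) \<partial>circle_measure)"

lemma herglotz_integrable:
  assumes W: "integrable circle_measure W" and z: "norm z < 1"
  shows "integrable circle_measure (\<lambda>\<xi>. (\<xi> + z) / (\<xi> - z) * complex_of_real (W \<xi>))"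
proof -
  have "integrable circle_measure (\<lambda>\<xi>. complex_of_real (W \<xi>) * ((\<xi> + z) / (\<xi> - z)))"
    by (intro integrable_mult_continuous integrable_of_real W continuous_intros) (use z in auto)
  then show ?thesis by (simp add: mult.commute)
qed

lemma herglotz_diff:
  assumes "integrable circle_measure W" "integrable circle_measure V" "norm z < 1"
  shows "herglotz (\<lambda>\<xi>. W \<xi> - V \<xi>) z = herglotz W z - herglotz V z"
  unfolding herglotz_def of_real_diff right_diff_distrib
  by (intro Bochner_Integration.integral_diff herglotz_integrable assms)

lemma herglotz_uminus: "herglotz (\<lambda>\<xi>. - W \<xi>) z = - herglotz W z"
  unfolding herglotz_def by simp

lemma herglotz_at_0: "herglotz W 0 = complex_of_real (\<integral>\<xi>. W \<xi> \<partial>circle_measure)"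
proof -
  have "herglotz W 0 = (\<integral>\<xi>. complex_of_real (W \<xi>) \<partial>circle_measure)"
    unfolding herglotz_def by (intro Bochner_Integration.integral_cong) auto
  then show ?thesis by simp
qed

lemma Re_herglotz_kernel:
  assumes "norm \<xi> = 1" "norm z < 1"
  shows "Re ((\<xi> + z) / (\<xi> - z)) = (1 - (norm z)\<^sup>2) / (norm (\<xi> - z))\<^sup>2"
proof -
  have "Re ((\<xi> + z) / (\<xi> - z)) = Re ((\<xi> + z) * cnj (\<xi> - z)) / (norm (\<xi> - z))\<^sup>2"
    by (simp add: complex_div_cnj[of "\<xi> + z"] Re_divide_of_real del: of_real_power flip: of_real_power)
  also have "Re ((\<xi> + z) * cnj (\<xi> - z)) = (norm \<xi>)\<^sup>2 - (norm z)\<^sup>2"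
    unfolding cmod_power2 by (simp add: algebra_simps power2_eq_square)
  finally show ?thesis using assms by simp
qed

lemma
  assumes W: "integrable circle_measure W" and z: "norm z < 1"
  shows Re_herglotz: "Re (herglotz W z) = (\<integral>\<xi>. (1 - (norm z)\<^sup>2) / (norm (\<xi> - z))\<^sup>2 * W \<xi> \<partial>circle_measure)"
    and integrable_poisson_mult: "integrable circle_measure (\<lambda>\<xi>. (1 - (norm z)\<^sup>2) / (norm (\<xi> - z))\<^sup>2 * W \<xi>)"
proof -
  have eq: "Re ((\<xi> + z) / (\<xi> - z) * complex_of_real (W \<xi>)) = (1 - (norm z)\<^sup>2) / (norm (\<xi> - z))\<^sup>2 * W \<xi>"
    if "\<xi> \<in> space circle_measure" for \<xi>
  proof -
    have "Re (a * complex_of_real b) = Re a * b" for a b by simp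
    then show ?thesis using Re_herglotz_kernel[of \<xi> z] that z by (simp only: mem_sphere_0 space_circle)
  qed
  note int = herglotz_integrable[OF W z]
  have "Re (herglotz W z) = (\<integral>\<xi>. Re ((\<xi> + z) / (\<xi> - z) * complex_of_real (W \<xi>)) \<partial>circle_measure)"
    unfolding herglotz_def by (rule integral_Re[OF int, symmetric])
  also have "\<dots> = (\<integral>\<xi>. (1 - (norm z)\<^sup>2) / (norm (\<xi> - z))\<^sup>2 * W \<xi> \<partial>circle_measure)"
    by (rule Bochner_Integration.integral_cong[OF refl eq])
  finally show "Re (herglotz W z) = (\<integral>\<xi>. (1 - (norm z)\<^sup>2) / (norm (\<xi> - z))\<^sup>2 * W \<xi> \<partial>circle_measure)" .
  have "integrable circle_measure (\<lambda>\<xi>. Re ((\<xi> + z) / (\<xi> - z) * complex_of_real (W \<xi>)))"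
    by (rule integrable_Re[OF int])
  also have "?this \<longleftrightarrow> integrable circle_measure (\<lambda>\<xi>. (1 - (norm z)\<^sup>2) / (norm (\<xi> - z))\<^sup>2 * W \<xi>)"
    by (rule Bochner_Integration.integrable_cong[OF refl eq])
  finally show "integrable circle_measure (\<lambda>\<xi>. (1 - (norm z)\<^sup>2) / (norm (\<xi> - z))\<^sup>2 * W \<xi>)" .
qed

lemma Re_herglotz_mono:
  assumes W: "integrable circle_measure W" and V: "integrable circle_measure V" and z: "norm z < 1"
    and le: "AE \<xi> in circle_measure. W \<xi> \<le> V \<xi>"
  shows "Re (herglotz W z) \<le> Re (herglotz V z)"
  unfolding Re_herglotz[OF W z] Re_herglotz[OF V z]
proof (rule integral_mono_AE)
  have "(norm z)\<^sup>2 < 1" using z by (simp add: abs_square_less_1)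
  then show "AE \<xi> in circle_measure. (1 - (norm z)\<^sup>2) / (norm (\<xi> - z))\<^sup>2 * W \<xi> \<le> (1 - (norm z)\<^sup>2) / (norm (\<xi> - z))\<^sup>2 * V \<xi>"
    using le by (elim eventually_mono) (intro mult_left_mono divide_nonneg_nonneg; simp)
qed (intro integrable_poisson_mult W V z)+

lemma Re_herglotz_const:
  assumes z: "norm z < 1" shows "Re (herglotz (\<lambda>_. c) z) = c"
  by (simp only: Re_herglotz[OF _ z] integrable_const circle.finite_measure integral_mult_left_zero
      integral_poisson_kernel[OF z] mult_1 circle.integrable_const)

lemma Re_herglotz_le:
  assumes W: "integrable circle_measure W" "AE \<xi> in circle_measure. W \<xi> \<le> c" and z: "norm z < 1"
  shows "Re (herglotz W z) \<le> c"
  using Re_herglotz_mono[OF W(1) _ z W(2)] Re_herglotz_const[OF z] by simp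

lemma Re_herglotz_ge:
  assumes W: "integrable circle_measure W" "AE \<xi> in circle_measure. c \<le> W \<xi>" and z: "norm z < 1"
  shows "c \<le> Re (herglotz W z)"
  using Re_herglotz_mono[OF _ W(1) z W(2)] Re_herglotz_const[OF z] by simp

text \<open>From (1 + w) / (1 - w) = 1 + 2w + 2w^2 + ... at \<open>w = z * cnj \<xi>\<close>, which
  is the Herglotz kernel on the circle.\<close>

definition herglotz_coeff :: "(complex \<Rightarrow> real) \<Rightarrow> nat \<Rightarrow> complex" where
  "herglotz_coeff W n = (if n = 0 then 1 else 2) * (\<integral>\<xi>. complex_of_real (W \<xi>) * cnj (\<xi> ^ n) \<partial>circle_measure)"

text \<open>The partial sums of the kernel are bounded by \<open>2 / (1 - norm z)\<close> uniformly
  on the circle, so summation and integration may be exchanged. This yields holomorphy as well as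
  the coefficients on smaller circles.\<close>

lemma herglotz_sums:
  assumes W: "integrable circle_measure W" and z: "norm z < 1"
  shows "(\<lambda>n. herglotz_coeff W n * z ^ n) sums herglotz W z"
proof -
  define e :: "nat \<Rightarrow> complex" where "e n = (if n = 0 then 1 else 2)" for n
  have Wi: "integrable circle_measure (\<lambda>\<xi>. complex_of_real (W \<xi>))" using W by simp
  have [measurable]: "W \<in> borel_measurable circle_measure" by (rule borel_measurable_integrable[OF W])
  have term_int: "integrable circle_measure (\<lambda>\<xi>. complex_of_real (W \<xi>) * cnj (\<xi> ^ n))" for n
    by (intro integrable_mult_continuous Wi continuous_intros)
  have e_sums: "(\<lambda>n. e n * w ^ n) sums ((1 + w) / (1 - w))" if "norm w < 1" for w
  proof -
    have "(\<lambda>n. 2 * w ^ n - (if n = 0 then 1 else 0)) sums (2 * (1 / (1 - w)) - 1)"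
      using that sums_single[of 0 "\<lambda>_. 1::complex"]
      by (intro sums_diff sums_mult geometric_sums) (auto simp: if_distrib)
    moreover have "2 * (1 / (1 - w)) - 1 = (1 + w) / (1 - w)"
    proof -
      have "1 - w \<noteq> 0" using that by auto
      then show ?thesis by (simp add: divide_simps)
    qed
    moreover have "(\<lambda>n. 2 * w ^ n - (if n = 0 then 1 else 0)) = (\<lambda>n. e n * w ^ n)"
      by (auto simp: e_def fun_eq_iff)
    ultimately show ?thesis by simp
  qed
  let ?K = "\<lambda>N \<xi>. \<Sum>n<N. e n * (z * cnj \<xi>) ^ n"
  have "(\<lambda>N. \<integral>\<xi>. ?K N \<xi> * complex_of_real (W \<xi>) \<partial>circle_measure) \<longlonglongrightarrow> herglotz W z"
    unfolding herglotz_def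
  proof (rule integral_dominated_convergence[where w = "\<lambda>\<xi>. 2 / (1 - norm z) * \<bar>W \<xi>\<bar>"])
    show "integrable circle_measure (\<lambda>\<xi>. 2 / (1 - norm z) * \<bar>W \<xi>\<bar>)" using W by simp
    show "AE \<xi> in circle_measure. (\<lambda>N. ?K N \<xi> * complex_of_real (W \<xi>)) \<longlonglongrightarrow> (\<xi> + z) / (\<xi> - z) * complex_of_real (W \<xi>)"
    proof (rule AE_I2)
      fix \<xi> assume "\<xi> \<in> space circle_measure"
      then have n1: "norm \<xi> = 1" by simp
      then have "\<xi> \<noteq> 0" "\<xi> * cnj \<xi> = 1" using complex_norm_square[of \<xi>] by auto
      have "norm (z * cnj \<xi>) < 1" using n1 z by (simp add: norm_mult)
      then have "(\<lambda>N. ?K N \<xi>) \<longlonglongrightarrow> (1 + z * cnj \<xi>) / (1 - z * cnj \<xi>)"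
        using e_sums unfolding sums_def by blast
      moreover have "(1 + z * cnj \<xi>) / (1 - z * cnj \<xi>) = (\<xi> + z) / (\<xi> - z)"
      proof -
        have "(1 + z * cnj \<xi>) / (1 - z * cnj \<xi>) = (\<xi> * (1 + z * cnj \<xi>)) / (\<xi> * (1 - z * cnj \<xi>))"
          using \<open>\<xi> \<noteq> 0\<close> by simp
        also have "\<xi> * (1 + z * cnj \<xi>) = \<xi> + z * (\<xi> * cnj \<xi>)" by (simp add: algebra_simps)
        also have "\<xi> * (1 - z * cnj \<xi>) = \<xi> - z * (\<xi> * cnj \<xi>)" by (simp add: algebra_simps)
        finally show ?thesis using \<open>\<xi> * cnj \<xi> = 1\<close> by simp
      qed
      ultimately show "(\<lambda>N. ?K N \<xi> * complex_of_real (W \<xi>)) \<longlonglongrightarrow> (\<xi> + z) / (\<xi> - z) * complex_of_real (W \<xi>)"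
        by (intro tendsto_mult tendsto_const) simp
    qed
    show "AE \<xi> in circle_measure. norm (?K N \<xi> * complex_of_real (W \<xi>)) \<le> 2 / (1 - norm z) * \<bar>W \<xi>\<bar>" for N
    proof (rule AE_I2)
      fix \<xi> assume "\<xi> \<in> space circle_measure"
      then have n1: "norm \<xi> = 1" by simp
      have "norm (?K N \<xi>) \<le> (\<Sum>n<N. 2 * norm z ^ n)"
        by (rule sum_norm_le) (simp add: norm_mult norm_power n1 e_def)
      also have "\<dots> \<le> (\<Sum>n. 2 * norm z ^ n)"
        using z by (intro sum_le_suminf summable_mult summable_geometric) auto
      also have "\<dots> = 2 / (1 - norm z)"
        using z by (subst suminf_mult) (auto simp: suminf_geometric summable_geometric)
      finally have "norm (?K N \<xi>) * \<bar>W \<xi>\<bar> \<le> 2 / (1 - norm z) * \<bar>W \<xi>\<bar>"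
        by (rule mult_right_mono) simp
      then show "norm (?K N \<xi> * complex_of_real (W \<xi>)) \<le> 2 / (1 - norm z) * \<bar>W \<xi>\<bar>"
        by (simp only: norm_mult norm_of_real)
    qed
    show "(\<lambda>\<xi>. (\<xi> + z) / (\<xi> - z) * complex_of_real (W \<xi>)) \<in> borel_measurable circle_measure"
      by (rule borel_measurable_integrable[OF herglotz_integrable[OF W z]])
    show "(\<lambda>\<xi>. ?K N \<xi> * complex_of_real (W \<xi>)) \<in> borel_measurable circle_measure" for N by measurable
  qed
  moreover have "(\<integral>\<xi>. ?K N \<xi> * complex_of_real (W \<xi>) \<partial>circle_measure) = (\<Sum>n<N. herglotz_coeff W n * z ^ n)" for N
  proof -
    have "(\<integral>\<xi>. ?K N \<xi> * complex_of_real (W \<xi>) \<partial>circle_measure) =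
       (\<integral>\<xi>. (\<Sum>n<N. (e n * z ^ n) * (complex_of_real (W \<xi>) * cnj (\<xi> ^ n))) \<partial>circle_measure)"
      by (intro Bochner_Integration.integral_cong refl)
         (simp add: sum_distrib_left power_mult_distrib mult_ac)
    also have "\<dots> = (\<Sum>n<N. (e n * z ^ n) * (\<integral>\<xi>. complex_of_real (W \<xi>) * cnj (\<xi> ^ n) \<partial>circle_measure))"
      by (subst Bochner_Integration.integral_sum) (auto intro!: integrable_mult_right term_int simp del: complex_cnj_power)
    also have "\<dots> = (\<Sum>n<N. herglotz_coeff W n * z ^ n)"
      by (simp add: herglotz_coeff_def e_def mult_ac)
    finally show ?thesis .
  qed
  ultimately show ?thesis by (simp add: sums_def)
qed

lemma herglotz_holomorphic:
  "integrable circle_measure W \<Longrightarrow> herglotz W holomorphic_on ball 0 1"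
  by (rule power_series_holomorphic[where a = "herglotz_coeff W"]) (simp add: herglotz_sums)

lemma norm_exp_herglotz: "norm (exp (herglotz W z)) = exp (Re (herglotz W z))"
  by (rule norm_exp_eq_Re)

lemma exp_herglotz_Hinf:
  assumes W: "integrable circle_measure W" "AE \<xi> in circle_measure. W \<xi> \<le> c"
  shows "(\<lambda>z. exp (herglotz W z)) \<in> Hinf"
proof (rule HinfI)
  show "(\<lambda>z. exp (herglotz W z)) holomorphic_on ball 0 1"
    by (intro holomorphic_intros herglotz_holomorphic W)
  show "norm (exp (herglotz W z)) \<le> exp c" if "norm z < 1" for z
    using Re_herglotz_le[OF W that] by (simp add: norm_exp_herglotz)
qed


section \<open>Boundary modulus of outer functions with bounded logarithm\<close>

lemma integral_cnj_powi_uminus: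
  fixes u :: "complex \<Rightarrow> real"
  shows "(\<integral>\<zeta>. complex_of_real (u \<zeta>) * cnj (\<zeta> powi (- k)) \<partial>circle_measure) =
    cnj (\<integral>\<zeta>. complex_of_real (u \<zeta>) * cnj (\<zeta> powi k) \<partial>circle_measure)"
proof -
  have "(\<integral>\<zeta>. complex_of_real (u \<zeta>) * cnj (\<zeta> powi (- k)) \<partial>circle_measure) =
    (\<integral>\<zeta>. cnj (complex_of_real (u \<zeta>) * cnj (\<zeta> powi k)) \<partial>circle_measure)"
  proof (rule Bochner_Integration.integral_cong[OF refl])
    fix \<zeta> :: complex assume "\<zeta> \<in> space circle_measure"
    then have n1: "norm \<zeta> = 1" by simp
    show "complex_of_real (u \<zeta>) * cnj (\<zeta> powi (- k)) = cnj (complex_of_real (u \<zeta>) * cnj (\<zeta> powi k))"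
      using sphere_powi_uminus[OF n1, of "- k"] by simp
  qed
  then show ?thesis by (simp only: Bochner_Integration.integral_cnj)
qed

text \<open>For a real function the coefficients of negative index are the conjugates of those of
  positive index.\<close>

lemma AE_eq_0_if_nonneg_coeff_0:
  fixes u :: "complex \<Rightarrow> real"
  assumes u: "integrable circle_measure u"
    and coeff: "\<And>n. (\<integral>\<zeta>. complex_of_real (u \<zeta>) * cnj (\<zeta> ^ n) \<partial>circle_measure) = 0"
  shows "AE \<zeta> in circle_measure. u \<zeta> = 0"
proof -
  have nonneg: "(\<integral>\<zeta>. complex_of_real (u \<zeta>) * cnj (\<zeta> powi int n) \<partial>circle_measure) = 0" for n
    using coeff[of n] by simp
  have "(\<integral>\<zeta>. complex_of_real (u \<zeta>) * cnj (\<zeta> powi k) \<partial>circle_measure) = 0" for k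
  proof (cases "k \<ge> 0")
    case True
    then show ?thesis using nonneg[of "nat k"] by simp
  next
    case False
    then show ?thesis using nonneg[of "nat (- k)"] integral_cnj_powi_uminus[of u "- k"] by simp
  qed
  then have "AE \<zeta> in circle_measure. complex_of_real (u \<zeta>) = 0"
    using u by (intro AE_eq_0_if_fourier_coeff_0) auto
  then show ?thesis by simp
qed

text \<open>The Poisson integral multiplies the \<open>n\<close>-th coefficient by
  \<open>r ^ n\<close>. The real part is half the sum of the analytic function and its conjugate,
  and this half cancels the 2 in \<open>herglotz_coeff\<close>.\<close>

lemma integral_Re_herglotz_coeff:
  assumes W: "integrable circle_measure W" and r: "\<bar>r\<bar> < 1"
  shows "(\<integral>\<zeta>. complex_of_real (Re (herglotz W (complex_of_real r * \<zeta>))) * cnj (\<zeta> ^ n) \<partial>circle_measure) =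
    of_real r ^ n * (\<integral>\<zeta>. complex_of_real (W \<zeta>) * cnj (\<zeta> ^ n) \<partial>circle_measure)"
proof -
  let ?b = "\<lambda>n. herglotz_coeff W n * of_real r ^ n" and ?h = "\<lambda>\<zeta>. herglotz W (complex_of_real r * \<zeta>)"
  let ?e = "\<lambda>\<zeta>::complex. \<zeta> powi int n"
  have sums: "(\<lambda>n. ?b n * \<zeta> ^ n) sums ?h \<zeta>" if "norm \<zeta> = 1" for \<zeta>
    using herglotz_sums[OF W, of "of_real r * \<zeta>"] r that by (simp add: norm_mult power_mult_distrib mult.assoc)
  have sm: "summable (\<lambda>n. norm (?b n))"
  proof -
    define x where "x = complex_of_real ((1 + \<bar>r\<bar>) / 2)"
    have nx: "norm x = (1 + \<bar>r\<bar>) / 2" unfolding x_def norm_of_real by simp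
    show ?thesis
    proof (rule powser_insidea)
      show "summable (\<lambda>n. herglotz_coeff W n * x ^ n)"
        using herglotz_sums[OF W, of x] r nx by (simp add: sums_iff)
      show "norm (complex_of_real r) < norm x" using r nx by simp
    qed
  qed
  note hL2 = L2_power_series[OF sm sums] and hc = fourier_coeff_power_series[OF sm sums]
  have e_cnj: "cnj (?e \<zeta>) = cnj (\<zeta> ^ n)" for \<zeta> by simp
  have "(\<integral>\<zeta>. complex_of_real (Re (?h \<zeta>)) * cnj (?e \<zeta>) \<partial>circle_measure) =
     (\<integral>\<zeta>. (?h \<zeta> * cnj (?e \<zeta>) + cnj (?h \<zeta>) * cnj (?e \<zeta>)) / 2 \<partial>circle_measure)"
  proof (rule Bochner_Integration.integral_cong[OF refl])
    fix \<zeta>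
    have "complex_of_real (Re w) = (w + cnj w) / 2" for w by (simp add: complex_add_cnj)
    then show "complex_of_real (Re (?h \<zeta>)) * cnj (?e \<zeta>) = (?h \<zeta> * cnj (?e \<zeta>) + cnj (?h \<zeta>) * cnj (?e \<zeta>)) / 2"
      by (simp only: distrib_right times_divide_eq_left)
  qed
  also have "\<dots> = (l2_inner ?h ?e + l2_inner (\<lambda>\<zeta>. cnj (?h \<zeta>)) ?e) / 2"
    unfolding l2_inner_def integral_divide_zero
    by (subst Bochner_Integration.integral_add[OF l2_inner_integrable[OF hL2 L2_powi]
          l2_inner_integrable[OF L2_cnj[OF hL2] L2_powi]]) simp_all
  also have "l2_inner ?h ?e = ?b n"
    using hc[of "int n"] by (simp add: fourier_coeff_def)
  also have "l2_inner (\<lambda>\<zeta>. cnj (?h \<zeta>)) ?e = cnj (fourier_coeff ?h (- int n))"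
  proof -
    have "l2_inner (\<lambda>\<zeta>. cnj (?h \<zeta>)) ?e = (\<integral>\<zeta>. cnj (?h \<zeta> * cnj (\<zeta> powi (- int n))) \<partial>circle_measure)"
      unfolding l2_inner_def
    proof (rule Bochner_Integration.integral_cong[OF refl])
      fix \<zeta> :: complex assume "\<zeta> \<in> space circle_measure"
      then have n1: "norm \<zeta> = 1" by simp
      show "cnj (?h \<zeta>) * cnj (?e \<zeta>) = cnj (?h \<zeta> * cnj (\<zeta> powi (- int n)))"
        using sphere_powi_uminus[OF n1, of "- int n"] by simp
    qed
    also have "\<dots> = cnj (fourier_coeff ?h (- int n))"
      unfolding fourier_coeff_def l2_inner_def by (rule Bochner_Integration.integral_cnj)
    finally show ?thesis .
  qed
  also have "(?b n + cnj (fourier_coeff ?h (- int n))) / 2 = of_real r ^ n * (\<integral>\<zeta>. complex_of_real (W \<zeta>) * cnj (\<zeta> ^ n) \<partial>circle_measure)"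
  \<comment> \<open>For \<open>n = 0\<close> both halves contribute the mean of \<open>W\<close>;
    for positive \<open>n\<close> the conjugate contributes a coefficient of negative index, which
    is 0.\<close>
  proof (cases "n = 0")
    case True
    then show ?thesis using hc[of 0] by (simp add: herglotz_coeff_def)
  next
    case False
    then have "fourier_coeff ?h (- int n) = 0" using hc[of "- int n"] by simp
    then show ?thesis using False by (simp add: herglotz_coeff_def)
  qed
  finally show ?thesis unfolding e_cnj .
qed

text \<open>Along the fixed radii the logarithm of the modulus is the Poisson integral
  \<open>u k\<close> of \<open>W\<close>. It converges to \<open>v\<close>, while its coefficients
  converge to those of \<open>W\<close>; hence \<open>v\<close> and \<open>W\<close> agree.
  Boundedness of \<open>W\<close> dominates the integrals and keeps the modulus away from 0.\<close>

theorem AE_norm_boundary_exp_herglotz: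
  assumes W [measurable]: "W \<in> borel_measurable circle_measure" and bd: "AE \<xi> in circle_measure. \<bar>W \<xi>\<bar> \<le> c"
  shows "AE \<zeta> in circle_measure. norm (boundary (\<lambda>z. exp (herglotz W z)) \<zeta>) = exp (W \<zeta>)"
proof -
  let ?O = "\<lambda>z. exp (herglotz W z)" and ?r = "\<lambda>k. 1 - 1 / (real k + 2)"
  have Wi: "integrable circle_measure W" by (rule integrable_circle_bounded[where C = c]) (use bd in auto)
  have up: "AE \<xi> in circle_measure. W \<xi> \<le> c" and lo: "AE \<xi> in circle_measure. - c \<le> W \<xi>"
    using bd by (auto elim!: eventually_mono)
  have O: "?O \<in> Hinf" by (rule exp_herglotz_Hinf[OF Wi up])
  let ?b = "boundary ?O"
  have [measurable]: "?b \<in> borel_measurable circle_measure" by (rule measurable_boundary_Hinf[OF O])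
  define v where "v \<zeta> = ln (norm (?b \<zeta>))" for \<zeta>
  have [measurable]: "v \<in> borel_measurable circle_measure" unfolding v_def by measurable
  define u where "u k \<zeta> = Re (herglotz W (complex_of_real (?r k) * \<zeta>))" for k \<zeta>
  have rk: "\<bar>?r k\<bar> < 1" for k using radial_sequence(1)[of k] by auto
  have ub: "\<bar>u k \<zeta>\<bar> \<le> c" if "norm \<zeta> = 1" for k \<zeta>
  proof -
    have "norm (complex_of_real (?r k) * \<zeta>) < 1" using that rk by (simp add: norm_mult del: of_real_diff)
    then show ?thesis
      using Re_herglotz_le[OF Wi up] Re_herglotz_ge[OF Wi lo] unfolding u_def by (intro abs_leI) force+
  qed
  have uc: "continuous_on (sphere 0 1) (u k)" for k
    unfolding u_def
    by (intro continuous_on_Re continuous_on_dilation holomorphic_on_imp_continuous_on herglotz_holomorphic Wi rk)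
  have [measurable]: "u k \<in> borel_measurable circle_measure" for k
    by (rule measurable_circle_continuous[OF uc])
  have circ: "AE \<zeta> in circle_measure. norm \<zeta> = 1" by (rule AE_I2) simp
  have ae: "AE \<zeta> in circle_measure. ((\<lambda>k. u k \<zeta>) \<longlonglongrightarrow> v \<zeta>) \<and> \<bar>v \<zeta>\<bar> \<le> c \<and> exp (v \<zeta>) = norm (?b \<zeta>)"
    using boundary_radial_limit[OF O] circ
  proof eventually_elim
    case (elim \<zeta>)
    have lim: "(\<lambda>k. exp (u k \<zeta>)) \<longlonglongrightarrow> norm (?b \<zeta>)"
      using tendsto_norm[OF radial_sequence(2)[OF elim(1)]] by (simp only: norm_exp_herglotz u_def)
    \<comment> \<open>A positive lower bound survives in the limit, so \<open>ln\<close> is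
      continuous at the limit and the default value \<open>ln 0 = 0\<close> cannot occur.\<close>
    have "exp (- c) \<le> norm (?b \<zeta>)"
    proof (rule LIMSEQ_le_const[OF lim])
      show "\<exists>N. \<forall>k\<ge>N. exp (- c) \<le> exp (u k \<zeta>)"
      proof (intro exI allI impI)
        show "exp (- c) \<le> exp (u k \<zeta>)" for k using ub[OF elim(2), of k] by simp
      qed
    qed
    then have pos: "norm (?b \<zeta>) > 0" using exp_gt_zero[of "- c"] by linarith
    have "(\<lambda>k. ln (exp (u k \<zeta>))) \<longlonglongrightarrow> ln (norm (?b \<zeta>))"
      by (rule tendsto_ln[OF lim]) (use pos in auto)
    then have v: "(\<lambda>k. u k \<zeta>) \<longlonglongrightarrow> v \<zeta>" by (simp add: v_def)
    moreover have "\<bar>v \<zeta>\<bar> \<le> c"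
      by (rule LIMSEQ_le_const2[OF tendsto_rabs[OF v]]) (use ub[OF elim(2)] in blast)
    ultimately show ?case using pos by (simp add: v_def)
  qed
  have vi: "integrable circle_measure v"
    by (rule integrable_circle_bounded[where C = c]) (use ae in \<open>auto elim: eventually_mono\<close>)
  have "AE \<zeta> in circle_measure. v \<zeta> - W \<zeta> = 0"
  proof (rule AE_eq_0_if_nonneg_coeff_0)
    show "integrable circle_measure (\<lambda>\<zeta>. v \<zeta> - W \<zeta>)" using vi Wi by simp
    fix n
    have vn: "integrable circle_measure (\<lambda>\<zeta>. complex_of_real (v \<zeta>) * cnj (\<zeta> ^ n))"
      and Wn: "integrable circle_measure (\<lambda>\<zeta>. complex_of_real (W \<zeta>) * cnj (\<zeta> ^ n))"
      by (intro integrable_mult_continuous integrable_of_real vi Wi continuous_intros)+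
    have "(\<lambda>k. \<integral>\<zeta>. complex_of_real (u k \<zeta>) * cnj (\<zeta> ^ n) \<partial>circle_measure) \<longlonglongrightarrow>
        (\<integral>\<zeta>. complex_of_real (v \<zeta>) * cnj (\<zeta> ^ n) \<partial>circle_measure)"
    proof (rule integral_dominated_convergence[where w = "\<lambda>_. c"])
      show "AE \<zeta> in circle_measure. (\<lambda>k. complex_of_real (u k \<zeta>) * cnj (\<zeta> ^ n)) \<longlonglongrightarrow> complex_of_real (v \<zeta>) * cnj (\<zeta> ^ n)"
        using ae by eventually_elim (intro tendsto_intros, blast)
      show "AE \<zeta> in circle_measure. norm (complex_of_real (u k \<zeta>) * cnj (\<zeta> ^ n)) \<le> c" for k
        by (rule AE_I2) (simp add: norm_mult norm_power ub)
      show "(\<lambda>\<zeta>. complex_of_real (v \<zeta>) * cnj (\<zeta> ^ n)) \<in> borel_measurable circle_measure"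
        by (rule borel_measurable_integrable[OF vn])
      show "(\<lambda>\<zeta>. complex_of_real (u k \<zeta>) * cnj (\<zeta> ^ n)) \<in> borel_measurable circle_measure" for k
        by measurable
    qed simp
    moreover have "(\<lambda>k. \<integral>\<zeta>. complex_of_real (u k \<zeta>) * cnj (\<zeta> ^ n) \<partial>circle_measure) \<longlonglongrightarrow>
        1 ^ n * (\<integral>\<zeta>. complex_of_real (W \<zeta>) * cnj (\<zeta> ^ n) \<partial>circle_measure)"
    proof -
      have "?r \<longlonglongrightarrow> 1" by real_asymp
      then have "(\<lambda>k. complex_of_real (?r k)) \<longlonglongrightarrow> complex_of_real 1" by (rule tendsto_of_real)
      then have "(\<lambda>k. complex_of_real (?r k)) \<longlonglongrightarrow> 1" by (simp only: of_real_1)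
      then show ?thesis
        unfolding u_def integral_Re_herglotz_coeff[OF Wi rk] by (intro tendsto_intros)
    qed
    ultimately have "(\<integral>\<zeta>. complex_of_real (v \<zeta>) * cnj (\<zeta> ^ n) \<partial>circle_measure) =
        1 ^ n * (\<integral>\<zeta>. complex_of_real (W \<zeta>) * cnj (\<zeta> ^ n) \<partial>circle_measure)"
      by (rule LIMSEQ_unique)
    then show "(\<integral>\<zeta>. complex_of_real (v \<zeta> - W \<zeta>) * cnj (\<zeta> ^ n) \<partial>circle_measure) = 0"
      unfolding of_real_diff left_diff_distrib Bochner_Integration.integral_diff[OF vn Wn] by simp
  qed
  with ae show ?thesis by eventually_elim simp
qed

section \<open>Log-integrability and the common ranges\<close>

text \<open>Multiplying \<open>\<phi>\<close> by the outer function of modulus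
  \<open>1 / max (norm (boundary \<phi> \<zeta>)) (exp (- k))\<close> gives boundary modulus at most
  1. The weak maximum principle bounds the product at \<open>z0\<close> independently of
  \<open>k\<close>. Taking logarithms bounds the Poisson integral of \<open>L - W k\<close> at
  \<open>z0\<close>, hence its plain integral, and monotone convergence removes the
  truncation.\<close>

lemma
  assumes \<phi>: "\<phi> \<in> Hinf" and z0: "norm z0 < 1" "\<phi> z0 \<noteq> 0"
  shows AE_boundary_nonzero: "AE \<zeta> in circle_measure. boundary \<phi> \<zeta> \<noteq> 0"
    and integrable_ln_norm_boundary: "integrable circle_measure (\<lambda>\<zeta>. ln (norm (boundary \<phi> \<zeta>)))"
proof -
  let ?b = "boundary \<phi>" and ?M = circle_measure
  have [measurable]: "?b \<in> borel_measurable ?M" by (rule measurable_boundary_Hinf[OF \<phi>])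
  obtain C0 where C0: "\<And>z. norm z < 1 \<Longrightarrow> norm (\<phi> z) \<le> C0" using Hinf_bound[OF \<phi>] by blast
  \<comment> \<open>A bound of at least 1 makes \<open>L = ln C\<close> nonnegative and also
    dominates the floor \<open>exp (- k)\<close>, so that \<open>W k \<le> L\<close> holds where the
    truncation is active too.\<close>
  define C where "C = max C0 1"
  have C1: "C \<ge> 1" and "\<And>z. norm z < 1 \<Longrightarrow> norm (\<phi> z) \<le> C" using C0 by (auto simp: C_def le_max_iff_disj)
  from AE_norm_boundary_le[OF \<phi> this(2)] have bC: "AE \<zeta> in ?M. norm (?b \<zeta>) \<le> C" .
  define L where "L = ln C"
  have L0: "L \<ge> 0" using C1 by (simp add: L_def)
  define W where "W k \<zeta> = ln (max (norm (?b \<zeta>)) (exp (- real k)))" for k \<zeta>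
  have [measurable]: "W k \<in> borel_measurable ?M" for k unfolding W_def by measurable
  have Wge: "- real k \<le> W k \<zeta>" for k \<zeta>
    unfolding W_def by (subst ln_ge_iff) (auto simp: less_max_iff_disj)
  have WleL: "W k \<zeta> \<le> L" if "norm (?b \<zeta>) \<le> C" for k \<zeta>
  proof -
    have "exp (- real k) \<le> C" using C1 order_trans[of "exp (- real k)" 1 C] by simp
    then show ?thesis
      unfolding W_def L_def using that C1 by (subst ln_le_cancel_iff) (auto simp: less_max_iff_disj)
  qed
  have Wle: "AE \<zeta> in ?M. W k \<zeta> \<le> L" for k using bC by eventually_elim (rule WleL)
  have Wabs: "AE \<zeta> in ?M. \<bar>W k \<zeta>\<bar> \<le> L + real k" for k
    using Wle[of k]
  proof eventually_elim
    case (elim \<zeta>)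
    then show ?case using Wge[of k \<zeta>] L0 by linarith
  qed
  have Wi: "integrable ?M (W k)" for k by (rule integrable_circle_bounded[OF _ Wabs[of k, folded real_norm_def]]) measurable
  define U where "U k \<zeta> = L - W k \<zeta>" for k \<zeta>
  have Ui: "integrable ?M (U k)" for k unfolding U_def using Wi by simp
  have [measurable]: "U k \<in> borel_measurable ?M" for k unfolding U_def by measurable
  have U0: "AE \<zeta> in ?M. 0 \<le> U k \<zeta>" for k using Wle[of k] by (auto simp: U_def)
  \<comment> \<open>A lower bound for the Poisson kernel at \<open>z0\<close>, since points of the
    circle are at distance at most 2 from \<open>z0\<close>.\<close>
  define p where "p = (1 - (norm z0)\<^sup>2) / 4"
  have s: "(norm z0)\<^sup>2 < 1" using z0 by (simp add: abs_square_less_1)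
  then have p: "p > 0" by (simp add: p_def)
  \<comment> \<open>Logarithm of the bound \<open>1 / (1 - norm z0)\<close> for the product, after
    division by the nonzero number \<open>norm (\<phi> z0)\<close>.\<close>
  define A where "A = ln (1 / (1 - norm z0) / norm (\<phi> z0))"
  have bound: "(\<integral>\<zeta>. U k \<zeta> \<partial>?M) \<le> (L + A) / p" for k
  proof -
    let ?E = "\<lambda>z. exp (herglotz (\<lambda>\<xi>. - W k \<xi>) z)"
    have mWi: "integrable ?M (\<lambda>\<xi>. - W k \<xi>)" using Wi by simp
    have E: "?E \<in> Hinf"
      by (rule exp_herglotz_Hinf[OF mWi, where c = "real k"]) (use Wge in \<open>auto simp: minus_le_iff\<close>)
    have q: "(\<lambda>z. \<phi> z * ?E z) \<in> Hinf" by (rule Hinf_mult[OF \<phi> E])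
    have "AE \<zeta> in ?M. norm (boundary ?E \<zeta>) = exp (- W k \<zeta>)"
      by (rule AE_norm_boundary_exp_herglotz) (use Wabs in auto)
    with AE_boundary_mult[OF \<phi> E] have "AE \<zeta> in ?M. norm (boundary (\<lambda>z. \<phi> z * ?E z) \<zeta>) \<le> 1"
    proof eventually_elim
      case (elim \<zeta>)
      have pos: "0 < max (norm (?b \<zeta>)) (exp (- real k))" by (simp add: less_max_iff_disj)
      have "norm (boundary (\<lambda>z. \<phi> z * ?E z) \<zeta>) = norm (?b \<zeta>) / max (norm (?b \<zeta>)) (exp (- real k))"
        unfolding elim(1) norm_mult elim(2) using pos by (simp only: W_def exp_minus exp_ln divide_inverse)
      also have "\<dots> \<le> 1" using pos by simp
      finally show ?case .
    qed
    from Hinf_norm_le[OF q this z0(1)]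
    have "norm (\<phi> z0) * exp (Re (herglotz (\<lambda>\<xi>. - W k \<xi>) z0)) \<le> 1 / (1 - norm z0)"
      by (simp add: norm_mult norm_exp_herglotz)
    then have "exp (Re (herglotz (\<lambda>\<xi>. - W k \<xi>) z0)) \<le> 1 / (1 - norm z0) / norm (\<phi> z0)"
      using z0 by (simp add: pos_le_divide_eq mult_ac)
    then have "Re (herglotz (\<lambda>\<xi>. - W k \<xi>) z0) \<le> A"
      unfolding A_def using z0 by (subst ln_ge_iff) auto
    moreover have "Re (herglotz (U k) z0) = L + Re (herglotz (\<lambda>\<xi>. - W k \<xi>) z0)"
      unfolding U_def herglotz_uminus
      by (subst herglotz_diff[OF _ Wi z0(1)]) (simp_all add: Re_herglotz_const[OF z0(1)])
    ultimately have "Re (herglotz (U k) z0) \<le> L + A" by simp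
    moreover have "p * (\<integral>\<zeta>. U k \<zeta> \<partial>?M) \<le> Re (herglotz (U k) z0)"
      unfolding Re_herglotz[OF Ui z0(1)] integral_mult_right_zero[symmetric]
    proof (rule integral_mono_AE)
      show "integrable ?M (\<lambda>\<zeta>. p * U k \<zeta>)" using Ui by simp
      show "integrable ?M (\<lambda>\<xi>. (1 - (norm z0)\<^sup>2) / (norm (\<xi> - z0))\<^sup>2 * U k \<xi>)"
        by (rule integrable_poisson_mult[OF Ui z0(1)])
      have circ: "AE \<zeta> in ?M. norm \<zeta> = 1" by (rule AE_I2) simp
      show "AE \<xi> in ?M. p * U k \<xi> \<le> (1 - (norm z0)\<^sup>2) / (norm (\<xi> - z0))\<^sup>2 * U k \<xi>"
        using U0[of k] circ
      proof eventually_elim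
        case (elim \<xi>)
        have "norm (\<xi> - z0) \<le> 2" using norm_triangle_ineq4[of \<xi> z0] elim z0 by simp
        then have "(norm (\<xi> - z0))\<^sup>2 \<le> 2\<^sup>2" by (intro power_mono) auto
        moreover have "\<xi> \<noteq> z0" using elim z0 by auto
        ultimately have "p \<le> (1 - (norm z0)\<^sup>2) / (norm (\<xi> - z0))\<^sup>2"
          unfolding p_def using s by (intro divide_left_mono) auto
        then show ?case using elim by (intro mult_right_mono) auto
      qed
    qed
    ultimately have "p * (\<integral>\<zeta>. U k \<zeta> \<partial>?M) \<le> L + A" by linarith
    then show ?thesis using p by (simp add: pos_le_divide_eq mult.commute)
  qed
  \<comment> \<open>The supremum is taken in the extended reals: it is infinite at every zero of the
    boundary function, so finiteness of its integral proves both claims.\<close>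
  define S where "S \<zeta> = (SUP k. ennreal (U k \<zeta>))" for \<zeta>
  have [measurable]: "S \<in> borel_measurable ?M" unfolding S_def by measurable
  have "(\<integral>\<^sup>+\<zeta>. S \<zeta> \<partial>?M) = (SUP k. \<integral>\<^sup>+\<zeta>. ennreal (U k \<zeta>) \<partial>?M)"
    unfolding S_def
  proof (rule nn_integral_monotone_convergence_SUP)
    show "incseq (\<lambda>k \<zeta>. ennreal (U k \<zeta>))"
    proof (intro monoI le_funI ennreal_leI)
      fix k l :: nat and \<zeta> assume "k \<le> l"
      then have "max (norm (?b \<zeta>)) (exp (- real l)) \<le> max (norm (?b \<zeta>)) (exp (- real k))"
        by (intro max.mono) auto
      moreover have "0 < max (norm (?b \<zeta>)) (exp (- real i))" for i by (simp add: less_max_iff_disj)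
      ultimately have "W l \<zeta> \<le> W k \<zeta>"
        unfolding W_def by (simp only: ln_le_cancel_iff)
      then show "U k \<zeta> \<le> U l \<zeta>" by (simp add: U_def)
    qed
  qed measurable
  also have "\<dots> \<le> ennreal ((L + A) / p)"
  proof (rule SUP_least)
    fix k
    have "(\<integral>\<^sup>+\<zeta>. ennreal (U k \<zeta>) \<partial>?M) = ennreal (\<integral>\<zeta>. U k \<zeta> \<partial>?M)"
      by (rule nn_integral_eq_integral[OF Ui U0])
    then show "(\<integral>\<^sup>+\<zeta>. ennreal (U k \<zeta>) \<partial>?M) \<le> ennreal ((L + A) / p)"
      using bound[of k] by (simp add: ennreal_leI)
  qed
  finally have Sfin: "(\<integral>\<^sup>+\<zeta>. S \<zeta> \<partial>?M) < \<infinity>" by (rule le_less_trans) simp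
  have "AE \<zeta> in ?M. S \<zeta> \<noteq> \<infinity>"
    by (rule nn_integral_PInf_AE) (use Sfin in auto)
  then show nz: "AE \<zeta> in ?M. ?b \<zeta> \<noteq> 0"
  proof eventually_elim
    case (elim \<zeta>)
    show ?case
    proof
      assume "?b \<zeta> = 0"
      then have U: "U k \<zeta> = L + real k" for k by (simp add: U_def W_def)
      obtain t where t: "S \<zeta> = ennreal t" "t \<ge> 0" using elim by (cases "S \<zeta>") auto
      have "real k \<le> t" for k
      proof -
        have "ennreal (U k \<zeta>) \<le> ennreal t" unfolding t(1)[symmetric] S_def by (rule SUP_upper) simp
        then have "L + real k \<le> t" by (simp only: U ennreal_le_iff[OF t(2)])
        then show ?thesis using L0 by simp
      qed
      then show False using reals_Archimedean2[of t] by (auto simp: not_less[symmetric])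
    qed
  qed
  have "integrable ?M (\<lambda>\<zeta>. L - ln (norm (?b \<zeta>)))"
  proof (rule integrableI_bounded)
    have "(\<integral>\<^sup>+\<zeta>. ennreal (norm (L - ln (norm (?b \<zeta>)))) \<partial>?M) \<le> (\<integral>\<^sup>+\<zeta>. S \<zeta> \<partial>?M)"
    proof (rule nn_integral_mono_AE)
      show "AE \<zeta> in ?M. ennreal (norm (L - ln (norm (?b \<zeta>)))) \<le> S \<zeta>"
        using nz bC
      proof eventually_elim
        case (elim \<zeta>)
        \<comment> \<open>Away from the zeros the truncation is inactive for large \<open>k\<close>,
          so the untruncated function is one of the \<open>U k\<close> at this point.\<close>
        obtain k where "- ln (norm (?b \<zeta>)) \<le> real k" using real_arch_simple by blast
        then have "- real k \<le> ln (norm (?b \<zeta>))" by simp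
        then have "exp (- real k) \<le> norm (?b \<zeta>)" using elim by (subst (asm) ln_ge_iff) auto
        then have "U k \<zeta> = L - ln (norm (?b \<zeta>))" by (simp add: U_def W_def max_def)
        moreover have "ln (norm (?b \<zeta>)) \<le> L" unfolding L_def using elim C1 by (subst ln_le_cancel_iff) auto
        ultimately have "ennreal (norm (L - ln (norm (?b \<zeta>)))) = ennreal (U k \<zeta>)" by simp
        also have "\<dots> \<le> S \<zeta>" unfolding S_def by (rule SUP_upper) simp
        finally show ?case .
      qed
    qed
    then show "(\<integral>\<^sup>+\<zeta>. ennreal (norm (L - ln (norm (?b \<zeta>)))) \<partial>?M) < \<infinity>"
      using Sfin by (rule le_less_trans)
  qed measurable
  then have "integrable ?M (\<lambda>\<zeta>. L - (L - ln (norm (?b \<zeta>))))" by (rule Bochner_Integration.integrable_diff[OF circle.integrable_const])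
  then show "integrable ?M (\<lambda>\<zeta>. ln (norm (?b \<zeta>)))" by simp
qed

text \<open>The minorant is the outer function with
  \<open>W = ln (norm (boundary \<phi> \<zeta>))\<close>. An inequality of boundary moduli is enough
  for comparing ranges, and it follows from comparison with outer functions of the truncated
  logarithms.\<close>

lemma outer_minorant:
  assumes \<phi>: "\<phi> \<in> Hinf" and z0: "norm z0 < 1" "\<phi> z0 \<noteq> 0"
  obtains \<psi> where "\<psi> \<in> Hinf" "outer_function \<psi>"
    "AE \<zeta> in circle_measure. norm (boundary \<psi> \<zeta>) \<le> norm (boundary \<phi> \<zeta>)"
proof -
  let ?b = "boundary \<phi>" and ?M = circle_measure
  define W where "W \<zeta> = ln (norm (?b \<zeta>))" for \<zeta>
  have [measurable]: "?b \<in> borel_measurable ?M" by (rule measurable_boundary_Hinf[OF \<phi>])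
  have [measurable]: "W \<in> borel_measurable ?M" unfolding W_def by measurable
  have nz: "AE \<zeta> in ?M. ?b \<zeta> \<noteq> 0" by (rule AE_boundary_nonzero[OF \<phi> z0])
  have Wi: "integrable ?M W" unfolding W_def by (rule integrable_ln_norm_boundary[OF \<phi> z0])
  obtain C0 where C0: "\<And>z. norm z < 1 \<Longrightarrow> norm (\<phi> z) \<le> C0" using Hinf_bound[OF \<phi>] by blast
  define C where "C = max C0 1"
  have C1: "C \<ge> 1" and "\<And>z. norm z < 1 \<Longrightarrow> norm (\<phi> z) \<le> C" using C0 by (auto simp: C_def le_max_iff_disj)
  from AE_norm_boundary_le[OF \<phi> this(2)] have bC: "AE \<zeta> in ?M. norm (?b \<zeta>) \<le> C" .
  have Wle: "AE \<zeta> in ?M. W \<zeta> \<le> ln C"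
    using bC nz by eventually_elim (use C1 in \<open>simp add: W_def\<close>)
  let ?\<psi> = "\<lambda>z. exp (herglotz W z)"
  have \<psi>: "?\<psi> \<in> Hinf" by (rule exp_herglotz_Hinf[OF Wi Wle])
  have outer: "outer_function ?\<psi>"
    unfolding outer_function_def herglotz_def using Wi by (intro exI[of _ 1] exI[of _ W]) simp
  \<comment> \<open>Raising \<open>W\<close> to \<open>max (W \<zeta>) (- real m)\<close> raises the
    modulus throughout the disk because the Poisson kernel is positive; the truncated logarithm is
    bounded, so the boundary modulus of its outer function is known.\<close>
  have le: "AE \<zeta> in ?M. norm (boundary ?\<psi> \<zeta>) \<le> exp (max (W \<zeta>) (- real m))" for m :: nat
  proof -
    let ?V = "\<lambda>\<zeta>. max (W \<zeta>) (- real m)" and ?r = "\<lambda>k. 1 - 1 / (real k + 2)"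
    let ?O = "\<lambda>z. exp (herglotz ?V z)"
    have Vi: "integrable ?M ?V" using Wi by (intro integrable_max) auto
    have Vb: "AE \<zeta> in ?M. \<bar>?V \<zeta>\<bar> \<le> ln C + real m"
      using Wle
    proof eventually_elim
      case (elim \<zeta>)
      have "ln C \<ge> 0" using C1 by simp
      then show ?case using elim by (auto simp: abs_le_iff max_def)
    qed
    have "AE \<zeta> in ?M. ?V \<zeta> \<le> ln C + real m" using Vb by eventually_elim linarith
    then have O: "?O \<in> Hinf" by (rule exp_herglotz_Hinf[OF Vi])
    have "AE \<zeta> in ?M. norm (boundary ?O \<zeta>) = exp (?V \<zeta>)"
      by (rule AE_norm_boundary_exp_herglotz[OF _ Vb]) measurable
    moreover have "AE \<zeta> in ?M. norm \<zeta> = 1" by (rule AE_I2) simp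
    ultimately show ?thesis using boundary_radial_limit[OF \<psi>] boundary_radial_limit[OF O]
    proof eventually_elim
      case (elim \<zeta>)
      have "norm (boundary ?\<psi> \<zeta>) \<le> norm (boundary ?O \<zeta>)"
      proof (rule LIMSEQ_le[OF tendsto_norm[OF radial_sequence(2)[OF elim(3)]] tendsto_norm[OF radial_sequence(2)[OF elim(4)]]])
        have "norm (?\<psi> (complex_of_real (?r k) * \<zeta>)) \<le> norm (?O (complex_of_real (?r k) * \<zeta>))" for k
        proof -
          have "norm (complex_of_real (?r k) * \<zeta>) < 1"
            using radial_sequence(1)[of k] elim(2) by (simp add: norm_mult del: of_real_diff)
          then show ?thesis
            unfolding norm_exp_herglotz by (subst exp_le_cancel_iff) (rule Re_herglotz_mono[OF Wi Vi], auto)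
        qed
        then show "\<exists>N. \<forall>k\<ge>N. norm (?\<psi> (complex_of_real (?r k) * \<zeta>)) \<le> norm (?O (complex_of_real (?r k) * \<zeta>))" by blast
      qed
      then show ?case using elim(1) by simp
    qed
  qed
  then have "AE \<zeta> in ?M. \<forall>m::nat. norm (boundary ?\<psi> \<zeta>) \<le> exp (max (W \<zeta>) (- real m))"
    by (subst AE_all_countable) blast
  with nz have "AE \<zeta> in ?M. norm (boundary ?\<psi> \<zeta>) \<le> norm (?b \<zeta>)"
  proof eventually_elim
    case (elim \<zeta>)
    obtain m where m: "- W \<zeta> \<le> real m" using real_arch_simple by blast
    have "norm (boundary ?\<psi> \<zeta>) \<le> exp (max (W \<zeta>) (- real m))" using elim(2) by blast
    also have "max (W \<zeta>) (- real m) = W \<zeta>" using m by simp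
    \<comment> \<open>Since \<open>ln 0 = 0\<close>, this equality would fail at a zero of the
      boundary function.\<close>
    also have "exp (W \<zeta>) = norm (?b \<zeta>)" using elim(1) by (simp add: W_def)
    finally show ?case .
  qed
  with \<psi> outer that show ?thesis by blast
qed

lemma H2_power: "(\<lambda>\<zeta>. \<zeta> ^ n) \<in> H2"
  using l2_inner_powi[of "int n"] by (simp add: H2_def L2_power fourier_coeff_def)

lemma H2_zero: "(\<lambda>_. 0) \<in> H2"
  by (auto simp: H2_def fourier_coeff_def l2_inner_def intro: L2_continuous)

text \<open>
  Truncating \<open>W\<close> from below gives bounded \<open>\<psi> n\<close> for which \<open>\<phi> * \<psi> n\<close> is bounded by \<open>1\<close> and tends
  to the unimodular constant of \<open>\<phi>\<close> in \<open>H\<^sup>2\<close>; hence \<open>\<phi> H\<^sup>2\<close> is dense.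
\<close>

lemma outer_multiples_dense:
  assumes \<phi>: "\<phi> \<in> Hinf" and outer: "outer_function \<phi>" and f: "f \<in> H2"
    and orth: "\<And>g. g \<in> H2 \<Longrightarrow> l2_inner f (\<lambda>\<zeta>. boundary \<phi> \<zeta> * g \<zeta>) = 0"
  shows "AE \<zeta> in circle_measure. f \<zeta> = 0"
proof -
  let ?M = circle_measure
  obtain \<gamma> W where \<gamma>: "norm \<gamma> = 1" and W: "integrable ?M W"
    and \<phi>_eq: "\<And>z. norm z < 1 \<Longrightarrow> \<phi> z = \<gamma> * exp (herglotz W z)"
    using outer unfolding outer_function_def herglotz_def by auto
  note [measurable] = borel_measurable_integrable[OF W]
  define V where "V n \<zeta> = max (W \<zeta>) (- real n)" for n \<zeta>
  have Vi: "integrable ?M (V n)" for n unfolding V_def using W by (intro integrable_max) auto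
  define \<psi> where "\<psi> n z = exp (herglotz (\<lambda>\<xi>. - V n \<xi>) z)" for n z
  have \<psi>: "\<psi> n \<in> Hinf" for n
    unfolding \<psi>_def by (rule exp_herglotz_Hinf[OF Bochner_Integration.integrable_minus[OF Vi], where c = "real n"]) (simp add: V_def)
  define q where "q n z = \<phi> z * \<psi> n z" for n z
  have q: "q n \<in> Hinf" for n unfolding q_def by (rule Hinf_mult[OF \<phi> \<psi>])
  \<comment> \<open>The logarithms subtract to \<open>W - V n\<close>, which is nonpositive and
    vanishes where \<open>W\<close> is at least \<open>- n\<close>; the first property gives the
    bound 1, the second the limit.\<close>
  have q_eq: "q n z = \<gamma> * exp (herglotz (\<lambda>\<xi>. W \<xi> - V n \<xi>) z)" if "norm z < 1" for n z
    unfolding q_def \<psi>_def \<phi>_eq[OF that] herglotz_diff[OF W Vi that] herglotz_uminus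
    by (simp add: exp_diff exp_minus divide_inverse)
  have di: "integrable ?M (\<lambda>\<xi>. W \<xi> - V n \<xi>)" for n using W Vi by simp
  have q1: "norm (q n z) \<le> 1" if "norm z < 1" for n z
  proof -
    have "Re (herglotz (\<lambda>\<xi>. W \<xi> - V n \<xi>) z) \<le> 0"
      by (rule Re_herglotz_le[OF di _ that]) (simp add: V_def)
    then show ?thesis by (simp add: q_eq[OF that] norm_mult \<gamma> norm_exp_herglotz)
  qed
  have q0: "(\<lambda>n. q n 0) \<longlonglongrightarrow> \<gamma>"
  proof -
    have "(\<lambda>n. \<integral>\<xi>. W \<xi> - V n \<xi> \<partial>?M) \<longlonglongrightarrow> (\<integral>\<xi>. 0 \<partial>?M)"
    proof (rule integral_dominated_convergence[where w = "\<lambda>\<xi>. \<bar>W \<xi>\<bar>"])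
      show "AE \<xi> in ?M. (\<lambda>n. W \<xi> - V n \<xi>) \<longlonglongrightarrow> 0"
      proof (rule AE_I2)
        fix \<xi>
        obtain N where N: "- W \<xi> \<le> real N" using real_arch_simple by blast
        show "(\<lambda>n. W \<xi> - V n \<xi>) \<longlonglongrightarrow> 0"
          by (rule tendsto_eventually, rule eventually_sequentiallyI[of N]) (use N in \<open>simp add: V_def max_def\<close>)
      qed
      show "AE \<xi> in ?M. norm (W \<xi> - V n \<xi>) \<le> \<bar>W \<xi>\<bar>" for n
        by (rule AE_I2) (simp add: V_def max_def)
      show "(\<lambda>\<xi>. W \<xi> - V n \<xi>) \<in> borel_measurable ?M" for n
        by (rule borel_measurable_integrable[OF di])
    qed (use W in auto)
    then have "(\<lambda>n. \<gamma> * exp (complex_of_real (\<integral>\<xi>. W \<xi> - V n \<xi> \<partial>?M))) \<longlonglongrightarrow> \<gamma> * exp (complex_of_real (\<integral>\<xi>. 0 \<partial>?M))"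
      by (intro tendsto_intros)
    then show ?thesis by (simp only: q_eq[of 0, simplified] herglotz_at_0) simp
  qed
  have c: "(\<lambda>_. \<gamma>) \<in> L2" by (intro L2_continuous continuous_intros)
  have bqL2: "boundary (q n) \<in> L2" for n by (rule H2_L2[OF boundary_H2[OF q]])
  \<comment> \<open>Expanding the square leaves norms at most 1 and the inner product with the
    constant \<open>\<gamma>\<close>. That product is a mean value, hence
    \<open>q n 0 * cnj \<gamma>\<close>, so convergence at the centre forces convergence in
    L^2.\<close>
  have lim: "(\<lambda>n. l2_sq (\<lambda>\<zeta>. boundary (q n) \<zeta> - \<gamma>)) \<longlonglongrightarrow> 0"
  proof (rule tendsto_sandwich[OF _ _ tendsto_const])
    have "(\<lambda>n. 2 - 2 * Re (q n 0 * cnj \<gamma>)) \<longlonglongrightarrow> 2 - 2 * Re (\<gamma> * cnj \<gamma>)"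
      by (intro tendsto_intros q0)
    moreover have "\<gamma> * cnj \<gamma> = 1" using complex_norm_square[of \<gamma>] \<gamma> by simp
    ultimately show "(\<lambda>n. 2 - 2 * Re (q n 0 * cnj \<gamma>)) \<longlonglongrightarrow> 0" by simp
    have "l2_sq (\<lambda>\<zeta>. boundary (q n) \<zeta> - \<gamma>) \<le> 2 - 2 * Re (q n 0 * cnj \<gamma>)" for n
    proof -
      have "l2_sq (boundary (q n)) \<le> (\<integral>\<zeta>. 1 \<partial>?M)"
        unfolding l2_sq_def
      proof (rule integral_mono_AE[OF L2_integrable_sq[OF bqL2]])
        show "AE \<zeta> in ?M. (norm (boundary (q n) \<zeta>))\<^sup>2 \<le> 1"
        proof -
          have "AE \<zeta> in ?M. norm (boundary (q n) \<zeta>) \<le> 1" by (rule AE_norm_boundary_le[OF q]) (rule q1)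
          then show ?thesis by eventually_elim (simp add: power_le_one)
        qed
      qed simp
      moreover have "(\<integral>\<zeta>. 1 \<partial>?M) = (1::real)" using circle.prob_space by simp
      moreover have "l2_sq (\<lambda>_. \<gamma>) = 1" unfolding l2_sq_def using circle.prob_space \<gamma> by simp
      moreover have "l2_inner (boundary (q n)) (\<lambda>_. \<gamma>) = q n 0 * cnj \<gamma>"
        unfolding l2_inner_def Hinf_eq_integral_boundary[OF q] by simp
      ultimately show ?thesis unfolding l2_sq_diff[OF bqL2 c] by simp
    qed
    then show "\<forall>\<^sub>F n in sequentially. l2_sq (\<lambda>\<zeta>. boundary (q n) \<zeta> - \<gamma>) \<le> 2 - 2 * Re (q n 0 * cnj \<gamma>)"
      by (intro always_eventually) blast
  qed (simp add: always_eventually)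
  have "fourier_coeff f (int m) = fourier_coeff (\<lambda>_. 0) (int m)" for m
  proof -
    \<comment> \<open>Shifting the power onto \<open>f\<close> leaves \<open>boundary (q n)\<close>
      alone, so its L^2 limit \<open>\<gamma>\<close> can be inserted; what remains is
      \<open>\<gamma>\<close> times the conjugate of the \<open>m\<close>-th coefficient of
      \<open>f\<close>.\<close>
    let ?g = "\<lambda>\<zeta>. cnj (\<zeta> ^ m) * f \<zeta>"
    have g: "?g \<in> L2"
      by (rule L2_bounded_mult[OF H2_L2[OF f], where C = 1])
         (auto intro: measurable_circle_continuous continuous_intros simp: norm_power)
    have "l2_inner (boundary (q n)) ?g = 0" for n
    proof -
      have bg: "(\<lambda>\<zeta>. boundary (\<psi> n) \<zeta> * \<zeta> ^ m) \<in> H2" by (rule boundary_mult_H2[OF \<psi> H2_power])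
      have "l2_inner f (\<lambda>\<zeta>. boundary (q n) \<zeta> * \<zeta> ^ m) = l2_inner f (\<lambda>\<zeta>. boundary \<phi> \<zeta> * (boundary (\<psi> n) \<zeta> * \<zeta> ^ m))"
      proof (rule l2_inner_cong_AE)
        show "AE \<zeta> in ?M. boundary (q n) \<zeta> * \<zeta> ^ m = boundary \<phi> \<zeta> * (boundary (\<psi> n) \<zeta> * \<zeta> ^ m)"
          using AE_boundary_mult[OF \<phi> \<psi>, of n] by (elim eventually_mono) (simp add: q_def[abs_def])
      qed ((intro L2_measurable H2_L2 f boundary_mult_H2 q \<phi> \<psi> H2_power)+, simp)
      also have "\<dots> = 0" by (rule orth[OF bg])
      finally have "cnj (l2_inner f (\<lambda>\<zeta>. boundary (q n) \<zeta> * \<zeta> ^ m)) = 0" by simp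
      moreover have "l2_inner (boundary (q n)) ?g = cnj (l2_inner f (\<lambda>\<zeta>. boundary (q n) \<zeta> * \<zeta> ^ m))"
        unfolding l2_inner_def Bochner_Integration.integral_cnj[symmetric] by (simp add: mult_ac)
      ultimately show ?thesis by simp
    qed
    moreover have "(\<lambda>n. l2_inner (boundary (q n)) ?g) \<longlonglongrightarrow> l2_inner (\<lambda>_. \<gamma>) ?g"
      by (rule l2_inner_tendsto[OF bqL2 c g lim])
    ultimately have "l2_inner (\<lambda>_. \<gamma>) ?g = 0" using LIMSEQ_unique[OF _ tendsto_const] by simp
    moreover have "l2_inner (\<lambda>_. \<gamma>) ?g = \<gamma> * cnj (fourier_coeff f (int m))"
      unfolding fourier_coeff_def l2_inner_def Bochner_Integration.integral_cnj[symmetric]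
      by (subst integral_mult_right_zero[symmetric]) (simp add: mult_ac)
    ultimately have "fourier_coeff f (int m) = 0" using \<gamma> by auto
    then show ?thesis by (simp add: fourier_coeff_def l2_inner_def)
  qed
  then show ?thesis by (rule H2_AE_eqI[OF f H2_zero])
qed

section \<open>Coefficient decay and comparison of the common ranges\<close>

text \<open>The decay makes the coefficients absolutely summable. Their power series is continuous
  on the closed disk, hence bounded, and its boundary function has the coefficients of
  \<open>f\<close>.\<close>

lemma root_exp_decay_Hinf:
  assumes f: "f \<in> H2" and decay: "root_exp_decay f"
  shows "f \<in> ae_closure (boundary ` Hinf)"
proof -
  define a where "a n = fourier_coeff f (int n)" for n
  obtain c where c: "c > 0" "(\<lambda>n. norm (a n)) \<in> O(\<lambda>n. exp (- c * sqrt (real n)))"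
    using decay unfolding root_exp_decay_def a_def by blast
  have "(\<lambda>n. exp (- c * sqrt (real n))) \<in> O(\<lambda>n. 1 / (real n)\<^sup>2)"
    using c(1) by real_asymp
  with c(2) have "(\<lambda>n. norm (a n)) \<in> O(\<lambda>n. 1 / (real n)\<^sup>2)" by (rule landau_o.big_trans)
  moreover have "summable (\<lambda>n. norm (1 / (real n)\<^sup>2))"
    using inverse_power_summable[of 2, where 'a = real] by (simp add: divide_inverse power_inverse)
  ultimately have a: "summable (\<lambda>n. norm (a n))" by (rule summable_comparison_test_bigo[rotated])
  define \<phi> where "\<phi> z = (\<Sum>n. a n * z ^ n)" for z
  note sums = power_series_sums_cball[OF a, folded \<phi>_def]
  note cont = power_series_continuous_cball[OF a, folded \<phi>_def]
  have \<phi>: "\<phi> \<in> Hinf"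
  proof -
    have "\<phi> holomorphic_on ball 0 1"
      by (rule power_series_holomorphic[where a = a]) (auto intro: sums)
    moreover have "bounded (\<phi> ` ball 0 1)"
      by (rule bounded_subset[OF compact_imp_bounded[OF compact_continuous_image[OF cont compact_cball]]]) auto
    ultimately show ?thesis by (simp add: Hinf_def)
  qed
  have bd: "boundary \<phi> \<zeta> = \<phi> \<zeta>" if "norm \<zeta> = 1" for \<zeta>
  proof (rule boundary_eqI)
    have "continuous_on {0..1} (\<lambda>r. \<phi> (complex_of_real r * \<zeta>))"
      by (rule continuous_on_compose2[OF cont]) (auto intro!: continuous_intros simp: norm_mult that)
    from continuous_on_Icc_at_leftD[OF this] show "has_radial_limit \<phi> \<zeta> (\<phi> \<zeta>)"
      by (simp add: has_radial_limit_def)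
  qed
  have "(\<lambda>n. a n * \<zeta> ^ n) sums boundary \<phi> \<zeta>" if "norm \<zeta> = 1" for \<zeta>
    using sums[of \<zeta>] that by (simp add: bd)
  from fourier_coeff_power_series[OF a this] have "fourier_coeff f (int n) = fourier_coeff (boundary \<phi>) (int n)" for n
    by (simp add: a_def)
  then have "AE \<zeta> in circle_measure. f \<zeta> = boundary \<phi> \<zeta>"
    by (rule H2_AE_eqI[OF f boundary_H2[OF \<phi>]])
  then show ?thesis using \<phi> L2_measurable[OF H2_L2[OF f]] by (auto simp: ae_closure_def)
qed

lemma boundary_1: "boundary (\<lambda>_. 1) = (\<lambda>_. 1)"
  by (intro ext boundary_eqI) (simp add: has_radial_limit_def)

lemma outer_function_nonzero: "outer_function \<phi> \<Longrightarrow> \<phi> 0 \<noteq> 0"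
  unfolding outer_function_def by fastforce

lemma model_space_H2: "f \<in> model_space u \<Longrightarrow> f \<in> H2"
  by (simp add: model_space_def)

lemma model_space_cong_AE:
  assumes u: "u \<in> Hinf" and f: "f \<in> model_space u" and g: "g \<in> borel_measurable circle_measure"
    and ae: "AE \<zeta> in circle_measure. g \<zeta> = f \<zeta>"
  shows "g \<in> model_space u"
proof -
  have "l2_inner g (\<lambda>\<zeta>. boundary u \<zeta> * h \<zeta>) = l2_inner f (\<lambda>\<zeta>. boundary u \<zeta> * h \<zeta>)" if "h \<in> H2" for h
    by (rule l2_inner_cong_AE)
       (use ae in \<open>auto intro: g L2_measurable H2_L2 model_space_H2[OF f] boundary_mult_H2 u that\<close>)
  then show ?thesis
    using f H2_cong_AE[OF model_space_H2[OF f] g ae] by (simp add: model_space_def)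
qed

text \<open>The constant 1 is outer, with \<open>W = 0\<close>, and its operator is the identity up
  to null sets.\<close>

lemma common_range_model_subset_model_space:
  assumes u: "u \<in> Hinf" shows "common_range_model u \<subseteq> model_space u"
proof
  fix f assume "f \<in> common_range_model u"
  moreover have "(\<lambda>_. 1) \<in> Hinf" by (rule HinfI[where C = 1]) auto
  moreover have "outer_function (\<lambda>_. 1)"
    unfolding outer_function_def by (intro exI[of _ 1] exI[of _ "\<lambda>_. 0"]) simp
  ultimately have "f \<in> ae_closure (coanalytic_toeplitz (\<lambda>_. 1) ` model_space u)"
    by (auto simp: common_range_model_def)
  then obtain g where g: "g \<in> model_space u" and f: "f \<in> borel_measurable circle_measure"
    and ae: "AE \<zeta> in circle_measure. f \<zeta> = P_plus g \<zeta>"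
    by (auto simp: ae_closure_def coanalytic_toeplitz_def boundary_1)
  have "AE \<zeta> in circle_measure. g \<zeta> = P_plus g \<zeta>"
    by (rule AE_eq_P_plusI) (auto intro: H2_L2 model_space_H2[OF g])
  with ae have "AE \<zeta> in circle_measure. f \<zeta> = g \<zeta>" by eventually_elim simp
  then show "f \<in> model_space u" by (rule model_space_cong_AE[OF u g f])
qed

text \<open>
  If \<open>\<bar>\<psi>\<bar> \<le> \<bar>\<phi>\<bar>\<close> on the circle, then \<open>T\<close> with symbol \<open>cnj \<psi>\<close> factors through the one with
  symbol \<open>cnj \<phi>\<close>, by multiplying with the conjugate of the bounded quotient.
\<close>

lemma coanalytic_toeplitz_range_mono:
  assumes \<phi>: "\<phi> \<in> Hinf" and \<psi>: "\<psi> \<in> Hinf"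
    and le: "AE \<zeta> in circle_measure. norm (boundary \<psi> \<zeta>) \<le> norm (boundary \<phi> \<zeta>)"
  shows "ae_closure (coanalytic_toeplitz \<psi> ` H2) \<subseteq> ae_closure (coanalytic_toeplitz \<phi> ` H2)"
proof
  let ?M = circle_measure
  fix f assume "f \<in> ae_closure (coanalytic_toeplitz \<psi> ` H2)"
  then obtain g where g: "g \<in> H2" and fm: "f \<in> borel_measurable ?M"
    and ae: "AE \<zeta> in ?M. f \<zeta> = P_plus (\<lambda>\<zeta>. cnj (boundary \<psi> \<zeta>) * g \<zeta>) \<zeta>"
    by (auto simp: ae_closure_def coanalytic_toeplitz_def)
  note [measurable] = measurable_boundary_Hinf[OF \<phi>] measurable_boundary_Hinf[OF \<psi>]
  have \<psi>g: "(\<lambda>\<zeta>. cnj (boundary \<psi> \<zeta>) * g \<zeta>) \<in> L2" by (rule cnj_boundary_mult_L2[OF \<psi> H2_L2[OF g]])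
  have f: "f \<in> H2" by (rule H2_cong_AE[OF P_plus_H2[OF \<psi>g] fm ae])
  \<comment> \<open>Where \<open>boundary \<phi>\<close> is 0 the quotient is 0 by convention;
    almost everywhere there the inequality makes \<open>boundary \<psi>\<close> vanish as well, so
    the factorization still holds.\<close>
  define \<omega> where "\<omega> \<zeta> = cnj (boundary \<psi> \<zeta> / boundary \<phi> \<zeta>)" for \<zeta>
  have [measurable]: "\<omega> \<in> borel_measurable ?M" unfolding \<omega>_def by measurable
  have \<omega>g: "(\<lambda>\<zeta>. \<omega> \<zeta> * g \<zeta>) \<in> L2"
  proof (rule L2_bounded_mult[OF H2_L2[OF g], where C = 1])
    show "AE \<zeta> in ?M. norm (\<omega> \<zeta>) \<le> 1"
      using le by eventually_elim (simp add: \<omega>_def norm_divide divide_le_eq)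
  qed measurable
  define h where "h = P_plus (\<lambda>\<zeta>. \<omega> \<zeta> * g \<zeta>)"
  have h: "h \<in> H2" unfolding h_def by (rule P_plus_H2[OF \<omega>g])
  have "AE \<zeta> in ?M. f \<zeta> = P_plus (\<lambda>\<zeta>. cnj (boundary \<phi> \<zeta>) * h \<zeta>) \<zeta>"
  proof (rule AE_eq_P_plusI[OF cnj_boundary_mult_L2[OF \<phi> H2_L2[OF h]] f])
    fix w assume w: "w \<in> H2"
    have \<phi>w: "(\<lambda>\<zeta>. boundary \<phi> \<zeta> * w \<zeta>) \<in> H2" by (rule boundary_mult_H2[OF \<phi> w])
    have "l2_inner (\<lambda>\<zeta>. cnj (boundary \<phi> \<zeta>) * h \<zeta>) w = l2_inner h (\<lambda>\<zeta>. boundary \<phi> \<zeta> * w \<zeta>)"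
      by (rule l2_inner_cnj_mult)
    also have "\<dots> = l2_inner (\<lambda>\<zeta>. \<omega> \<zeta> * g \<zeta>) (\<lambda>\<zeta>. boundary \<phi> \<zeta> * w \<zeta>)"
      unfolding h_def by (rule l2_inner_P_plus[OF \<omega>g \<phi>w])
    also have "\<dots> = l2_inner (\<lambda>\<zeta>. cnj (boundary \<phi> \<zeta>) * (\<omega> \<zeta> * g \<zeta>)) w"
      by (rule l2_inner_cnj_mult[symmetric])
    also have "\<dots> = l2_inner (\<lambda>\<zeta>. cnj (boundary \<psi> \<zeta>) * g \<zeta>) w"
    proof (rule l2_inner_cong_AE)
      show "AE \<zeta> in ?M. cnj (boundary \<phi> \<zeta>) * (\<omega> \<zeta> * g \<zeta>) = cnj (boundary \<psi> \<zeta>) * g \<zeta>"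
        using le by eventually_elim (auto simp: \<omega>_def)
    qed (use L2_measurable[OF cnj_boundary_mult_L2[OF \<phi> \<omega>g]] L2_measurable[OF \<psi>g] L2_measurable[OF H2_L2[OF w]] in auto)
    also have "\<dots> = l2_inner (P_plus (\<lambda>\<zeta>. cnj (boundary \<psi> \<zeta>) * g \<zeta>)) w"
      by (rule l2_inner_P_plus[OF \<psi>g w, symmetric])
    also have "\<dots> = l2_inner f w"
      by (rule l2_inner_cong_AE)
         (use ae in \<open>auto intro: fm L2_measurable H2_L2 w P_plus_H2 \<psi>g elim: eventually_mono\<close>)
    finally show "l2_inner f w = l2_inner (\<lambda>\<zeta>. cnj (boundary \<phi> \<zeta>) * h \<zeta>) w" by simp
  qed
  then show "f \<in> ae_closure (coanalytic_toeplitz \<phi> ` H2)"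
    using fm h by (auto simp: ae_closure_def coanalytic_toeplitz_def)
qed

lemma common_range_model_subset_common_range_H2: "common_range_model u \<subseteq> common_range_H2"
proof
  fix f assume f: "f \<in> common_range_model u"
  show "f \<in> common_range_H2"
    unfolding common_range_H2_def
  proof
    fix \<phi> assume "\<phi> \<in> {\<phi> \<in> Hinf. \<exists>z\<in>ball 0 1. \<phi> z \<noteq> 0}"
    then obtain z where \<phi>: "\<phi> \<in> Hinf" and z: "norm z < 1" "\<phi> z \<noteq> 0" by auto
    obtain \<psi> where \<psi>: "\<psi> \<in> Hinf" "outer_function \<psi>"
      and le: "AE \<zeta> in circle_measure. norm (boundary \<psi> \<zeta>) \<le> norm (boundary \<phi> \<zeta>)"
      using outer_minorant[OF \<phi> z] by blast
    have "f \<in> ae_closure (coanalytic_toeplitz \<psi> ` model_space u)"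
      using f \<psi> by (auto simp: common_range_model_def)
    then have "f \<in> ae_closure (coanalytic_toeplitz \<psi> ` H2)"
      by (auto simp: ae_closure_def intro: model_space_H2)
    then show "f \<in> ae_closure (coanalytic_toeplitz \<phi> ` H2)"
      using coanalytic_toeplitz_range_mono[OF \<phi> \<psi>(1) le] by blast
  qed
qed

text \<open>
  A preimage under an injective co-analytic Toeplitz operator of an element of the model space lies in
  the model space, because co-analytic Toeplitz operators commute.
\<close>

lemma common_range_H2_subset_common_range_model:
  assumes u: "u \<in> Hinf" shows "model_space u \<inter> common_range_H2 \<subseteq> common_range_model u"
proof
  let ?M = circle_measure
  fix f assume "f \<in> model_space u \<inter> common_range_H2"
  then have fu: "f \<in> model_space u" and fr: "f \<in> common_range_H2" by auto
  show "f \<in> common_range_model u"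
    unfolding common_range_model_def
  proof
    fix \<phi> assume "\<phi> \<in> {\<phi> \<in> Hinf. outer_function \<phi>}"
    then have \<phi>: "\<phi> \<in> Hinf" and outer: "outer_function \<phi>" by auto
    have "f \<in> ae_closure (coanalytic_toeplitz \<phi> ` H2)"
      using fr \<phi> outer_function_nonzero[OF outer] by (force simp: common_range_H2_def)
    then obtain h where h: "h \<in> H2" and fm: "f \<in> borel_measurable ?M"
      and ae: "AE \<zeta> in ?M. f \<zeta> = P_plus (\<lambda>\<zeta>. cnj (boundary \<phi> \<zeta>) * h \<zeta>) \<zeta>"
      by (auto simp: ae_closure_def coanalytic_toeplitz_def)
    have \<phi>h: "(\<lambda>\<zeta>. cnj (boundary \<phi> \<zeta>) * h \<zeta>) \<in> L2" by (rule cnj_boundary_mult_L2[OF \<phi> H2_L2[OF h]])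
    have uh: "(\<lambda>\<zeta>. cnj (boundary u \<zeta>) * h \<zeta>) \<in> L2" by (rule cnj_boundary_mult_L2[OF u H2_L2[OF h]])
    \<comment> \<open>By \<open>k_inner\<close> this function vanishes almost everywhere exactly
      when \<open>h\<close> is orthogonal to the multiples of \<open>boundary u\<close>, that is,
      when \<open>h\<close> lies in the model space.\<close>
    define k where "k = P_plus (\<lambda>\<zeta>. cnj (boundary u \<zeta>) * h \<zeta>)"
    have k: "k \<in> H2" unfolding k_def by (rule P_plus_H2[OF uh])
    have k_inner: "l2_inner k g = l2_inner h (\<lambda>\<zeta>. boundary u \<zeta> * g \<zeta>)" if "g \<in> H2" for g
      unfolding k_def l2_inner_P_plus[OF uh that] by (rule l2_inner_cnj_mult)
    have "AE \<zeta> in ?M. k \<zeta> = 0"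
    proof (rule outer_multiples_dense[OF \<phi> outer k])
      fix g assume g: "g \<in> H2"
      have ug: "(\<lambda>\<zeta>. boundary u \<zeta> * g \<zeta>) \<in> H2" by (rule boundary_mult_H2[OF u g])
      have "l2_inner k (\<lambda>\<zeta>. boundary \<phi> \<zeta> * g \<zeta>) = l2_inner h (\<lambda>\<zeta>. boundary u \<zeta> * (boundary \<phi> \<zeta> * g \<zeta>))"
        by (rule k_inner[OF boundary_mult_H2[OF \<phi> g]])
      \<comment> \<open>Commutation of the two operators appears here, on the adjoint side, as
        commutation of multiplications.\<close>
      also have "\<dots> = l2_inner h (\<lambda>\<zeta>. boundary \<phi> \<zeta> * (boundary u \<zeta> * g \<zeta>))"
        by (simp add: mult.left_commute)
      also have "\<dots> = l2_inner (\<lambda>\<zeta>. cnj (boundary \<phi> \<zeta>) * h \<zeta>) (\<lambda>\<zeta>. boundary u \<zeta> * g \<zeta>)"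
        by (rule l2_inner_cnj_mult[symmetric])
      also have "\<dots> = l2_inner (P_plus (\<lambda>\<zeta>. cnj (boundary \<phi> \<zeta>) * h \<zeta>)) (\<lambda>\<zeta>. boundary u \<zeta> * g \<zeta>)"
        by (rule l2_inner_P_plus[OF \<phi>h ug, symmetric])
      also have "\<dots> = l2_inner f (\<lambda>\<zeta>. boundary u \<zeta> * g \<zeta>)"
        by (rule l2_inner_cong_AE)
           (use ae in \<open>auto intro: fm L2_measurable[OF H2_L2[OF ug]] L2_measurable H2_L2 P_plus_H2 \<phi>h elim: eventually_mono\<close>)
      also have "\<dots> = 0" using fu g by (simp add: model_space_def)
      finally show "l2_inner k (\<lambda>\<zeta>. boundary \<phi> \<zeta> * g \<zeta>) = 0" .
    qed
    then have "l2_inner k g = l2_inner (\<lambda>_. 0) g" if "g \<in> H2" for g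
      by (intro l2_inner_cong_AE L2_measurable H2_L2 k H2_zero that) auto
    then have "l2_inner h (\<lambda>\<zeta>. boundary u \<zeta> * g \<zeta>) = 0" if "g \<in> H2" for g
      using that k_inner[OF that] by (simp add: l2_inner_def)
    then have "h \<in> model_space u" using h by (simp add: model_space_def)
    then show "f \<in> ae_closure (coanalytic_toeplitz \<phi> ` model_space u)"
      using fm ae by (auto simp: ae_closure_def coanalytic_toeplitz_def)
  qed
qed

theorem theorem8p7:
  fixes u :: "complex \<Rightarrow> complex"
  assumes mccarthy: "common_range_H2 = {f \<in> ae_closure (boundary ` Hinf). root_exp_decay f}"
    and inner: "inner_function u"
  shows "common_range_model u = model_space u \<inter> common_range_H2 \<and>
         model_space u \<inter> common_range_H2 = {f \<in> model_space u. root_exp_decay f}"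
proof
  have u: "u \<in> Hinf" using inner by (simp add: inner_function_def)
  show "common_range_model u = model_space u \<inter> common_range_H2"
    using common_range_model_subset_model_space[OF u] common_range_model_subset_common_range_H2
      common_range_H2_subset_common_range_model[OF u] by blast
  \<comment> \<open>Unfolding the known description leaves its requirement that \<open>f\<close> be
    the boundary function of some member of \<open>Hinf\<close>; inside the model space the decay
    supplies it.\<close>
  show "model_space u \<inter> common_range_H2 = {f \<in> model_space u. root_exp_decay f}"
    unfolding mccarthy by (auto intro: root_exp_decay_Hinf model_space_H2)
qed

end
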